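(* Let $a\in C^\infty(\mathbb T;\mathbb R)$, $a_0=\frac1{2\pi}\int_0^{2\pi}a(t)\,dt$, and $A(t)=\int_0^t(a(\sigma)-a_0)\,d\sigma$ (a $2\pi$-periodic smooth function). For $u\in\mathcal D'(\mathbb T^2)$ let $(\Psi_{\pm A}u)(t,x)=u(t,x\mp A(t))$, understood as pullback by a smooth diffeomorphism. Let $s_1,s_2\in\mathbb R$. Then $$\Psi_{\pm A}\colon H_{\mathrm{mix}}^{(s_1,s_2)}(\mathbb T^2)\longrightarrow H_{\mathrm{mix}}^{(s_1,\,s_2-|s_1|)}(\mathbb T^2)$$ is continuous. More precisely, there is a constant $C>0$ depending only on $A,s_1$ such that $$\|\Psi_{\pm A}u\|_{H_{\mathrm{mix}}^{(s_1,\,s_2-|s_1|)}(\mathbb T^2)}\le C\,\|u\|_{H_{\mathrm{mix}}^{(s_1,s_2)}(\mathbb T^2)}$$ for all $u\in H_{\mathrm{mix}}^{(s_1,s_2)}(\mathbb T^2)$.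
   Context: $\mathbb T=\mathbb R/2\pi\mathbb Z$, with variables $(t,x)\in\mathbb T^2$ and dual frequencies $(\tau,\xi)\in\mathbb Z^2$. $\mathcal D'(\mathbb T^2)$ is the space of distributions on $\mathbb T^2$. Fourier coefficients are $\widehat f(\tau,\xi)=\frac1{(2\pi)^2}\int_{\mathbb T^2}f(t,x)e^{-i(t\tau+x\xi)}\,dt\,dx$ (by duality for distributions). $\langle w\rangle=(1+|w|^2)^{1/2}$. For $s_1,s_2\in\mathbb R$, $H_{\mathrm{mix}}^{(s_1,s_2)}(\mathbb T^2)$ is the space of $f\in\mathcal D'(\mathbb T^2)$ with $\|f\|_{H_{\mathrm{mix}}^{(s_1,s_2)}(\mathbb T^2)}^2=\sum_{(\tau,\xi)\in\mathbb Z^2}\langle\tau\rangle^{2s_1}\langle\xi\rangle^{2s_2}|\widehat f(\tau,\xi)|^2<\infty$. *)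

theory Defs
  imports "HOL-Analysis.Analysis"
begin

section \<open>Smooth functions\<close>

definition dir_deriv ::
  "'a::real_normed_vector \<Rightarrow> ('a \<Rightarrow> 'b::real_normed_vector) \<Rightarrow> 'a \<Rightarrow> 'b" where
  "dir_deriv v f = (\<lambda>z. frechet_derivative f (at z) v)"

text \<open>Every iterated partial derivative, in whatever order the partial derivatives are taken,
  exists and is again (Frechet) differentiable; complex values are treated as a real vector space.\<close>

definition smooth :: "('a::euclidean_space \<Rightarrow> 'b::real_normed_vector) \<Rightarrow> bool" where
  "smooth f \<longleftrightarrow> (\<forall>vs. set vs \<subseteq> Basis \<longrightarrow> (foldr dir_deriv vs f) differentiable_on UNIV)"

text \<open>Functions on the circle \<open>\<real>/2\<pi>\<int>\<close> and on its square are represented by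
  their periodic lifts to \<open>\<real>\<close> and \<open>\<real>\<^sup>2\<close>.\<close>

definition smooth_circle :: "(real \<Rightarrow> real) set" where
  "smooth_circle = {a. smooth a \<and> (\<forall>t. a (t + 2 * pi) = a t)}"

definition test_fun :: "(real \<times> real \<Rightarrow> complex) set" where
  "test_fun = {\<phi>. smooth \<phi> \<and>
     (\<forall>t x. \<phi> (t + 2 * pi, x) = \<phi> (t, x) \<and> \<phi> (t, x + 2 * pi) = \<phi> (t, x))}"

section \<open>Distributions on the two-dimensional torus\<close>

definition test_seminorm :: "nat \<Rightarrow> (real \<times> real \<Rightarrow> complex) \<Rightarrow> real" where
  "test_seminorm N \<phi> = (\<Sum>m\<le>N. \<Sum>j\<le>m.
     (SUP z. norm ((dir_deriv (1, 0) ^^ j) ((dir_deriv (0, 1) ^^ (m - j)) \<phi>) z)))"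

text \<open>A distribution is a continuous complex-linear functional on the test functions. It is
  set to \<open>0\<close> on arguments that are not test functions, so that distributions that agree
  on all test functions are equal. A function \<open>f\<close> corresponds to the functional
  \<open>\<phi> \<mapsto> \<integral> f \<phi> dt dx\<close> (no complex conjugation, no normalising factor).\<close>

type_synonym functional = "(real \<times> real \<Rightarrow> complex) \<Rightarrow> complex"

definition distributions :: "functional set" where
  "distributions = {u.
     (\<forall>\<phi>\<in>test_fun. \<forall>\<psi>\<in>test_fun. u (\<lambda>z. \<phi> z + \<psi> z) = u \<phi> + u \<psi>) \<and>
     (\<forall>c. \<forall>\<phi>\<in>test_fun. u (\<lambda>z. c * \<phi> z) = c * u \<phi>) \<and>
     (\<exists>N C. \<forall>\<phi>\<in>test_fun. norm (u \<phi>) \<le> C * test_seminorm N \<phi>) \<and>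
     (\<forall>\<phi>. \<phi> \<notin> test_fun \<longrightarrow> u \<phi> = 0)}"

definition fourier_coeff :: "functional \<Rightarrow> int \<Rightarrow> int \<Rightarrow> complex" where
  "fourier_coeff u \<tau> \<xi> =
     1 / (2 * of_real pi)^2 *
       u (\<lambda>(t, x). exp (- \<i> * of_real (t * of_int \<tau> + x * of_int \<xi>)))"

section \<open>Sobolev spaces of mixed order\<close>

definition japanese :: "real \<Rightarrow> real" where
  "japanese w = sqrt (1 + \<bar>w\<bar>^2)"

definition Hmix_term :: "real \<Rightarrow> real \<Rightarrow> functional \<Rightarrow> int \<times> int \<Rightarrow> real" where
  "Hmix_term s1 s2 u = (\<lambda>(\<tau>, \<xi>).
     japanese (of_int \<tau>) powr (2 * s1) * japanese (of_int \<xi>) powr (2 * s2) *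
       (norm (fourier_coeff u \<tau> \<xi>))^2)"

definition Hmix :: "real \<Rightarrow> real \<Rightarrow> functional set" where
  "Hmix s1 s2 = {u \<in> distributions. Hmix_term s1 s2 u summable_on UNIV}"

definition Hmix_norm :: "real \<Rightarrow> real \<Rightarrow> functional \<Rightarrow> real" where
  "Hmix_norm s1 s2 u = sqrt (\<Sum>\<^sub>\<infinity>p. Hmix_term s1 s2 u p)"

definition Hmix_continuous ::
  "real \<Rightarrow> real \<Rightarrow> real \<Rightarrow> real \<Rightarrow> (functional \<Rightarrow> functional) \<Rightarrow> bool" where
  "Hmix_continuous s1 s2 r1 r2 T \<longleftrightarrow>
     (\<forall>u\<in>Hmix s1 s2. T u \<in> Hmix r1 r2) \<and>
     (\<forall>u\<in>Hmix s1 s2. \<forall>\<epsilon>>0. \<exists>\<delta>>0. \<forall>v\<in>Hmix s1 s2.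
        Hmix_norm s1 s2 (\<lambda>\<phi>. v \<phi> - u \<phi>) < \<delta> \<longrightarrow>
        Hmix_norm r1 r2 (\<lambda>\<phi>. T v \<phi> - T u \<phi>) < \<epsilon>)"

section \<open>Pullback by a diffeomorphism\<close>

definition jacobian :: "(real \<times> real \<Rightarrow> real \<times> real) \<Rightarrow> real \<times> real \<Rightarrow> real" where
  "jacobian F z = (let L = frechet_derivative F (at z) in
     fst (L (1, 0)) * snd (L (0, 1)) - fst (L (0, 1)) * snd (L (1, 0)))"

text \<open>Here \<open>F\<close> is the lift to \<open>\<real>\<^sup>2\<close> of a diffeomorphism of the torus. The formula is the
  change of variables \<open>\<integral> (f \<circ> F) \<phi> = \<integral> f (\<phi> \<circ> F\<^sup>-\<^sup>1) \<bar>det DF\<^sup>-\<^sup>1\<bar>\<close>, so that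
  \<open>pullback F u\<close> extends \<open>u \<mapsto> u \<circ> F\<close> from functions to distributions.\<close>

definition pullback :: "(real \<times> real \<Rightarrow> real \<times> real) \<Rightarrow> functional \<Rightarrow> functional" where
  "pullback F u = (\<lambda>\<phi>. if \<phi> \<in> test_fun
     then u (\<lambda>z. of_real \<bar>jacobian (inv F) z\<bar> * \<phi> (inv F z)) else 0)"

definition Psi :: "(real \<Rightarrow> real) \<Rightarrow> functional \<Rightarrow> functional" where
  "Psi B = pullback (\<lambda>(t, x). (t, x - B t))"

section \<open>The mean-free primitive of a periodic function\<close>

definition mean :: "(real \<Rightarrow> real) \<Rightarrow> real" where
  "mean a = 1 / (2 * pi) * (LBINT t=0..2 * pi. a t)"

text \<open>The interval integral is oriented, so negative \<open>t\<close> are covered.\<close>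

definition mean_free_primitive :: "(real \<Rightarrow> real) \<Rightarrow> real \<Rightarrow> real" where
  "mean_free_primitive a t = (LBINT \<sigma>=0..t. (a \<sigma> - mean a))"

end

theory Submission
  imports Defs
begin

text \<open>On the \<open>\<xi>\<close>-th Fourier mode in \<open>x\<close> the pullback is multiplication by the phase
  \<open>exp (- \<i> \<xi> B(t))\<close>, whose \<open>m\<close>-th derivative is bounded by a constant times \<open>\<langle>\<xi>\<rangle>\<^sup>m\<close>.
  With \<open>\<lambda> = \<langle>\<xi>\<rangle>\<close>, cut the frequencies \<open>\<tau>\<close> into dyadic blocks according to \<open>max 1 (\<bar>\<tau>\<bar> / \<lambda>)\<close>.
  The multiplication is bounded on \<open>L\<^sup>2\<close> and, between blocks \<open>i\<close> and \<open>j\<close>, has norm at most a constant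
  times \<open>2\<close> to the power \<open>- N \<bar>i - j\<bar>\<close>. Summing over the blocks, it is bounded on the space with
  weight \<open>max 1 (\<bar>\<tau>\<bar> / \<lambda>)\<close> to any real power \<open>s\<close>, uniformly in \<open>\<xi>\<close>, and replacing this weight by
  \<open>\<langle>\<tau>\<rangle>\<close> costs the factor \<open>\<lambda>\<close> to the power \<open>\<bar>s\<bar>\<close>. This treats negative and fractional \<open>s\<close>
  directly, without duality or interpolation.\<close>

section \<open>Derivative bounds for functions on the circle\<close>

text \<open>The loss \<open>|s1|\<close> has a single source: with
  \<open>w = max 1 (|\<tau>| / \<lambda>)\<close> one has \<open>w \<le> \<langle>\<tau>\<rangle>
  \<le> sqrt 2 * \<lambda> * w\<close>. Passing to \<open>w\<close> and back therefore costs nothing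
  in one direction and \<open>\<lambda>\<close> to the power \<open>|s1|\<close> in the other,
  whatever the sign of \<open>s1\<close>. Measured in units of \<lambda> the phase has derivative
  bounds uniform in \<xi>, which is why the blocks start at \<lambda> and not at 1. The decay
  exponent satisfies \<open>N \<ge> |s1| + 1\<close>: the part \<open>|s1|\<close> pays for the
  ratio of two block weights, and one more power makes the sum over blocks geometric. The
  \<xi>-weight is constant on each mode, so no constant sees \<open>s2\<close>. The obstacle is that
  \<open>u\<close> is only a distribution, and the Fourier coefficients of its pullback enter as
  limits of symmetric partial sums. Hence all estimates are made for finite sums, with constants
  independent of the index sets. The limit itself comes from the convergence of Fourier series
  together with all derivatives, because a distribution is controlled by finitely many derivatives
  of the test function.\<close>

text \<open>Unfolded, the m-th derivative is at most \<open>l ^ m * M\<close> for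
  \<open>m \<le> n\<close>, the recursion moving each factor \<open>l\<close> into the constant.
  Scale \<open>l = 1\<close> expresses ordinary smoothness,
  \<open>l = \<langle>\<xi>\<rangle>\<close> fits the phase. Level 0 asks for periodicity and a
  bound only, so continuity of the n-th derivative is read off from level
  \<open>n + 1\<close>.\<close>

fun circle_bound :: "real \<Rightarrow> nat \<Rightarrow> real \<Rightarrow> (real \<Rightarrow> complex) \<Rightarrow> bool" where
  "circle_bound l 0 M f \<longleftrightarrow> (\<forall>t. f (t + 2 * pi) = f t) \<and> (\<forall>t. norm (f t) \<le> M)"
| "circle_bound l (Suc n) M f \<longleftrightarrow> (\<forall>t. f (t + 2 * pi) = f t) \<and> (\<forall>t. norm (f t) \<le> M) \<and>
     (\<exists>f'. (\<forall>t. (f has_vector_derivative f' t) (at t)) \<and> circle_bound l n (l * M) f')"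

lemma circle_bound_D:
  assumes "circle_bound l n M f"
  shows "f (t + 2 * pi) = f t" "norm (f t) \<le> M"
  using assms by (cases n; auto)+

lemma circle_bound_SucI:
  assumes "\<And>t. f (t + 2 * pi) = f t" "\<And>t. norm (f t) \<le> M"
    "\<And>t. (f has_vector_derivative f' t) (at t)" "circle_bound l n (l * M) f'"
  shows "circle_bound l (Suc n) M f"
  using assms by auto

lemma circle_bound_nonneg: "circle_bound l n M f \<Longrightarrow> 0 \<le> M"
  using circle_bound_D(2) norm_ge_zero order_trans by blast

lemma circle_bound_lower:
  "circle_bound l n M f \<Longrightarrow> m \<le> n \<Longrightarrow> circle_bound l m M f"
proof (induction m arbitrary: n M f)
  case 0
  then show ?case using circle_bound_D by simp
next
  case (Suc m)
  then obtain n' where "n = Suc n'" by (metis Suc_le_D)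
  with Suc show ?case by auto
qed

lemma circle_bound_mono:
  "circle_bound l n M f \<Longrightarrow> M \<le> M' \<Longrightarrow> 0 \<le> l \<Longrightarrow> l \<le> l' \<Longrightarrow> circle_bound l' n M' f"
proof (induction n arbitrary: M M' f)
  case 0
  then show ?case by (auto intro: order_trans)
next
  case (Suc n)
  have "0 \<le> M" using Suc.prems(1) circle_bound_nonneg by blast
  then have "l * M \<le> l' * M'" using Suc.prems by (simp add: mult_mono)
  then show ?case using Suc.IH Suc.prems by (fastforce intro: order_trans)
qed

text \<open>As \<open>l \<ge> 1\<close>, every \<open>l ^ m\<close> with \<open>m \<le> n\<close> is
  at most \<open>l ^ n\<close>. This gives up the sharp scale for a poor constant, which is enough
  wherever only qualitative smoothness is asked.\<close>

lemma circle_bound_rescale: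
  "circle_bound l n M f \<Longrightarrow> 1 \<le> l \<Longrightarrow> circle_bound 1 n (l ^ n * M) f"
proof (induction n arbitrary: M f)
  case (Suc n)
  then obtain f' where
    f': "\<And>t. (f has_vector_derivative f' t) (at t)" "circle_bound l n (l * M) f'"
    by auto
  have "circle_bound 1 n (1 * (l ^ Suc n * M)) f'"
    using Suc.IH[OF f'(2)] Suc.prems(2) by (simp add: mult_ac)
  moreover have "norm (f t) \<le> l ^ Suc n * M" for t
  proof -
    have "norm (f t) \<le> 1 * M" using circle_bound_D(2)[OF Suc.prems(1)] by simp
    also have "\<dots> \<le> l ^ Suc n * M"
      using Suc.prems(2) circle_bound_nonneg[OF Suc.prems(1)] by (intro mult_right_mono one_le_power)
    finally show ?thesis .
  qed
  ultimately show ?case using circle_bound_D(1)[OF Suc.prems(1)] f'(1) by (intro circle_bound_SucI)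
qed simp

lemma circle_bound_add:
  "circle_bound l n M f \<Longrightarrow> circle_bound l n M' g \<Longrightarrow> circle_bound l n (M + M') (\<lambda>t. f t + g t)"
proof (induction n arbitrary: M M' f g)
  case 0
  then show ?case by (auto intro: norm_triangle_mono)
next
  case (Suc n)
  then obtain f' g' where
    f': "\<And>t. (f has_vector_derivative f' t) (at t)" "circle_bound l n (l * M) f'" and
    g': "\<And>t. (g has_vector_derivative g' t) (at t)" "circle_bound l n (l * M') g'"
    by auto
  have "circle_bound l n (l * (M + M')) (\<lambda>t. f' t + g' t)"
    using Suc.IH[OF f'(2) g'(2)] by (simp add: distrib_left)
  moreover have "((\<lambda>t. f t + g t) has_vector_derivative f' t + g' t) (at t)" for t
    using f'(1) g'(1) by (rule has_vector_derivative_add)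
  ultimately show ?case using Suc.prems
    by (intro circle_bound_SucI[where f' = "\<lambda>t. f' t + g' t"]) (auto intro: norm_triangle_mono)
qed

text \<open>The factor \<open>2 ^ n\<close> counts the terms of the Leibniz rule: each
  differentiation splits a product into two.\<close>

lemma circle_bound_mult:
  "circle_bound l n M f \<Longrightarrow> circle_bound l n M' g \<Longrightarrow> 0 \<le> l \<Longrightarrow>
   circle_bound l n (2 ^ n * (M * M')) (\<lambda>t. f t * g t)"
proof (induction n arbitrary: M M' f g)
  case 0
  then show ?case
    by (auto simp: norm_mult intro!: mult_mono intro: order_trans[OF norm_ge_zero])
next
  case (Suc n)
  then obtain f' g' where
    f': "\<And>t. (f has_vector_derivative f' t) (at t)" "circle_bound l n (l * M) f'" and
    g': "\<And>t. (g has_vector_derivative g' t) (at t)" "circle_bound l n (l * M') g'"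
    by auto
  have fg: "circle_bound l n M f" "circle_bound l n M' g"
    using Suc.prems circle_bound_lower[of l "Suc n" _ _ n] by auto
  have "circle_bound l n (2 ^ n * (M * (l * M')) + 2 ^ n * (l * M * M'))
    (\<lambda>t. f t * g' t + f' t * g t)"
    by (intro circle_bound_add Suc.IH fg f'(2) g'(2) Suc.prems(3))
  then have "circle_bound l n (l * (2 ^ Suc n * (M * M'))) (\<lambda>t. f t * g' t + f' t * g t)"
    by (simp add: algebra_simps)
  moreover have "((\<lambda>t. f t * g t) has_vector_derivative f t * g' t + f' t * g t) (at t)" for t
    using f'(1) g'(1) by (rule has_vector_derivative_mult)
  moreover have "norm (f t * g t) \<le> 2 ^ Suc n * (M * M')" for t
  proof -
    have "norm (f t * g t) \<le> M * M'"
      unfolding norm_mult using Suc.prems circle_bound_D circle_bound_nonneg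
      by (meson mult_mono norm_ge_zero)
    also have "\<dots> \<le> 2 ^ Suc n * (M * M')"
      using Suc.prems circle_bound_nonneg
      by (metis (no_types, opaque_lifting) mult_nonneg_nonneg mult_right_mono mult_1 one_le_power one_le_numeral)
    finally show ?thesis .
  qed
  ultimately show ?case using Suc.prems
    by (intro circle_bound_SucI[where f' = "\<lambda>t. f t * g' t + f' t * g t"]) auto
qed

lemma circle_bound_const: "0 \<le> l \<Longrightarrow> circle_bound l n (norm c) (\<lambda>t. c)"
proof (induction n arbitrary: c)
  case (Suc n)
  have "circle_bound l n (l * norm c) (\<lambda>t. 0)"
    using Suc.IH[of 0] Suc.prems circle_bound_mono[of l n 0 _ "l * norm c" l] by simp
  moreover have "((\<lambda>t. c) has_vector_derivative 0) (at t)" for t by simp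
  ultimately show ?case
    by (intro circle_bound_SucI[where f' = "\<lambda>t. 0"]) auto
qed simp

lemma circle_bound_cmult:
  assumes "circle_bound l n M f" "0 \<le> l"
  shows "circle_bound l n (norm c * M) (\<lambda>t. c * f t)"
  using assms
proof (induction n arbitrary: M f)
  case 0
  then show ?case by (auto simp: norm_mult intro: mult_left_mono)
next
  case (Suc n)
  then obtain f' where
    f': "\<And>t. (f has_vector_derivative f' t) (at t)" "circle_bound l n (l * M) f'"
    by auto
  have "circle_bound l n (l * (norm c * M)) (\<lambda>t. c * f' t)"
    using Suc.IH[OF f'(2)] Suc.prems by (simp add: mult_ac)
  moreover have "((\<lambda>t. c * f t) has_vector_derivative c * f' t) (at t)" for t
    using f'(1) by (auto intro: derivative_eq_intros)
  ultimately show ?case using Suc.prems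
    by (intro circle_bound_SucI[where f' = "\<lambda>t. c * f' t"]) (auto simp: norm_mult intro: mult_left_mono)
qed

lemma has_vector_derivative_cis:
  "((\<lambda>t. cis (c * t)) has_vector_derivative \<i> * of_real c * cis (c * t)) (at t within S)"
proof -
  have "((\<lambda>t. exp (\<i> * of_real (c * t))) has_vector_derivative
      \<i> * of_real c * exp (\<i> * of_real (c * t))) (at t within S)"
    by (rule has_vector_derivative_real_field[where f = "\<lambda>z. exp (\<i> * (of_real c * z))", simplified of_real_mult[symmetric]])
       (auto intro!: derivative_eq_intros)
  then show ?thesis by (simp add: cis_conv_exp)
qed

lemmas has_vector_derivative_cis_int = has_vector_derivative_cis[of "of_int k" for k, simplified]

lemma cis_periodic: "cis (of_int k * (t + 2 * pi)) = cis (of_int k * t)"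
proof -
  have "cis (of_int k * (t + 2 * pi)) = cis (of_int k * t) * cis (2 * pi * of_int k)"
    by (simp add: cis_mult algebra_simps)
  then show ?thesis by simp
qed

lemma circle_bound_cis: 
  "0 \<le> l \<Longrightarrow> \<bar>real_of_int k\<bar> \<le> l \<Longrightarrow> circle_bound l n 1 (\<lambda>t. cis (of_int k * t))"
proof (induction n)
  case 0
  then show ?case by (simp add: cis_periodic)
next
  case (Suc n)
  have "circle_bound l n (norm (\<i> * of_real (of_int k)) * 1) (\<lambda>t. \<i> * of_real (of_int k) * cis (of_int k * t))"
    by (rule circle_bound_cmult) (use Suc in auto)
  then have "circle_bound l n (l * 1) (\<lambda>t. \<i> * of_real (of_int k) * cis (of_int k * t))"
    by (rule circle_bound_mono) (use Suc.prems in \<open>auto simp: norm_mult\<close>)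
  then show ?case
    by (intro circle_bound_SucI[OF _ _ has_vector_derivative_cis_int]) (auto simp: cis_periodic)
qed

lemma circle_bound_cis_int: "\<exists>M. circle_bound 1 n M (\<lambda>t. cis (of_int k * t))"
  using circle_bound_rescale[OF circle_bound_cis[of "max 1 \<bar>of_int k\<bar>" k n]] by auto

section \<open>Fourier coefficients on the circle\<close>

text \<open>The exponential has a plus sign, so this is the classical coefficient at
  \<open>- k\<close>. With this choice \<open>circle_coeff h (\<sigma> - \<tau>)\<close> is the
  matrix entry, from frequency \<sigma> to frequency \<tau>, of multiplication by \<open>h\<close>;
  Fourier series accordingly carry \<open>cis (- (k * t))\<close>.\<close>

definition circle_coeff :: "(real \<Rightarrow> complex) \<Rightarrow> int \<Rightarrow> complex" where
  "circle_coeff h k = 1 / (2 * of_real pi) * integral {0..2 * pi} (\<lambda>t. h t * cis (of_int k * t))"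

lemma integral_cis:
  "((\<lambda>t. cis (of_int k * t)) has_integral (if k = 0 then 2 * of_real pi else 0)) {0..2 * pi}"
proof (cases "k = 0")
  case True
  then show ?thesis using has_integral_const_real[of "1::complex" 0 "2 * pi"] 
    by (simp add: scaleR_conv_of_real)
next
  case False
  have "((\<lambda>t. \<i> * of_real (of_int k) * cis (of_int k * t)) has_integral
     cis (of_int k * (2 * pi)) - cis (of_int k * 0)) {0..2 * pi}"
    by (rule fundamental_theorem_of_calculus) (auto intro: has_vector_derivative_cis_int)
  then have "((\<lambda>t. \<i> * of_real (of_int k) * cis (of_int k * t)) has_integral 0) {0..2 * pi}"
    using cis_periodic[of k 0] by simp
  from has_integral_mult_right[OF this, of "1 / (\<i> * of_real (of_int k))"] False 
  show ?thesis by (simp add: field_simps)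
qed

lemma norm_square_trig_poly:
  assumes "finite F"
  shows "((\<lambda>t. (norm (\<Sum>\<sigma>\<in>F. f \<sigma> * cis (of_int \<sigma> * t)))\<^sup>2) has_integral
     2 * pi * (\<Sum>\<sigma>\<in>F. (norm (f \<sigma>))\<^sup>2)) {0..2 * pi}"
proof -
  have eq: "complex_of_real ((norm (\<Sum>\<sigma>\<in>F. f \<sigma> * cis (of_int \<sigma> * t)))\<^sup>2) =
      (\<Sum>\<sigma>\<in>F. \<Sum>\<rho>\<in>F. f \<sigma> * cnj (f \<rho>) * cis (of_int (\<sigma> - \<rho>) * t))" for t
    unfolding complex_norm_square
    by (simp add: sum_product cis_cnj cis_mult algebra_simps)
  have "((\<lambda>t. \<Sum>\<sigma>\<in>F. \<Sum>\<rho>\<in>F. f \<sigma> * cnj (f \<rho>) * cis (of_int (\<sigma> - \<rho>) * t)) has_integral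
     (\<Sum>\<sigma>\<in>F. \<Sum>\<rho>\<in>F. f \<sigma> * cnj (f \<rho>) * (if \<sigma> - \<rho> = 0 then 2 * of_real pi else 0))) {0..2 * pi}"
    using assms by (intro has_integral_sum has_integral_mult_right integral_cis)
  also have "(\<Sum>\<sigma>\<in>F. \<Sum>\<rho>\<in>F. f \<sigma> * cnj (f \<rho>) * (if \<sigma> - \<rho> = 0 then 2 * complex_of_real pi else 0))
     = (\<Sum>\<sigma>\<in>F. of_real (2 * pi * (norm (f \<sigma>))\<^sup>2))"
    using assms by (intro sum.cong refl) (simp add: complex_norm_square if_distrib sum.delta mult_ac cong: if_cong flip: of_real_power)
  finally have "((\<lambda>t. complex_of_real ((norm (\<Sum>\<sigma>\<in>F. f \<sigma> * cis (of_int \<sigma> * t)))\<^sup>2)) has_integral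
     of_real (2 * pi * (\<Sum>\<sigma>\<in>F. (norm (f \<sigma>))\<^sup>2))) {0..2 * pi}"
    unfolding eq by (simp add: sum_distrib_left)
  from has_integral_Re[OF this] show ?thesis by simp
qed

section \<open>Multiplication operators as bilinear forms in Fourier coefficients\<close>

text \<open>Up to the factor \<open>2 * pi\<close> the double sum is the integral of
  \<open>h * p * cnj q\<close>, where the trigonometric polynomials \<open>p\<close> and
  \<open>q\<close> have the coefficients \<open>f\<close> and \<open>cnj g\<close>. Pointwise AM-GM
  and orthogonality of the exponentials then leave only the sup norm of \<open>h\<close>.\<close>

lemma multiplier_bound_sum_squares:
  assumes "finite F" "finite T" and h: "continuous_on UNIV h" "\<And>t. norm (h t) \<le> M"
  shows "norm (\<Sum>\<tau>\<in>T. \<Sum>\<sigma>\<in>F. g \<tau> * f \<sigma> * circle_coeff h (\<sigma> - \<tau>))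
     \<le> M * ((\<Sum>\<sigma>\<in>F. (norm (f \<sigma>))\<^sup>2) + (\<Sum>\<tau>\<in>T. (norm (g \<tau>))\<^sup>2)) / 2"
proof -
  have M: "0 \<le> M" using h(2) norm_ge_zero order_trans by blast
  define p where "p t = (\<Sum>\<sigma>\<in>F. f \<sigma> * cis (of_int \<sigma> * t))" for t
  define q where "q t = (\<Sum>\<tau>\<in>T. cnj (g \<tau>) * cis (of_int \<tau> * t))" for t
  have cont: "continuous_on {0..2*pi} (\<lambda>t. h t * cis (of_int k * t))" for k
    by (intro continuous_intros continuous_on_subset[OF h(1)]) auto
  have int: "((\<lambda>t. h t * cis (of_int k * t)) has_integral (2 * of_real pi * circle_coeff h k)) {0..2*pi}" for k
    using integrable_integral[OF integrable_continuous_interval[OF cont]]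
    by (simp add: circle_coeff_def)
  have "((\<lambda>t. \<Sum>\<tau>\<in>T. \<Sum>\<sigma>\<in>F. g \<tau> * f \<sigma> * (h t * cis (of_int (\<sigma> - \<tau>) * t))) has_integral
     (\<Sum>\<tau>\<in>T. \<Sum>\<sigma>\<in>F. g \<tau> * f \<sigma> * (2 * of_real pi * circle_coeff h (\<sigma> - \<tau>)))) {0..2*pi}"
    using assms by (intro has_integral_sum has_integral_mult_right int)
  also have "(\<lambda>t. \<Sum>\<tau>\<in>T. \<Sum>\<sigma>\<in>F. g \<tau> * f \<sigma> * (h t * cis (of_int (\<sigma> - \<tau>) * t)))
    = (\<lambda>t. h t * p t * cnj (q t))"
  proof
    fix t
    have *: "cis (of_int (\<sigma> - \<tau>) * t) = cis (of_int \<sigma> * t) * cnj (cis (of_int \<tau> * t))" for \<sigma> \<tau>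
      by (simp add: cis_cnj cis_mult algebra_simps)
    show "(\<Sum>\<tau>\<in>T. \<Sum>\<sigma>\<in>F. g \<tau> * f \<sigma> * (h t * cis (of_int (\<sigma> - \<tau>) * t))) = h t * p t * cnj (q t)"
      unfolding p_def q_def * cnj_sum complex_cnj_mult complex_cnj_cnj sum_distrib_left sum_distrib_right
      by (intro sum.cong refl) (simp only: mult_ac)
  qed
  also have "(\<Sum>\<tau>\<in>T. \<Sum>\<sigma>\<in>F. g \<tau> * f \<sigma> * (2 * of_real pi * circle_coeff h (\<sigma> - \<tau>)))
     = 2 * of_real pi * (\<Sum>\<tau>\<in>T. \<Sum>\<sigma>\<in>F. g \<tau> * f \<sigma> * circle_coeff h (\<sigma> - \<tau>))" (is "_ = _ * ?S")
    by (simp add: sum_distrib_left mult_ac)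
  finally have I: "((\<lambda>t. h t * p t * cnj (q t)) has_integral 2 * of_real pi * ?S) {0..2*pi}" .
  have J: "((\<lambda>t. M / 2 * ((norm (p t))\<^sup>2 + (norm (q t))\<^sup>2)) has_integral
      M / 2 * (2 * pi * (\<Sum>\<sigma>\<in>F. (norm (f \<sigma>))\<^sup>2) + 2 * pi * (\<Sum>\<tau>\<in>T. (norm (g \<tau>))\<^sup>2))) {0..2*pi}"
    using norm_square_trig_poly[OF assms(1), of f] norm_square_trig_poly[OF assms(2), of "\<lambda>\<tau>. cnj (g \<tau>)"]
    unfolding p_def q_def by (intro has_integral_mult_right has_integral_add) simp_all
  have le: "norm (h t * p t * cnj (q t)) \<le> M / 2 * ((norm (p t))\<^sup>2 + (norm (q t))\<^sup>2)" for t
  proof -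
    have "norm (h t * p t * cnj (q t)) \<le> M * (norm (p t) * norm (q t))"
      using mult_right_mono[OF h(2)[of t], of "norm (p t) * norm (q t)"] by (simp add: norm_mult mult_ac)
    also have "norm (p t) * norm (q t) \<le> ((norm (p t))\<^sup>2 + (norm (q t))\<^sup>2) / 2"
      using sum_squares_bound[of "norm (p t)" "norm (q t)"] by simp
    finally show ?thesis using M by (simp add: mult_left_mono)
  qed
  have "norm (2 * of_real pi * ?S) \<le> 
      M / 2 * (2 * pi * (\<Sum>\<sigma>\<in>F. (norm (f \<sigma>))\<^sup>2) + 2 * pi * (\<Sum>\<tau>\<in>T. (norm (g \<tau>))\<^sup>2))"
    using integral_norm_bound_integral[OF has_integral_integrable[OF I] has_integral_integrable[OF J]]
      le unfolding integral_unique[OF I] integral_unique[OF J] by blast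
  then have "2 * pi * norm ?S \<le> 2 * pi * (M * ((\<Sum>\<sigma>\<in>F. (norm (f \<sigma>))\<^sup>2) + (\<Sum>\<tau>\<in>T. (norm (g \<tau>))\<^sup>2)) / 2)"
    by (simp add: norm_mult algebra_simps)
  then show ?thesis by (rule mult_left_le_imp_le) simp
qed

text \<open>The optimal \<open>\<theta>\<^sup>2\<close> is \<open>Y / X\<close>, which degenerates
  when \<open>X\<close> or \<open>Y\<close> vanishes. Both are therefore shifted by a small
  \<open>d\<close>, and the resulting error is made smaller than any given \<open>e\<close>.\<close>

lemma scaled_bound_imp_product:
  fixes b X Y :: real
  assumes "\<And>\<theta>. \<theta> > 0 \<Longrightarrow> b \<le> M * (\<theta>\<^sup>2 * X\<^sup>2 + Y\<^sup>2 / \<theta>\<^sup>2) / 2" "0 \<le> X" "0 \<le> Y" "0 \<le> M"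
  shows "b \<le> M * (X * Y)"
proof (rule field_le_epsilon)
  fix e :: real assume e: "e > 0"
  \<comment> \<open>\<open>d \<le> 1\<close> gives \<open>d * d \<le> d\<close>, so
    \<open>(X + d) * (Y + d)\<close> exceeds \<open>X * Y\<close> by at most
    \<open>d * (1 + X + Y)\<close>; the second entry of the minimum makes \<open>M\<close> times
    this at most \<open>e\<close>.\<close>
  define d where "d = min 1 (e / (M * (1 + X + Y) + 1))"
  have d: "0 < d" "d \<le> 1" using e assms by (auto simp: d_def add_nonneg_pos)
  have "d * (M * (1 + X + Y) + 1) \<le> e"
  proof -
    have pos: "M * (1 + X + Y) + 1 > 0" using assms(2-4) by (intro add_nonneg_pos mult_nonneg_nonneg) auto
    have "d \<le> e / (M * (1 + X + Y) + 1)" by (simp add: d_def)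
    then show ?thesis using pos by (simp only: pos_le_divide_eq)
  qed
  then have de: "d * M * (1 + X + Y) \<le> e" using d by (simp add: algebra_simps)
  have "b \<le> M * ((sqrt ((Y + d) / (X + d)))\<^sup>2 * X\<^sup>2 + Y\<^sup>2 / (sqrt ((Y + d) / (X + d)))\<^sup>2) / 2"
    using d assms by (intro assms(1)) simp
  also have "(sqrt ((Y + d) / (X + d)))\<^sup>2 = (Y + d) / (X + d)"
    using d assms by simp
  also have "M * ((Y + d) / (X + d) * X\<^sup>2 + Y\<^sup>2 / ((Y + d) / (X + d))) / 2 \<le> M * ((X + d) * (Y + d))"
  proof -
    have "(Y + d) / (X + d) * X\<^sup>2 \<le> (Y + d) / (X + d) * (X + d)\<^sup>2"
      using d assms by (intro mult_left_mono power_mono) auto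
    also have "\<dots> = (X + d) * (Y + d)" using d assms by (simp add: power2_eq_square field_simps)
    finally have 1: "(Y + d) / (X + d) * X\<^sup>2 \<le> (X + d) * (Y + d)" .
    have "Y\<^sup>2 / ((Y + d) / (X + d)) \<le> (Y + d)\<^sup>2 / ((Y + d) / (X + d))"
      using d assms by (intro divide_right_mono power_mono) auto
    also have "\<dots> = (X + d) * (Y + d)" using d assms by (simp add: power2_eq_square field_simps)
    finally have 2: "Y\<^sup>2 / ((Y + d) / (X + d)) \<le> (X + d) * (Y + d)" .
    have "((Y + d) / (X + d) * X\<^sup>2 + Y\<^sup>2 / ((Y + d) / (X + d))) / 2 \<le> (X + d) * (Y + d)"
      using 1 2 by simp
    from mult_left_mono[OF this assms(4)] show ?thesis by simp
  qed
  also have "M * ((X + d) * (Y + d)) \<le> M * (X * Y + d * (1 + X + Y))"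
    using d mult_left_mono[of d 1 d] by (intro mult_left_mono assms(4)) (simp add: algebra_simps)
  also have "\<dots> = M * (X * Y) + d * M * (1 + X + Y)" by (simp add: algebra_simps)
  finally have "b \<le> M * (X * Y) + d * M * (1 + X + Y)" .
  with de show "b \<le> M * (X * Y) + e" by linarith
qed

text \<open>The form does not change when \<open>f\<close> is multiplied and \<open>g\<close>
  divided by \<theta>, so the bound by a sum of squares holds for every such scaling and can be
  optimised into a product.\<close>

lemma multiplier_bound_L2:
  assumes "finite F" "finite T" and h: "continuous_on UNIV h" "\<And>t. norm (h t) \<le> M"
  shows "norm (\<Sum>\<tau>\<in>T. \<Sum>\<sigma>\<in>F. g \<tau> * f \<sigma> * circle_coeff h (\<sigma> - \<tau>))
     \<le> M * (L2_set (\<lambda>\<sigma>. norm (f \<sigma>)) F * L2_set (\<lambda>\<tau>. norm (g \<tau>)) T)"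
proof (rule scaled_bound_imp_product)
  fix \<theta> :: real assume "\<theta> > 0"
  let ?g = "\<lambda>\<tau>. g \<tau> / of_real \<theta>" and ?f = "\<lambda>\<sigma>. of_real \<theta> * f \<sigma>"
  have "(\<Sum>\<tau>\<in>T. \<Sum>\<sigma>\<in>F. g \<tau> * f \<sigma> * circle_coeff h (\<sigma> - \<tau>)) =
      (\<Sum>\<tau>\<in>T. \<Sum>\<sigma>\<in>F. ?g \<tau> * ?f \<sigma> * circle_coeff h (\<sigma> - \<tau>))"
    using \<open>\<theta> > 0\<close> by simp
  also have "norm \<dots> \<le> M * ((\<Sum>\<sigma>\<in>F. (norm (?f \<sigma>))\<^sup>2) + (\<Sum>\<tau>\<in>T. (norm (?g \<tau>))\<^sup>2)) / 2"
    by (rule multiplier_bound_sum_squares) fact+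
  also have "\<dots> = M * (\<theta>\<^sup>2 * (L2_set (\<lambda>\<sigma>. norm (f \<sigma>)) F)\<^sup>2 + (L2_set (\<lambda>\<tau>. norm (g \<tau>)) T)\<^sup>2 / \<theta>\<^sup>2) / 2"
    by (simp add: L2_set_def norm_mult norm_divide power_mult_distrib power_divide sum_nonneg
      sum_distrib_left sum_divide_distrib)
  finally show "norm (\<Sum>\<tau>\<in>T. \<Sum>\<sigma>\<in>F. g \<tau> * f \<sigma> * circle_coeff h (\<sigma> - \<tau>)) \<le> 
    M * (\<theta>\<^sup>2 * (L2_set (\<lambda>\<sigma>. norm (f \<sigma>)) F)\<^sup>2 + (L2_set (\<lambda>\<tau>. norm (g \<tau>)) T)\<^sup>2 / \<theta>\<^sup>2) / 2" .
next
  show "0 \<le> M" using h(2) norm_ge_zero order_trans by blast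
qed simp_all

lemma norm_circle_coeff_le:
  assumes "continuous_on UNIV h" "\<And>t. norm (h t) \<le> M"
  shows "norm (circle_coeff h k) \<le> M"
  using multiplier_bound_L2[of "{k}" "{0}" h M "\<lambda>_. 1" "\<lambda>_. 1"] assms by simp

text \<open>Testing the form with \<open>f = cnj (circle_coeff h)\<close> against the single
  frequency 0 gives \<open>S \<le> M * sqrt S\<close> for the partial sum \<open>S\<close>.\<close>

lemma bessel_inequality:
  assumes "continuous_on UNIV h" "\<And>t. norm (h t) \<le> M" "finite F"
  shows "(\<Sum>k\<in>F. (norm (circle_coeff h k))\<^sup>2) \<le> M\<^sup>2"
proof -
  define S where "S = (\<Sum>k\<in>F. (norm (circle_coeff h k))\<^sup>2)"
  have S0: "0 \<le> S" unfolding S_def by (simp add: sum_nonneg)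
  have M: "0 \<le> M" using assms(2) norm_ge_zero order_trans by blast
  have "norm (\<Sum>\<sigma>\<in>F. cnj (circle_coeff h \<sigma>) * circle_coeff h \<sigma>) \<le> M * sqrt S"
    using multiplier_bound_L2[of F "{0}" h M "\<lambda>_. 1" "\<lambda>\<sigma>. cnj (circle_coeff h \<sigma>)"] assms
    by (simp add: S_def L2_set_def)
  also have "(\<Sum>\<sigma>\<in>F. cnj (circle_coeff h \<sigma>) * circle_coeff h \<sigma>) = of_real S"
    unfolding S_def by (simp add: complex_norm_square mult.commute flip: of_real_power)
  finally have le: "S \<le> M * sqrt S" using S0 by simp
  have "sqrt S \<le> M"
  proof (cases "S = 0")
    case False
    then have "sqrt S * sqrt S \<le> M * sqrt S" "sqrt S > 0" using le S0 by auto
    then show ?thesis by (rule mult_right_le_imp_le)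
  qed (simp add: M)
  then show ?thesis using S0 unfolding S_def
    by (metis real_sqrt_pow2 power_mono real_sqrt_ge_zero)
qed

text \<open>Along distinct frequencies Bessel makes the squares summable. The form with an arbitrary
  injective \<open>j\<close> serves both ends, \<open>n + 1\<close> and \<open>- n\<close>, of a
  telescoping symmetric sum.\<close>

lemma riemann_lebesgue:
  assumes "continuous_on UNIV h" "\<And>t. norm (h t) \<le> M" "inj j"
  shows "(\<lambda>n::nat. circle_coeff h (j n)) \<longlonglongrightarrow> 0"
proof -
  have "summable (\<lambda>n. (norm (circle_coeff h (j n)))\<^sup>2)"
  proof (rule summableI_nonneg_bounded)
    fix n
    show "(\<Sum>i<n. (norm (circle_coeff h (j i)))\<^sup>2) \<le> M\<^sup>2"
    proof -
      have "inj_on j {..<n}" using assms(3) inj_on_subset by blast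
      then have "(\<Sum>i<n. (norm (circle_coeff h (j i)))\<^sup>2) = (\<Sum>k\<in>j ` {..<n}. (norm (circle_coeff h k))\<^sup>2)"
        by (simp add: sum.reindex)
      also have "\<dots> \<le> M\<^sup>2" by (rule bessel_inequality[OF assms(1,2)]) simp
      finally show ?thesis .
    qed
  qed simp
  then have "(\<lambda>n. (norm (circle_coeff h (j n)))\<^sup>2) \<longlonglongrightarrow> 0" by (rule summable_LIMSEQ_zero)
  then have "(\<lambda>n. sqrt ((norm (circle_coeff h (j n)))\<^sup>2)) \<longlonglongrightarrow> sqrt 0" by (rule tendsto_real_sqrt)
  then show ?thesis by (simp add: tendsto_norm_zero_iff)
qed

lemma periodic_int:
  assumes "\<And>t. f (t + 2 * pi) = f t"
  shows "f (t + 2 * pi * of_int k) = f t"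
proof (induction k rule: int_induct[where k = 0])
  case (step1 i)
  then show ?case using assms[of "t + 2 * pi * of_int i"] by (simp add: algebra_simps)
next
  case (step2 i)
  then show ?case using assms[of "t + 2 * pi * of_int (i - 1)"] by (simp add: algebra_simps)
qed simp

lemma reduce_period: obtains k where "t + 2 * pi * of_int k \<in> {0..2 * pi}"
proof
  let ?k = "- \<lfloor>t / (2 * pi)\<rfloor>"
  have "of_int \<lfloor>t / (2 * pi)\<rfloor> * (2 * pi) \<le> t" "t < (of_int \<lfloor>t / (2 * pi)\<rfloor> + 1) * (2 * pi)"
    using floor_divide_lower[of "2 * pi" t] floor_divide_upper[of "2 * pi" t] by simp_all
  then show "t + 2 * pi * of_int ?k \<in> {0..2 * pi}" by (simp add: algebra_simps)
qed

lemma periodic_continuous_bounded: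
  fixes f :: "real \<Rightarrow> 'a::real_normed_vector"
  assumes "\<And>t. f (t + 2 * pi) = f t" "continuous_on UNIV f"
  obtains M where "\<And>t. norm (f t) \<le> M"
proof -
  have "bounded (f ` {0..2 * pi})"
    using assms(2) by (intro compact_imp_bounded compact_continuous_image continuous_on_subset[OF assms(2)]) auto
  then obtain M where M: "\<And>s. s \<in> {0..2 * pi} \<Longrightarrow> norm (f s) \<le> M"
    unfolding bounded_iff by blast
  have "norm (f t) \<le> M" for t
    by (rule reduce_period[of t]) (metis M periodic_int[of f, OF assms(1)])
  then show ?thesis using that by blast
qed

lemma circle_coeff_deriv:
  assumes "\<And>t. (h has_vector_derivative h' t) (at t)" "continuous_on UNIV h'"
    "\<And>t. h (t + 2 * pi) = h t"
  shows "circle_coeff h' k = - \<i> * of_int k * circle_coeff h k"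
proof -
  have ch: "continuous_on UNIV h"
    using assms(1) by (meson continuous_at_imp_continuous_on has_vector_derivative_continuous)
  have int: "(\<lambda>t. f t * cis (of_int k * t)) integrable_on {0..2*pi}" if "continuous_on UNIV f" for f
    by (intro integrable_continuous_interval continuous_intros continuous_on_subset[OF that]) auto
  have "((\<lambda>t. h t * (\<i> * of_int k * cis (of_int k * t)) + h' t * cis (of_int k * t)) has_integral
     h (2 * pi) * cis (of_int k * (2 * pi)) - h 0 * cis (of_int k * 0)) {0..2 * pi}"
    by (rule fundamental_theorem_of_calculus)
       (auto intro!: has_vector_derivative_mult has_vector_derivative_cis_int
          has_vector_derivative_at_within[OF assms(1)])
  then have "((\<lambda>t. h t * (\<i> * of_int k * cis (of_int k * t)) + h' t * cis (of_int k * t)) has_integral 0) {0..2 * pi}"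
    using cis_periodic[of k 0] assms(3)[of 0] by simp
  moreover have "((\<lambda>t. (\<i> * of_int k) * (h t * cis (of_int k * t)) + h' t * cis (of_int k * t)) has_integral
     (\<i> * of_int k) * integral {0..2*pi} (\<lambda>t. h t * cis (of_int k * t)) +
      integral {0..2*pi} (\<lambda>t. h' t * cis (of_int k * t))) {0..2*pi}"
    by (intro has_integral_add has_integral_mult_right integrable_integral int ch assms(2))
  ultimately have "(\<i> * of_int k) * integral {0..2*pi} (\<lambda>t. h t * cis (of_int k * t)) +
      integral {0..2*pi} (\<lambda>t. h' t * cis (of_int k * t)) = 0"
    by (intro has_integral_unique) (simp_all add: mult_ac)
  then have "integral {0..2*pi} (\<lambda>t. h' t * cis (of_int k * t)) = 
     - ((\<i> * of_int k) * integral {0..2*pi} (\<lambda>t. h t * cis (of_int k * t)))"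
    by (metis add_eq_0_iff)
  then show ?thesis unfolding circle_coeff_def by simp
qed

section \<open>Convergence of Fourier series together with all derivatives\<close>

definition fourier_sum :: "nat \<Rightarrow> (real \<Rightarrow> complex) \<Rightarrow> real \<Rightarrow> complex" where
  "fourier_sum n h t = (\<Sum>k\<in>{- int n..int n}. circle_coeff h k * cis (- (of_int k * t)))"

lemma sum_symmetric_Suc:
  fixes f :: "int \<Rightarrow> 'a::comm_monoid_add"
  shows "sum f {- int (Suc n)..int (Suc n)} = sum f {- int n..int n} + f (int (Suc n)) + f (- int (Suc n))"
proof -
  have "{- int (Suc n)..int (Suc n)} = insert (- int (Suc n)) (insert (int (Suc n)) {- int n..int n})"
    by auto
  then show ?thesis by (simp add: add_ac)
qed

lemma has_vector_derivative_quotient: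
  assumes "(f has_vector_derivative D) (at t)"
  shows "((\<lambda>s. (1 / (s - t)) *\<^sub>R (f s - f t)) \<longlongrightarrow> D) (at t)"
proof -
  have "((\<lambda>s. norm (f s - f t - (s - t) *\<^sub>R D) / norm (s - t)) \<longlongrightarrow> 0) (at t)"
    using assms unfolding has_vector_derivative_def has_derivative_iff_norm by blast
  moreover have "\<forall>\<^sub>F s in at t. norm (f s - f t - (s - t) *\<^sub>R D) / norm (s - t) =
      norm ((1 / (s - t)) *\<^sub>R (f s - f t) - D)"
  proof -
    have "norm (f s - f t - (s - t) *\<^sub>R D) / norm (s - t) = norm ((1 / (s - t)) *\<^sub>R (f s - f t) - D)"
      if "s \<noteq> t" for s
    proof -
      have "(1 / (s - t)) *\<^sub>R (f s - f t) - D = (1 / (s - t)) *\<^sub>R (f s - f t - (s - t) *\<^sub>R D)"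
        using that by (simp add: scaleR_diff_right)
      then show ?thesis by (simp add: divide_inverse_commute)
    qed
    then show ?thesis by (auto simp: eventually_at_filter)
  qed
  ultimately have "((\<lambda>s. norm ((1 / (s - t)) *\<^sub>R (f s - f t) - D)) \<longlongrightarrow> 0) (at t)"
    by (rule Lim_transform_eventually)
  then show ?thesis using Lim_null tendsto_norm_zero_iff by blast
qed

text \<open>Dividing \<open>h - h t\<^sub>0\<close> by \<open>cis (t - t\<^sub>0) - 1\<close> leaves a continuous function,
  so the partial sums telescope and the Riemann-Lebesgue lemma applies.\<close>

lemma fourier_sum_tendsto:
  assumes per: "\<And>t. h (t + 2 * pi) = h t" and cont: "continuous_on UNIV h"
    and D: "(h has_vector_derivative D) (at t0)"
  shows "(\<lambda>n. fourier_sum n h t0) \<longlonglongrightarrow> h t0"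
proof -
  define e where "e t = cis (t - t0)" for t
  \<comment> \<open>The value \<open>D / \<i>\<close> is the limit of the quotient at
    \<open>t0\<close>, because \<open>e\<close> has derivative \<open>\<i>\<close> there;
    periodicity carries it to the other zeros of \<open>e - 1\<close>.\<close>
  define g where "g t = (if e t = 1 then D / \<i> else (h t - h t0) / (e t - 1))" for t
  have e1: "\<exists>k. t = t0 + 2 * pi * of_int k" if "e t = 1" for t
  proof -
    have "sin (t - t0) = 0" "cos (t - t0) = 1" using that by (auto simp: e_def complex_eq_iff)
    then obtain k where "t - t0 = of_int k * (2 * pi)" 
      using cos_one_2pi_int by (metis mult.commute mult.assoc)
    then show ?thesis by (intro exI[of _ k]) (simp add: algebra_simps)
  qed
  have e_per: "e (t + 2 * pi * of_int k) = e t" for t k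
  proof -
    have "e (t + 2 * pi * of_int k) = cis (t - t0) * cis (2 * pi * of_int k)"
      unfolding e_def cis_mult by (simp add: algebra_simps)
    then show ?thesis by (simp add: e_def)
  qed
  have h_per: "h (t + 2 * pi * of_int k) = h t" for t k using periodic_int[of h, OF per] .
  have hg: "h t - h t0 = (e t - 1) * g t" for t
    using e1[of t] h_per by (auto simp: g_def)
  have g_per: "g (t + 2 * pi * of_int k) = g t" for t k
    by (simp add: g_def e_per h_per)
  have cont_e: "continuous_on UNIV e" unfolding e_def by (intro continuous_intros)
  have g_t0: "isCont g t0"
  proof -
    have E: "(e has_vector_derivative \<i>) (at t0)"
    proof -
      have "((\<lambda>t. cis (- t0) * cis (1 * t)) has_vector_derivative cis (- t0) * (\<i> * of_real 1 * cis (1 * t0))) (at t0)"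
        by (rule has_vector_derivative_mult_right) (rule has_vector_derivative_cis)
      then show ?thesis by (simp add: e_def[abs_def] cis_mult mult_ac)
    qed
    have lims: "((\<lambda>t. (1 / (t - t0)) *\<^sub>R (h t - h t0)) \<longlongrightarrow> D) (at t0)"
       "((\<lambda>t. (1 / (t - t0)) *\<^sub>R (e t - e t0)) \<longlongrightarrow> \<i>) (at t0)"
      using D E by (simp_all only: has_vector_derivative_quotient)
    have "((\<lambda>t. ((1 / (t - t0)) *\<^sub>R (h t - h t0)) / ((1 / (t - t0)) *\<^sub>R (e t - e t0))) \<longlongrightarrow> D / \<i>) (at t0)"
      by (intro tendsto_divide lims) simp
    moreover have "\<forall>\<^sub>F t in at t0. ((1 / (t - t0)) *\<^sub>R (h t - h t0)) / ((1 / (t - t0)) *\<^sub>R (e t - e t0)) = g t"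
    proof -
      have "\<forall>\<^sub>F t in at t0. (1 / (t - t0)) *\<^sub>R (e t - e t0) \<noteq> 0"
        by (rule tendsto_imp_eventually_ne[OF lims(2)]) simp
      then show ?thesis
        by eventually_elim (auto simp: g_def e_def scaleR_conv_of_real)
    qed
    ultimately have "(g \<longlongrightarrow> D / \<i>) (at t0)" by (rule Lim_transform_eventually)
    moreover have "g t0 = D / \<i>" by (simp add: g_def e_def)
    ultimately show ?thesis by (simp add: isCont_def)
  qed
  have "isCont g t" for t
  proof (cases "e t = 1")
    case True
    then obtain k where k: "t = t0 + 2 * pi * of_int k" using e1 by blast
    have "isCont (\<lambda>s. g (s + - (2 * pi * of_int k))) t"
      by (rule continuous_at_compose[unfolded o_def, of t "\<lambda>s. s + - (2 * pi * of_int k)" g])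
         (use g_t0 k in \<open>auto intro!: continuous_intros\<close>)
    moreover have "g (s + - (2 * pi * of_int k)) = g s" for s
      using g_per[of s "- k"] by simp
    ultimately show ?thesis by simp
  next
    case False
    have ce: "isCont e t" and ch: "isCont h t"
      using cont_e cont by (simp_all add: continuous_on_eq_continuous_at)
    have "isCont (\<lambda>s. (h s - h t0) / (e s - 1)) t"
      by (intro continuous_intros ce ch) (use False in auto)
    moreover have "\<forall>\<^sub>F s in nhds t. (h s - h t0) / (e s - 1) = g s"
    proof -
      have "open {s. e s \<noteq> 1}"
        using cont_e by (intro open_Collect_neq continuous_on_const)
      then have "\<forall>\<^sub>F s in nhds t. s \<in> {s. e s \<noteq> 1}" using False by (intro eventually_nhds_in_open) auto
      then show ?thesis by eventually_elim (auto simp: g_def)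
    qed
    ultimately show ?thesis by (metis isCont_cong)
  qed
  then have cont_g: "continuous_on UNIV g" by (simp add: continuous_at_imp_continuous_on)
  obtain M where M: "\<And>t. norm (g t) \<le> M"
    using periodic_continuous_bounded[of g] g_per[of _ 1] cont_g by auto
  have int: "(\<lambda>t. f t * cis (of_int k * t)) integrable_on {0..2*pi}" if "continuous_on UNIV f" for f k
    by (intro integrable_continuous_interval continuous_intros continuous_on_subset[OF that]) auto
  define b where "b k = cis (- (of_int k * t0)) * circle_coeff g k" for k
  \<comment> \<open>In \<open>h = h t0 + (e - 1) * g\<close> the factor \<open>e\<close> raises the
    frequency by one, so each term is a difference of consecutive values of \<open>b\<close>; the
    constant \<open>h t0\<close> contributes at \<open>k = 0\<close> only.\<close>
  have coeff: "circle_coeff h k * cis (- (of_int k * t0)) = (if k = 0 then h t0 else 0) + (b (k + 1) - b k)" for k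
  proof -
    define I where "I f k = integral {0..2*pi} (\<lambda>t. f t * cis (of_int k * t))" for f and k :: int
    have "((\<lambda>t. h t0 * cis (of_int k * t) + (cis (- t0) * (g t * cis (of_int (k + 1) * t)) - g t * cis (of_int k * t)))
      has_integral (h t0 * (if k = 0 then 2 * of_real pi else 0) + (cis (- t0) * I g (k + 1) - I g k))) {0..2*pi}"
      unfolding I_def by (intro has_integral_add has_integral_diff has_integral_mult_right integral_cis integrable_integral int cont_g)
    also have "(\<lambda>t. h t0 * cis (of_int k * t) + (cis (- t0) * (g t * cis (of_int (k + 1) * t)) - g t * cis (of_int k * t)))
      = (\<lambda>t. h t * cis (of_int k * t))"
    proof
      fix t
      have "e t * cis (of_int k * t) = cis (- t0) * cis (of_int (k + 1) * t)"
        by (simp add: e_def cis_mult algebra_simps)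
      then have "cis (- t0) * (g t * cis (of_int (k + 1) * t)) = e t * g t * cis (of_int k * t)"
        by (simp add: mult_ac)
      moreover have "h t = h t0 + (e t - 1) * g t" using hg[of t] by (simp add: algebra_simps)
      ultimately show "h t0 * cis (of_int k * t) + (cis (- t0) * (g t * cis (of_int (k + 1) * t)) - g t * cis (of_int k * t))
        = h t * cis (of_int k * t)" by (metis (no_types, lifting) add_diff_eq distrib_right left_diff_distrib mult_1)
    qed
    finally have "I h k = h t0 * (if k = 0 then 2 * of_real pi else 0) + (cis (- t0) * I g (k + 1) - I g k)"
      unfolding I_def by (rule integral_unique)
    moreover have "circle_coeff f k = 1 / (2 * of_real pi) * I f k" for f k
      by (simp add: circle_coeff_def I_def)
    ultimately have coeff_h: "circle_coeff h k = (if k = 0 then h t0 else 0) + (cis (- t0) * circle_coeff g (k + 1) - circle_coeff g k)"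
      by (simp add: add_divide_distrib diff_divide_distrib)
    have "cis (- (of_int (k + 1) * t0)) = cis (- (of_int k * t0)) * cis (- t0)"
      by (simp add: cis_mult algebra_simps)
    then show ?thesis unfolding coeff_h b_def by (simp add: algebra_simps)
  qed
  have sum: "fourier_sum n h t0 = h t0 + (b (int n + 1) - b (- int n))" for n
  proof (induction n)
    case 0
    then show ?case using coeff[of 0] by (simp add: fourier_sum_def)
  next
    case (Suc n)
    have "fourier_sum (Suc n) h t0 = fourier_sum n h t0 + 
      circle_coeff h (int (Suc n)) * cis (- (of_int (int (Suc n)) * t0)) +
      circle_coeff h (- int (Suc n)) * cis (- (of_int (- int (Suc n)) * t0))"
      unfolding fourier_sum_def by (rule sum_symmetric_Suc)
    also have "\<dots> = h t0 + (b (int (Suc n) + 1) - b (- int (Suc n)))"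
      unfolding Suc coeff by (simp add: add_ac)
    finally show ?case .
  qed
  have b0: "(\<lambda>n. b (j n)) \<longlonglongrightarrow> 0" if "inj j" for j
    using tendsto_norm_zero[OF riemann_lebesgue[OF cont_g M that]]
    by (subst tendsto_norm_zero_iff[symmetric]) (simp add: b_def norm_mult)
  have "(\<lambda>n. h t0 + (b (int n + 1) - b (- int n))) \<longlonglongrightarrow> h t0 + (0 - 0)"
    by (intro tendsto_intros b0) (auto simp: inj_def)
  then show ?thesis by (simp add: sum)
qed

lemma circle_bound_continuous: "circle_bound l (Suc n) M f \<Longrightarrow> continuous_on UNIV f"
  by (auto intro!: continuous_at_imp_continuous_on intro: has_vector_derivative_continuous)

text \<open>Two integrations by parts bound the coefficients by \<open>M / k\<^sup>2\<close>, and
  \<open>1 / (m + 1)\<^sup>2 \<le> 1 / m - 1 / (m + 1)\<close> lets the tail telescope; the factor 2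
  counts \<open>k\<close> and \<open>- k\<close>. Level 3 provides continuity of the second
  derivative. Pointwise convergence identifies the limit of the Cauchy estimate.\<close>

lemma fourier_sum_uniform:
  assumes "circle_bound 1 3 M h" "n \<ge> 1"
  shows "norm (h t - fourier_sum n h t) \<le> 2 * M / n"
proof -
  obtain h1 where h1: "\<And>t. (h has_vector_derivative h1 t) (at t)" "circle_bound 1 2 M h1"
    using assms(1) by (auto simp: numeral_3_eq_3 numeral_2_eq_2)
  obtain h2 where h2: "\<And>t. (h1 has_vector_derivative h2 t) (at t)" "circle_bound 1 1 M h2"
    using h1(2) by (auto simp: numeral_3_eq_3 numeral_2_eq_2)
  have ch: "continuous_on UNIV h" "continuous_on UNIV h1" "continuous_on UNIV h2"
    using assms(1) h1(2) h2(2) circle_bound_continuous by (metis numeral_3_eq_3 numeral_2_eq_2 One_nat_def)+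
  have M: "0 \<le> M" using assms(1) circle_bound_nonneg by blast
  have coeff: "norm (circle_coeff h k) \<le> M / (of_int k)\<^sup>2" if "k \<noteq> 0" for k
  proof -
    have "circle_coeff h2 k = - \<i> * of_int k * (- \<i> * of_int k * circle_coeff h k)"
      using circle_coeff_deriv[OF h1(1) ch(2)] circle_coeff_deriv[OF h2(1) ch(3)]
        circle_bound_D(1)[OF assms(1)] circle_bound_D(1)[OF h1(2)] by simp
    then have "norm (circle_coeff h2 k) = (of_int k)\<^sup>2 * norm (circle_coeff h k)"
      by (simp add: norm_mult power2_eq_square flip: mult.assoc)
    moreover have "norm (circle_coeff h2 k) \<le> M"
      using norm_circle_coeff_le[OF ch(3)] circle_bound_D(2)[OF h2(2)] by blast
    ultimately show ?thesis using that by (simp add: field_simps)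
  qed
  have step: "norm (fourier_sum m h t - fourier_sum n h t) \<le> 2 * M * (1 / n - 1 / m)" if "m \<ge> n" for m
    using that
  proof (induction m rule: dec_induct)
    case (step m)
    have m: "m \<ge> 1" using step assms by simp
    have "norm (fourier_sum (Suc m) h t - fourier_sum n h t) = norm (fourier_sum m h t - fourier_sum n h t + 
      circle_coeff h (int (Suc m)) * cis (- (of_int (int (Suc m)) * t)) +
      circle_coeff h (- int (Suc m)) * cis (- (of_int (- int (Suc m)) * t)))"
      unfolding fourier_sum_def sum_symmetric_Suc by (simp add: algebra_simps)
    also have "\<dots> \<le> norm (fourier_sum m h t - fourier_sum n h t) + 
       norm (circle_coeff h (int (Suc m))) + norm (circle_coeff h (- int (Suc m)))"
      by (rule order_trans[OF norm_triangle_ineq]) (auto intro!: add_mono order_trans[OF norm_triangle_ineq] simp: norm_mult)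
    also have "\<dots> \<le> 2 * M * (1 / n - 1 / m) + M / (real (Suc m))\<^sup>2 + M / (real (Suc m))\<^sup>2"
      using coeff[of "int (Suc m)"] coeff[of "- int (Suc m)"]
      by (intro add_mono step) (simp_all add: power2_eq_square algebra_simps)
    also have "\<dots> = 2 * M * (1 / n - 1 / m + 1 / (real (Suc m))\<^sup>2)" by (simp add: algebra_simps)
    also have "\<dots> \<le> 2 * M * (1 / n - 1 / Suc m)"
    proof -
      have "1 / (real (Suc m))\<^sup>2 \<le> 1 / (real m * real (Suc m))"
        using m by (intro divide_left_mono) (auto simp: power2_eq_square)
      also have "\<dots> = 1 / m - 1 / Suc m" using m by (simp add: field_simps)
      finally show ?thesis using M by (intro mult_left_mono) auto
    qed
    finally show ?case .
  qed simp
  have "norm (fourier_sum m h t - fourier_sum n h t) \<le> 2 * M / n" if "m \<ge> n" for m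
  proof -
    have "2 * M * (1 / n - 1 / m) \<le> 2 * M * (1 / n)" using M by (intro mult_left_mono) auto
    then show ?thesis using step[OF that] by simp
  qed
  moreover have "(\<lambda>m. norm (fourier_sum m h t - fourier_sum n h t)) \<longlonglongrightarrow> norm (h t - fourier_sum n h t)"
    by (intro tendsto_intros fourier_sum_tendsto[OF _ ch(1) h1(1)] circle_bound_D(1)[OF assms(1)])
  ultimately show ?thesis by (intro LIMSEQ_le_const2) auto
qed

text \<open>Fourier sums commute with differentiation, so the uniform estimate applies to each
  derivative in turn. This is convergence in the norms by which distributions are bounded.\<close>

lemma fourier_sum_converges:
  assumes "\<And>n. \<exists>M. circle_bound 1 n M h" "\<epsilon> > 0"
  shows "\<forall>\<^sub>F n in sequentially. circle_bound 1 N \<epsilon> (\<lambda>t. h t - fourier_sum n h t)"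
  using assms(1)
proof (induction N arbitrary: h)
  case 0
  then obtain M where M: "circle_bound 1 3 M h" by blast
  have per: "h (t + 2 * pi) - fourier_sum n h (t + 2 * pi) = h t - fourier_sum n h t" for n t
    using circle_bound_D(1)[OF M] cis_periodic[of "- k" t for k] by (simp add: fourier_sum_def)
  have "(\<lambda>n. 2 * M / real n) \<longlonglongrightarrow> 0" by (rule lim_const_over_n)
  then have "\<forall>\<^sub>F n in sequentially. 2 * M / real n < \<epsilon>" using assms(2) by (rule order_tendstoD)
  then show ?case using eventually_ge_at_top[of "1::nat"]
  proof eventually_elim
    case (elim n)
    then show ?case using fourier_sum_uniform[OF M, of n] per by (auto intro: order_trans[OF _ less_imp_le])
  qed
next
  case (Suc N)
  obtain M where M: "circle_bound 1 3 M h" using Suc.prems by blast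
  then obtain h' where h': "\<And>t. (h has_vector_derivative h' t) (at t)"
    by (auto simp: numeral_3_eq_3)
  have bnd: "\<exists>M. circle_bound 1 n M h'" for n
  proof -
    obtain M h'' where "\<And>t. (h has_vector_derivative h'' t) (at t)" "circle_bound 1 n (1 * M) h''"
      using Suc.prems[of "Suc n"] by auto
    moreover from this(1) have "h'' = h'" using h' vector_derivative_unique_at by blast
    ultimately show ?thesis by blast
  qed
  have coeff: "circle_coeff h' k = - \<i> * of_int k * circle_coeff h k" for k
    using bnd[of 1] circle_bound_continuous circle_bound_D(1)[OF M]
    by (intro circle_coeff_deriv h') (auto simp del: circle_bound.simps)
  have sum': "(fourier_sum n h has_vector_derivative fourier_sum n h' t) (at t)" for n t
    unfolding fourier_sum_def[abs_def] coeff
  proof (rule has_vector_derivative_sum)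
    fix k
    have "((\<lambda>t. circle_coeff h k * cis (- of_int k * t)) has_vector_derivative
      circle_coeff h k * (\<i> * of_real (- of_int k) * cis (- of_int k * t))) (at t)"
      by (rule has_vector_derivative_mult_right) (rule has_vector_derivative_cis)
    then show "((\<lambda>t. circle_coeff h k * cis (- (of_int k * t))) has_vector_derivative
      - \<i> * of_int k * circle_coeff h k * cis (- (of_int k * t))) (at t)"
      by (simp add: mult_ac)
  qed
  have per: "h (t + 2 * pi) - fourier_sum n h (t + 2 * pi) = h t - fourier_sum n h t" for n t
    using circle_bound_D(1)[OF M] cis_periodic[of "- k" t for k] by (simp add: fourier_sum_def)
  have "(\<lambda>n. 2 * M / real n) \<longlonglongrightarrow> 0" by (rule lim_const_over_n)
  then have "\<forall>\<^sub>F n in sequentially. 2 * M / real n < \<epsilon>" using assms(2) by (rule order_tendstoD)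
  then show ?case using eventually_ge_at_top[of "1::nat"] Suc.IH[OF bnd]
  proof eventually_elim
    case (elim n)
    then show ?case using fourier_sum_uniform[OF M, of n]
      by (intro circle_bound_SucI[where f' = "\<lambda>t. h' t - fourier_sum n h' t"] has_vector_derivative_diff h' sum')
         (auto simp: per intro: order_trans[OF _ less_imp_le])
  qed
qed

section \<open>Almost orthogonality of dyadic frequency blocks\<close>

text \<open>The factor \<open>(\<sigma> - \<tau>) ^ m\<close> turns the matrix of a multiplier into
  that of its m-th derivative, up to a power of \<open>\<i>\<close>. The condition thus says that
  the m-th derivative acts on L2 with norm at most \<open>C * l ^ m\<close>. Stating it for a kernel
  \<kappa> rather than a function makes the transposed form available as well.\<close>

definition multiplier_bounds :: "real \<Rightarrow> real \<Rightarrow> nat \<Rightarrow> (int \<Rightarrow> complex) \<Rightarrow> bool" where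
  "multiplier_bounds C l N \<kappa> \<longleftrightarrow> (\<forall>m\<le>N. \<forall>F T f g. finite F \<longrightarrow> finite T \<longrightarrow>
     norm (\<Sum>\<tau>\<in>T. \<Sum>\<sigma>\<in>F. g \<tau> * f \<sigma> * (of_int (\<sigma> - \<tau>) ^ m * \<kappa> (\<sigma> - \<tau>)))
       \<le> C * l ^ m * (L2_set (\<lambda>\<sigma>. norm (f \<sigma>)) F * L2_set (\<lambda>\<tau>. norm (g \<tau>)) T))"

lemma multiplier_boundsD:
  assumes "multiplier_bounds C l N \<kappa>" "m \<le> N" "finite F" "finite T"
  shows "norm (\<Sum>\<tau>\<in>T. \<Sum>\<sigma>\<in>F. g \<tau> * f \<sigma> * (of_int (\<sigma> - \<tau>) ^ m * \<kappa> (\<sigma> - \<tau>)))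
       \<le> C * l ^ m * (L2_set (\<lambda>\<sigma>. norm (f \<sigma>)) F * L2_set (\<lambda>\<tau>. norm (g \<tau>)) T)"
  using assms unfolding multiplier_bounds_def by blast

text \<open>Reflecting \<kappa> transposes the form and exchanges \<open>f\<close> with
  \<open>g\<close>; the sign \<open>(- 1) ^ m\<close> disappears in the norm. It lets blocks with
  large \<sigma> be treated as blocks with large \<tau>.\<close>

lemma multiplier_bounds_reflect:
  assumes "multiplier_bounds C l N \<kappa>"
  shows "multiplier_bounds C l N (\<lambda>k. \<kappa> (- k))"
  unfolding multiplier_bounds_def
proof (intro allI impI)
  fix m and F T :: "int set" and f g :: "int \<Rightarrow> complex"
  assume m: "m \<le> N" and fin: "finite F" "finite T"
  have "(\<Sum>\<tau>\<in>T. \<Sum>\<sigma>\<in>F. g \<tau> * f \<sigma> * (of_int (\<sigma> - \<tau>) ^ m * \<kappa> (- (\<sigma> - \<tau>)))) =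
    (\<Sum>\<sigma>\<in>F. \<Sum>\<tau>\<in>T. g \<tau> * f \<sigma> * (of_int (\<sigma> - \<tau>) ^ m * \<kappa> (- (\<sigma> - \<tau>))))"
    by (rule sum.swap)
  also have "\<dots> = (\<Sum>\<sigma>\<in>F. \<Sum>\<tau>\<in>T. (- 1) ^ m * (f \<sigma> * g \<tau> * (of_int (\<tau> - \<sigma>) ^ m * \<kappa> (\<tau> - \<sigma>))))"
  proof (intro sum.cong refl)
    fix \<sigma> \<tau>
    have "(of_int (\<sigma> - \<tau>) :: complex) = (- 1) * of_int (\<tau> - \<sigma>)" by simp
    then have "(of_int (\<sigma> - \<tau>) :: complex) ^ m = (- 1) ^ m * of_int (\<tau> - \<sigma>) ^ m"
      by (metis power_mult_distrib)
    then show "g \<tau> * f \<sigma> * (of_int (\<sigma> - \<tau>) ^ m * \<kappa> (- (\<sigma> - \<tau>))) =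
      (- 1) ^ m * (f \<sigma> * g \<tau> * (of_int (\<tau> - \<sigma>) ^ m * \<kappa> (\<tau> - \<sigma>)))" by simp
  qed
  also have "\<dots> = (- 1) ^ m * (\<Sum>\<sigma>\<in>F. \<Sum>\<tau>\<in>T. f \<sigma> * g \<tau> * (of_int (\<tau> - \<sigma>) ^ m * \<kappa> (\<tau> - \<sigma>)))"
    by (simp add: sum_distrib_left)
  also have "norm \<dots> \<le> C * l ^ m * (L2_set (\<lambda>\<tau>. norm (g \<tau>)) T * L2_set (\<lambda>\<sigma>. norm (f \<sigma>)) F)"
    using multiplier_boundsD[OF assms m fin(2,1), of f g] by (simp add: norm_mult norm_power)
  finally show "norm (\<Sum>\<tau>\<in>T. \<Sum>\<sigma>\<in>F. g \<tau> * f \<sigma> * (of_int (\<sigma> - \<tau>) ^ m * \<kappa> (- (\<sigma> - \<tau>))))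
       \<le> C * l ^ m * (L2_set (\<lambda>\<sigma>. norm (f \<sigma>)) F * L2_set (\<lambda>\<tau>. norm (g \<tau>)) T)"
    by (simp add: mult.commute)
qed

text \<open>Writing \<open>\<tau>\<^sup>N = (\<sigma> - (\<sigma> - \<tau>))\<^sup>N\<close> trades the large frequency \<open>\<tau>\<close> of one argument for
  the small frequency \<open>\<sigma>\<close> of the other and for derivatives of the multiplier.\<close>

lemma multiplier_off_diagonal:
  assumes bnd: "multiplier_bounds C l N \<kappa>" and fin: "finite F" "finite T"
    and F: "\<And>\<sigma>. \<sigma> \<in> F \<Longrightarrow> \<bar>of_int \<sigma>\<bar> \<le> \<rho>" and T: "\<And>\<tau>. \<tau> \<in> T \<Longrightarrow> \<mu> \<le> \<bar>of_int \<tau>\<bar>"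
    and pos: "0 < l" "l \<le> \<rho>" "0 < \<mu>" "0 \<le> C"
  shows "norm (\<Sum>\<tau>\<in>T. \<Sum>\<sigma>\<in>F. g \<tau> * f \<sigma> * \<kappa> (\<sigma> - \<tau>))
    \<le> C * (2 * \<rho> / \<mu>) ^ N * (L2_set (\<lambda>\<sigma>. norm (f \<sigma>)) F * L2_set (\<lambda>\<tau>. norm (g \<tau>)) T)"
proof -
  \<comment> \<open>The powers from the binomial expansion are shared out: \<open>f'\<close> takes
    those of the small frequency \<sigma>, at a cost \<open>\<rho> ^ (N - m)\<close>, and
    \<open>g'\<close> takes the division by \<open>\<tau> ^ N\<close>, with gain
    \<open>1 / \<mu> ^ N\<close>.\<close>
  define f' where "f' m \<sigma> = f \<sigma> * of_int \<sigma> ^ (N - m)" for m \<sigma>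
  define g' where "g' \<tau> = g \<tau> / of_int \<tau> ^ N" for \<tau>
  let ?L = "\<lambda>f F. L2_set (\<lambda>x. norm (f x :: complex)) F"
  let ?S = "\<lambda>m. \<Sum>\<tau>\<in>T. \<Sum>\<sigma>\<in>F. g' \<tau> * f' m \<sigma> * (of_int (\<sigma> - \<tau>) ^ m * \<kappa> (\<sigma> - \<tau>))"
  have Lf: "?L (f' m) F \<le> \<rho> ^ (N - m) * ?L f F" for m
  proof -
    have "?L (f' m) F \<le> L2_set (\<lambda>\<sigma>. \<rho> ^ (N - m) * norm (f \<sigma>)) F"
    proof (rule L2_set_mono)
      fix \<sigma> assume "\<sigma> \<in> F"
      then have "\<bar>of_int \<sigma>\<bar> ^ (N - m) \<le> \<rho> ^ (N - m)" using F by (intro power_mono) auto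
      then show "norm (f' m \<sigma>) \<le> \<rho> ^ (N - m) * norm (f \<sigma>)"
        by (simp add: f'_def norm_mult norm_power mult.commute mult_left_mono)
    qed simp
    also have "\<dots> = \<rho> ^ (N - m) * ?L f F" using pos by (simp add: L2_set_right_distrib)
    finally show ?thesis .
  qed
  have Lg: "?L g' T \<le> 1 / \<mu> ^ N * ?L g T"
  proof -
    have "?L g' T \<le> L2_set (\<lambda>\<tau>. 1 / \<mu> ^ N * norm (g \<tau>)) T"
    proof (rule L2_set_mono)
      fix \<tau> assume "\<tau> \<in> T"
      then have "\<mu> ^ N \<le> \<bar>of_int \<tau>\<bar> ^ N" using T pos by (intro power_mono) auto
      then show "norm (g' \<tau>) \<le> 1 / \<mu> ^ N * norm (g \<tau>)"
        using pos by (simp add: g'_def norm_divide norm_power frac_le)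
    qed simp
    also have "\<dots> = 1 / \<mu> ^ N * ?L g T" using pos by (simp only: L2_set_right_distrib[symmetric] zero_le_divide_1_iff zero_le_power less_imp_le)
    finally show ?thesis .
  qed
  have "g \<tau> * f \<sigma> * \<kappa> (\<sigma> - \<tau>) = (\<Sum>m\<le>N. of_nat (N choose m) * (- 1) ^ m *
      (g' \<tau> * f' m \<sigma> * (of_int (\<sigma> - \<tau>) ^ m * \<kappa> (\<sigma> - \<tau>))))" if "\<tau> \<in> T" for \<tau> \<sigma>
  proof -
    have "\<tau> \<noteq> 0" using T[OF that] pos by auto
    have "(of_int \<tau> :: complex) ^ N = (- of_int (\<sigma> - \<tau>) + of_int \<sigma>) ^ N" by simp
    also have "\<dots> = (\<Sum>m\<le>N. of_nat (N choose m) * (- 1) ^ m * (of_int (\<sigma> - \<tau>) ^ m * of_int \<sigma> ^ (N - m)))"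
      unfolding binomial_ring by (intro sum.cong refl) (simp only: power_minus[of "of_int (\<sigma> - \<tau>)"] mult_ac)
    finally have "g' \<tau> * f \<sigma> * \<kappa> (\<sigma> - \<tau>) * of_int \<tau> ^ N = (\<Sum>m\<le>N. of_nat (N choose m) * (- 1) ^ m *
      (g' \<tau> * f' m \<sigma> * (of_int (\<sigma> - \<tau>) ^ m * \<kappa> (\<sigma> - \<tau>))))"
      by (simp add: sum_distrib_left f'_def mult_ac)
    moreover have "g \<tau> = g' \<tau> * of_int \<tau> ^ N" using \<open>\<tau> \<noteq> 0\<close> by (simp add: g'_def)
    ultimately show ?thesis by (simp add: mult_ac)
  qed
  then have "(\<Sum>\<tau>\<in>T. \<Sum>\<sigma>\<in>F. g \<tau> * f \<sigma> * \<kappa> (\<sigma> - \<tau>)) = (\<Sum>\<tau>\<in>T. \<Sum>\<sigma>\<in>F. \<Sum>m\<le>N. of_nat (N choose m) * (- 1) ^ m *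
      (g' \<tau> * f' m \<sigma> * (of_int (\<sigma> - \<tau>) ^ m * \<kappa> (\<sigma> - \<tau>))))" by simp
  also have "\<dots> = (\<Sum>m\<le>N. of_nat (N choose m) * (- 1) ^ m * ?S m)"
  proof -
    have "(\<Sum>\<tau>\<in>T. \<Sum>\<sigma>\<in>F. \<Sum>m\<le>N. h m \<tau> \<sigma>) = (\<Sum>m\<le>N. \<Sum>\<tau>\<in>T. \<Sum>\<sigma>\<in>F. h m \<tau> \<sigma>)"
      for h :: "nat \<Rightarrow> int \<Rightarrow> int \<Rightarrow> complex"
    proof -
      have "(\<Sum>\<tau>\<in>T. \<Sum>\<sigma>\<in>F. \<Sum>m\<le>N. h m \<tau> \<sigma>) = (\<Sum>\<tau>\<in>T. \<Sum>m\<le>N. \<Sum>\<sigma>\<in>F. h m \<tau> \<sigma>)"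
        by (intro sum.cong refl sum.swap)
      also have "\<dots> = (\<Sum>m\<le>N. \<Sum>\<tau>\<in>T. \<Sum>\<sigma>\<in>F. h m \<tau> \<sigma>)" by (rule sum.swap)
      finally show ?thesis .
    qed
    then show ?thesis unfolding sum_distrib_left .
  qed
  finally have eq: "(\<Sum>\<tau>\<in>T. \<Sum>\<sigma>\<in>F. g \<tau> * f \<sigma> * \<kappa> (\<sigma> - \<tau>)) = (\<Sum>m\<le>N. of_nat (N choose m) * (- 1) ^ m * ?S m)" .
  \<comment> \<open>Since \<open>l \<le> \<rho>\<close>, the product
    \<open>l ^ m * \<rho> ^ (N - m)\<close> is at most \<open>\<rho> ^ N\<close>. All terms then
    have the same bound and the binomial coefficients add up to \<open>2 ^ N\<close>.\<close>
  have S: "norm (?S m) \<le> C * (\<rho> / \<mu>) ^ N * (?L f F * ?L g T)" if "m \<le> N" for m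
  proof -
    have "norm (?S m) \<le> C * l ^ m * (?L (f' m) F * ?L g' T)"
      by (rule multiplier_boundsD[OF bnd that fin])
    also have "\<dots> \<le> C * \<rho> ^ m * ((\<rho> ^ (N - m) * ?L f F) * (1 / \<mu> ^ N * ?L g T))"
      using pos by (intro mult_mono Lf Lg power_mono mult_nonneg_nonneg) auto
    also have "\<dots> = C * (\<rho> ^ (m + (N - m)) / \<mu> ^ N) * (?L f F * ?L g T)"
      by (simp only: power_add) simp
    finally show ?thesis using that by (simp add: power_divide)
  qed
  have "norm (\<Sum>m\<le>N. of_nat (N choose m) * (- 1) ^ m * ?S m) \<le> 
      (\<Sum>m\<le>N. real (N choose m) * (C * (\<rho> / \<mu>) ^ N * (?L f F * ?L g T)))"
    by (rule sum_norm_le) (use S in \<open>simp add: norm_mult norm_power mult_left_mono\<close>)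
  also have "\<dots> = 2 ^ N * (C * (\<rho> / \<mu>) ^ N * (?L f F * ?L g T))"
    by (simp add: sum_distrib_right[symmetric] choose_row_sum flip: of_nat_sum)
  also have "\<dots> = C * (2 * \<rho> / \<mu>) ^ N * (?L f F * ?L g T)"
    by (simp add: power_mult_distrib power_divide)
  finally show ?thesis unfolding eq .
qed

text \<open>For \<open>l > 0\<close>, block 0 collects all \<open>|\<tau>| < 2 * l\<close>: up to
  the scale \<open>l\<close> integration by parts gains nothing, so these frequencies are not
  separated any further.\<close>

definition dyadic_index :: "real \<Rightarrow> int \<Rightarrow> nat" where
  "dyadic_index l \<tau> = nat \<lfloor>log 2 (max 1 (\<bar>of_int \<tau>\<bar> / l))\<rfloor>"

lemma dyadic_index:
  "2 ^ dyadic_index l \<tau> \<le> max 1 (\<bar>of_int \<tau>\<bar> / l)"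
  "max 1 (\<bar>of_int \<tau>\<bar> / l) \<le> 2 ^ (dyadic_index l \<tau> + 1)"
proof -
  define w where "w = max 1 (\<bar>of_int \<tau>\<bar> / l)"
  have w: "w \<ge> 1" by (simp add: w_def)
  then have n: "real (dyadic_index l \<tau>) = of_int \<lfloor>log 2 w\<rfloor>"
    by (simp add: dyadic_index_def w_def)
  have "real (dyadic_index l \<tau>) \<le> log 2 w" "log 2 w \<le> real (dyadic_index l \<tau> + 1)"
    using n by linarith+
  then have "2 powr real (dyadic_index l \<tau>) \<le> w" "w \<le> 2 powr real (dyadic_index l \<tau> + 1)"
    using w by (simp_all add: le_log_iff log_le_iff)
  then show "2 ^ dyadic_index l \<tau> \<le> w" "w \<le> 2 ^ (dyadic_index l \<tau> + 1)"
    by (simp_all only: powr_realpow[of 2, simplified])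
qed

text \<open>On the diagonal the plain L2 bound, \<open>m = 0\<close>, suffices. For
  \<open>j < i\<close> the off-diagonal estimate applies with
  \<open>\<rho> = 2 ^ (j + 1) * l\<close> and \<open>\<mu> = 2 ^ i * l\<close>; then
  \<open>2 * \<rho> / \<mu>\<close> is 4 times \<open>2 powr (- (i - j))\<close>, the origin of
  \<open>4 ^ N\<close>. The case \<open>i < j\<close> is the transposed one.\<close>

lemma dyadic_block_bound:
  assumes bnd: "multiplier_bounds C l N \<kappa>" and fin: "finite F" "finite T"
    and F: "\<And>\<sigma>. \<sigma> \<in> F \<Longrightarrow> dyadic_index l \<sigma> = j" and T: "\<And>\<tau>. \<tau> \<in> T \<Longrightarrow> dyadic_index l \<tau> = i"
    and pos: "0 < l" "0 \<le> C"
  shows "norm (\<Sum>\<tau>\<in>T. \<Sum>\<sigma>\<in>F. g \<tau> * f \<sigma> * \<kappa> (\<sigma> - \<tau>))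
    \<le> C * 4 ^ N * 2 powr (- real N * \<bar>real i - real j\<bar>) *
        (L2_set (\<lambda>\<sigma>. norm (f \<sigma>)) F * L2_set (\<lambda>\<tau>. norm (g \<tau>)) T)"
proof -
  have upper: "\<bar>of_int k\<bar> \<le> 2 ^ (dyadic_index l k + 1) * l" for k
    using dyadic_index(2)[of k l] pos by (simp add: pos_divide_le_eq)
  \<comment> \<open>Block 0 contains the frequency 0, hence the restriction to positive indices; the
    higher of two different indices is always positive.\<close>
  have lower: "2 ^ dyadic_index l k * l \<le> \<bar>of_int k\<bar>" if "dyadic_index l k > 0" for k
  proof -
    have "(2::real) ^ dyadic_index l k > 1" using that by simp
    then have "2 ^ dyadic_index l k \<le> \<bar>of_int k\<bar> / l"
      using dyadic_index(1)[of l k] by linarith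
    then show ?thesis using pos by (simp add: pos_le_divide_eq)
  qed
  have ratio: "(2 * (2 ^ (m + 1) * l) / (2 ^ n * l)) ^ N = 4 ^ N * 2 powr (- real N * (real n - real m))" for m n :: nat
  proof -
    have "2 * (2 ^ (m + 1) * l) / (2 ^ n * l) = 4 * 2 powr (- (real n - real m))"
      using pos by (simp add: powr_diff powr_realpow)
    then have "(2 * (2 ^ (m + 1) * l) / (2 ^ n * l)) ^ N = 4 ^ N * (2 powr (- (real n - real m))) ^ N"
      by (simp only: power_mult_distrib)
    also have "(2 powr (- (real n - real m))) ^ N = 2 powr (- real N * (real n - real m))"
      by (subst powr_realpow[symmetric]) (simp_all add: powr_powr algebra_simps)
    finally show ?thesis .
  qed
  have l_le: "l \<le> 2 ^ (m + 1) * l" for m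
    using pos mult_right_mono[of 1 "2 ^ (m + 1)" l] one_le_power[of "2::real" "m + 1"] by simp
  consider "i = j" | "j < i" | "i < j" by linarith
  then show ?thesis
  proof cases
    case 1
    have "norm (\<Sum>\<tau>\<in>T. \<Sum>\<sigma>\<in>F. g \<tau> * f \<sigma> * \<kappa> (\<sigma> - \<tau>)) \<le> C * 
        (L2_set (\<lambda>\<sigma>. norm (f \<sigma>)) F * L2_set (\<lambda>\<tau>. norm (g \<tau>)) T)"
      using multiplier_boundsD[OF bnd _ fin, of 0] by simp
    also have "\<dots> \<le> C * 4 ^ N * (L2_set (\<lambda>\<sigma>. norm (f \<sigma>)) F * L2_set (\<lambda>\<tau>. norm (g \<tau>)) T)"
      using pos mult_left_mono[of 1 "4 ^ N" C] by (intro mult_right_mono mult_nonneg_nonneg L2_set_nonneg) auto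
    finally show ?thesis using 1 by simp
  next
    case 2
    have "norm (\<Sum>\<tau>\<in>T. \<Sum>\<sigma>\<in>F. g \<tau> * f \<sigma> * \<kappa> (\<sigma> - \<tau>))
      \<le> C * (2 * (2 ^ (j + 1) * l) / (2 ^ i * l)) ^ N * (L2_set (\<lambda>\<sigma>. norm (f \<sigma>)) F * L2_set (\<lambda>\<tau>. norm (g \<tau>)) T)"
      by (rule multiplier_off_diagonal[OF bnd fin]) (use upper lower F T 2 pos l_le in force)+
    then show ?thesis unfolding ratio using 2 by (simp add: mult.assoc)
  next
    case 3
    have "norm (\<Sum>\<sigma>\<in>F. \<Sum>\<tau>\<in>T. f \<sigma> * g \<tau> * \<kappa> (- (\<tau> - \<sigma>)))
      \<le> C * (2 * (2 ^ (i + 1) * l) / (2 ^ j * l)) ^ N * (L2_set (\<lambda>\<tau>. norm (g \<tau>)) T * L2_set (\<lambda>\<sigma>. norm (f \<sigma>)) F)"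
      by (rule multiplier_off_diagonal[OF multiplier_bounds_reflect[OF bnd] fin(2,1)])
         (use upper lower F T 3 pos l_le in force)+
    moreover have "(\<Sum>\<tau>\<in>T. \<Sum>\<sigma>\<in>F. g \<tau> * f \<sigma> * \<kappa> (\<sigma> - \<tau>)) = (\<Sum>\<sigma>\<in>F. \<Sum>\<tau>\<in>T. f \<sigma> * g \<tau> * \<kappa> (- (\<tau> - \<sigma>)))"
      by (subst sum.swap) (simp add: mult_ac)
    ultimately show ?thesis unfolding ratio using 3 by (simp add: mult_ac)
  qed
qed

text \<open>These are the row sums of a Schur test over block indices. Each side of \<open>j\<close>
  is dominated by a geometric series with sum at most 2.\<close>

lemma sum_half_powr_abs_diff: "(\<Sum>i<n. 2 powr (- \<bar>real i - real j\<bar>)) \<le> 4"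
proof -
  have geo: "(\<Sum>i<m. 2 powr (- real i)) \<le> 2" for m
  proof -
    have "(\<Sum>i<m. 2 powr (- real i)) = (\<Sum>i<m. (1 / 2) ^ i)"
      by (simp add: powr_minus_divide powr_realpow power_one_over)
    also have "\<dots> \<le> 2" by (simp add: sum_gp_strict)
    finally show ?thesis .
  qed
  have "(\<Sum>i<n. 2 powr (- \<bar>real i - real j\<bar>)) \<le> (\<Sum>i<n + j. 2 powr (- \<bar>real i - real j\<bar>))"
    by (rule sum_mono2) auto
  also have "\<dots> = (\<Sum>i<j. 2 powr (- \<bar>real i - real j\<bar>)) + (\<Sum>i=j..<n + j. 2 powr (- \<bar>real i - real j\<bar>))"
    by (subst sum.atLeastLessThan_concat[of 0 j "n + j", simplified atLeast0LessThan, symmetric]) auto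
  also have "(\<Sum>i=j..<n + j. 2 powr (- \<bar>real i - real j\<bar>)) = (\<Sum>i<n. 2 powr (- real i))"
    by (rule sum.reindex_bij_witness[of _ "\<lambda>i. i + j" "\<lambda>i. i - j"]) auto
  also have "\<dots> \<le> 2" by (rule geo)
  also have "(\<Sum>i<j. 2 powr (- \<bar>real i - real j\<bar>)) = (\<Sum>i\<in>{1..j}. 2 powr (- real i))"
    by (rule sum.reindex_bij_witness[of _ "\<lambda>i. j - i" "\<lambda>i. j - i"]) (auto simp: of_nat_diff)
  also have "\<dots> \<le> (\<Sum>i<Suc j. 2 powr (- real i))"
    by (rule sum_mono2) auto
  also have "\<dots> \<le> 2" by (rule geo)
  finally show ?thesis by simp
qed

text \<open>For \<open>s \<ge> 0\<close> the lower end of the block decides. For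
  \<open>s < 0\<close> the upper end does, and its factor 2 raised to the power
  \<open>- 2 * s\<close> is \<open>4 powr |s|\<close>.\<close>

lemma dyadic_weight:
  assumes "2 ^ j \<le> w" "w \<le> 2 ^ (j + 1)"
  shows "2 powr (2 * s * real j) \<le> 4 powr \<bar>s\<bar> * w powr (2 * s)"
proof -
  have w: "w > 0" by (rule less_le_trans[OF _ assms(1)]) simp
  have eq: "2 powr (2 * s * real j) = (2 ^ j) powr (2 * s)"
    by (simp add: powr_powr mult.commute flip: powr_realpow)
  show ?thesis
  proof (cases "0 \<le> s")
    case True
    then have "(2 ^ j) powr (2 * s) \<le> w powr (2 * s)" using assms(1) by (intro powr_mono2) auto
    also have "\<dots> \<le> 4 powr \<bar>s\<bar> * w powr (2 * s)"
      using mult_right_mono[of 1 "4 powr \<bar>s\<bar>" "w powr (2 * s)"] ge_one_powr_ge_zero[of 4 "\<bar>s\<bar>"] by simp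
    finally show ?thesis using eq by simp
  next
    case False
    have "(2 ^ j) powr (2 * s) \<le> (w / 2) powr (2 * s)"
      using False w assms(2) by (intro powr_mono2') auto
    also have "\<dots> = 4 powr \<bar>s\<bar> * w powr (2 * s)"
    proof -
      have "(4 :: real) powr \<bar>s\<bar> = 2 powr (- (2 * s))"
        using False powr_powr[of 2 2 "\<bar>s\<bar>"] by simp
      then show ?thesis using w by (simp add: powr_divide powr_minus_divide)
    qed
    finally show ?thesis using eq by simp
  qed
qed

text \<open>Conjugation with the weight multiplies block \<open>(i, j)\<close> by
  \<open>2 powr (s * (i - j))\<close>. As \<open>N \<ge> |s| + 1\<close>, a decay
  \<open>2 powr (- |i - j|)\<close> survives, and a Schur test closes the estimate. Of the constant,
  2 is the row sum 4 times the 1/2 of AM-GM, and \<open>4 powr |s|\<close> pays for replacing block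
  weights by \<open>w\<close>.\<close>

lemma weighted_multiplier_bound:
  assumes bnd: "multiplier_bounds C l N \<kappa>" and fin: "finite F" "finite T"
    and pos: "0 < l" "0 \<le> C" and N: "\<bar>s\<bar> + 1 \<le> real N"
  defines "w \<equiv> (\<lambda>k. max 1 (\<bar>real_of_int k\<bar> / l))"
  shows "norm (\<Sum>\<tau>\<in>T. \<Sum>\<sigma>\<in>F. g \<tau> * f \<sigma> * \<kappa> (\<sigma> - \<tau>))
    \<le> C * 4 ^ N * 2 * 4 powr \<bar>s\<bar> * ((\<Sum>\<sigma>\<in>F. w \<sigma> powr (2 * s) * (norm (f \<sigma>))\<^sup>2) + 
         (\<Sum>\<tau>\<in>T. w \<tau> powr (- 2 * s) * (norm (g \<tau>))\<^sup>2))"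
proof -
  define n where "n = Suc (Max (insert 0 (dyadic_index l ` (F \<union> T))))"
  have n: "dyadic_index l k < n" if "k \<in> F \<union> T" for k
    unfolding n_def using that fin by (simp add: less_Suc_eq_le)
  define Fb where "Fb j = {\<sigma> \<in> F. dyadic_index l \<sigma> = j}" for j
  define Tb where "Tb i = {\<tau> \<in> T. dyadic_index l \<tau> = i}" for i
  have finb: "finite (Fb j)" "finite (Tb j)" for j using fin by (auto simp: Fb_def Tb_def)
  have splitF: "(\<Sum>j<n. sum h (Fb j)) = sum h F" for h :: "int \<Rightarrow> 'b::comm_monoid_add"
    unfolding Fb_def using fin n by (intro sum.group) auto
  have splitT: "(\<Sum>j<n. sum h (Tb j)) = sum h T" for h :: "int \<Rightarrow> 'b::comm_monoid_add"
    unfolding Tb_def using fin n by (intro sum.group) auto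
  \<comment> \<open>The opposite exponents in \<open>a\<close> and \<open>b\<close> reflect that
    \<open>f\<close> is measured in the weighted space and \<open>g\<close> in its dual.\<close>
  define a where "a j = 2 powr (s * real j) * L2_set (\<lambda>\<sigma>. norm (f \<sigma>)) (Fb j)" for j
  define b where "b i = 2 powr (- s * real i) * L2_set (\<lambda>\<tau>. norm (g \<tau>)) (Tb i)" for i
  have ab: "0 \<le> a i" "0 \<le> b i" for i by (simp_all add: a_def b_def L2_set_nonneg)
  have block: "norm (\<Sum>\<tau>\<in>Tb i. \<Sum>\<sigma>\<in>Fb j. g \<tau> * f \<sigma> * \<kappa> (\<sigma> - \<tau>))
      \<le> C * 4 ^ N * (2 powr (- \<bar>real i - real j\<bar>) * ((a j)\<^sup>2 + (b i)\<^sup>2) / 2)" for i j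
  proof -
    have "norm (\<Sum>\<tau>\<in>Tb i. \<Sum>\<sigma>\<in>Fb j. g \<tau> * f \<sigma> * \<kappa> (\<sigma> - \<tau>)) \<le> C * 4 ^ N * 2 powr (- real N * \<bar>real i - real j\<bar>) *
        (L2_set (\<lambda>\<sigma>. norm (f \<sigma>)) (Fb j) * L2_set (\<lambda>\<tau>. norm (g \<tau>)) (Tb i))"
      by (rule dyadic_block_bound[OF bnd finb]) (use pos in \<open>auto simp: Fb_def Tb_def\<close>)
    also have "\<dots> = C * 4 ^ N * (2 powr (- real N * \<bar>real i - real j\<bar> + s * (real i - real j)) * (a j * b i))"
    proof -
      have "L2_set (\<lambda>\<sigma>. norm (f \<sigma>)) (Fb j) = 2 powr (- (s * real j)) * a j"
        "L2_set (\<lambda>\<tau>. norm (g \<tau>)) (Tb i) = 2 powr (s * real i) * b i"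
        by (simp_all add: a_def b_def powr_minus)
      moreover have "2 powr (- real N * \<bar>real i - real j\<bar> + s * (real i - real j)) =
        2 powr (- real N * \<bar>real i - real j\<bar>) * 2 powr (- (s * real j)) * 2 powr (s * real i)"
        by (simp add: algebra_simps flip: powr_add)
      ultimately show ?thesis by simp
    qed
    also have "\<dots> \<le> C * 4 ^ N * (2 powr (- \<bar>real i - real j\<bar>) * (((a j)\<^sup>2 + (b i)\<^sup>2) / 2))"
    proof (intro mult_left_mono mult_mono)
      have "s * (real i - real j) \<le> \<bar>s\<bar> * \<bar>real i - real j\<bar>"
        by (metis abs_ge_self abs_mult)
      also have "\<dots> \<le> (real N - 1) * \<bar>real i - real j\<bar>"
        using N by (intro mult_right_mono) auto
      finally show "2 powr (- real N * \<bar>real i - real j\<bar> + s * (real i - real j)) \<le> 2 powr (- \<bar>real i - real j\<bar>)"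
        by (simp add: algebra_simps)
      show "a j * b i \<le> ((a j)\<^sup>2 + (b i)\<^sup>2) / 2" using sum_squares_bound[of "a j" "b i"] by simp
    qed (use pos ab in auto)
    finally show ?thesis by simp
  qed
  have "(\<Sum>\<tau>\<in>T. \<Sum>\<sigma>\<in>F. g \<tau> * f \<sigma> * \<kappa> (\<sigma> - \<tau>)) = (\<Sum>i<n. \<Sum>j<n. \<Sum>\<tau>\<in>Tb i. \<Sum>\<sigma>\<in>Fb j. g \<tau> * f \<sigma> * \<kappa> (\<sigma> - \<tau>))"
    unfolding splitF[symmetric] splitT[symmetric] by (intro sum.cong refl sum.swap)
  also have "norm \<dots> \<le> (\<Sum>i<n. \<Sum>j<n. C * 4 ^ N * (2 powr (- \<bar>real i - real j\<bar>) * ((a j)\<^sup>2 + (b i)\<^sup>2) / 2))"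
    by (intro sum_norm_le block)
  also have "\<dots> = C * 4 ^ N / 2 * ((\<Sum>i<n. \<Sum>j<n. 2 powr (- \<bar>real i - real j\<bar>) * (a j)\<^sup>2) +
      (\<Sum>i<n. \<Sum>j<n. 2 powr (- \<bar>real i - real j\<bar>) * (b i)\<^sup>2))"
    unfolding sum_distrib_left sum.distrib[symmetric] by (intro sum.cong refl) (simp add: field_simps)
  finally have main: "norm (\<Sum>\<tau>\<in>T. \<Sum>\<sigma>\<in>F. g \<tau> * f \<sigma> * \<kappa> (\<sigma> - \<tau>)) \<le> C * 4 ^ N / 2 * ((\<Sum>i<n. \<Sum>j<n. 2 powr (- \<bar>real i - real j\<bar>) * (a j)\<^sup>2) +
      (\<Sum>i<n. \<Sum>j<n. 2 powr (- \<bar>real i - real j\<bar>) * (b i)\<^sup>2))" .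
  have "(\<Sum>i<n. \<Sum>j<n. 2 powr (- \<bar>real i - real j\<bar>) * (a j)\<^sup>2) \<le> 4 * (\<Sum>j<n. (a j)\<^sup>2)"
  proof -
    have "(\<Sum>i<n. \<Sum>j<n. 2 powr (- \<bar>real i - real j\<bar>) * (a j)\<^sup>2) = (\<Sum>j<n. (\<Sum>i<n. 2 powr (- \<bar>real i - real j\<bar>)) * (a j)\<^sup>2)"
      by (subst sum.swap) (simp add: sum_distrib_right)
    also have "\<dots> \<le> (\<Sum>j<n. 4 * (a j)\<^sup>2)"
      by (intro sum_mono mult_right_mono sum_half_powr_abs_diff) simp
    finally show ?thesis by (simp add: sum_distrib_left)
  qed
  moreover have "(\<Sum>i<n. \<Sum>j<n. 2 powr (- \<bar>real i - real j\<bar>) * (b i)\<^sup>2) \<le> 4 * (\<Sum>i<n. (b i)\<^sup>2)"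
  proof -
    have "(\<Sum>i<n. \<Sum>j<n. 2 powr (- \<bar>real i - real j\<bar>) * (b i)\<^sup>2) = (\<Sum>i<n. (\<Sum>j<n. 2 powr (- \<bar>real j - real i\<bar>)) * (b i)\<^sup>2)"
      by (simp add: sum_distrib_right abs_minus_commute)
    also have "\<dots> \<le> (\<Sum>i<n. 4 * (b i)\<^sup>2)"
      by (intro sum_mono mult_right_mono sum_half_powr_abs_diff) simp
    finally show ?thesis by (simp add: sum_distrib_left)
  qed
  moreover have "(\<Sum>j<n. (a j)\<^sup>2) \<le> 4 powr \<bar>s\<bar> * (\<Sum>\<sigma>\<in>F. w \<sigma> powr (2 * s) * (norm (f \<sigma>))\<^sup>2)"
  proof -
    have "(a j)\<^sup>2 \<le> (\<Sum>\<sigma>\<in>Fb j. 4 powr \<bar>s\<bar> * (w \<sigma> powr (2 * s) * (norm (f \<sigma>))\<^sup>2))" for j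
    proof -
      have "(a j)\<^sup>2 = (\<Sum>\<sigma>\<in>Fb j. 2 powr (2 * s * real j) * (norm (f \<sigma>))\<^sup>2)"
        by (simp add: a_def power_mult_distrib L2_set_def sum_nonneg sum_distrib_left power2_eq_square mult_ac flip: powr_add)
      also have "\<dots> \<le> (\<Sum>\<sigma>\<in>Fb j. 4 powr \<bar>s\<bar> * w \<sigma> powr (2 * s) * (norm (f \<sigma>))\<^sup>2)"
        using dyadic_index by (intro sum_mono mult_right_mono dyadic_weight) (auto simp: Fb_def w_def)
      finally show ?thesis by (simp add: mult.assoc)
    qed
    then show ?thesis unfolding splitF[symmetric] sum_distrib_left by (intro sum_mono)
  qed
  moreover have "(\<Sum>i<n. (b i)\<^sup>2) \<le> 4 powr \<bar>s\<bar> * (\<Sum>\<tau>\<in>T. w \<tau> powr (- 2 * s) * (norm (g \<tau>))\<^sup>2)"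
  proof -
    have "(b j)\<^sup>2 \<le> (\<Sum>\<sigma>\<in>Tb j. 4 powr \<bar>s\<bar> * (w \<sigma> powr (- 2 * s) * (norm (g \<sigma>))\<^sup>2))" for j
    proof -
      have "(b j)\<^sup>2 = (\<Sum>\<sigma>\<in>Tb j. 2 powr (2 * (- s) * real j) * (norm (g \<sigma>))\<^sup>2)"
        by (simp add: b_def power_mult_distrib L2_set_def sum_nonneg sum_distrib_left power2_eq_square mult_ac flip: powr_add)
      also have "\<dots> \<le> (\<Sum>\<sigma>\<in>Tb j. 4 powr \<bar>- s\<bar> * w \<sigma> powr (2 * (- s)) * (norm (g \<sigma>))\<^sup>2)"
        using dyadic_index by (intro sum_mono mult_right_mono dyadic_weight) (auto simp: Tb_def w_def)
      finally show ?thesis by (simp add: mult.assoc)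
    qed
    then show ?thesis unfolding splitT[symmetric] sum_distrib_left by (intro sum_mono)
  qed
  ultimately have "(\<Sum>i<n. \<Sum>j<n. 2 powr (- \<bar>real i - real j\<bar>) * (a j)\<^sup>2) +
      (\<Sum>i<n. \<Sum>j<n. 2 powr (- \<bar>real i - real j\<bar>) * (b i)\<^sup>2) \<le>
      4 * 4 powr \<bar>s\<bar> * ((\<Sum>\<sigma>\<in>F. w \<sigma> powr (2 * s) * (norm (f \<sigma>))\<^sup>2) + 
         (\<Sum>\<tau>\<in>T. w \<tau> powr (- 2 * s) * (norm (g \<tau>))\<^sup>2))"
    unfolding distrib_left by linarith
  then have "C * 4 ^ N / 2 * ((\<Sum>i<n. \<Sum>j<n. 2 powr (- \<bar>real i - real j\<bar>) * (a j)\<^sup>2) +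
      (\<Sum>i<n. \<Sum>j<n. 2 powr (- \<bar>real i - real j\<bar>) * (b i)\<^sup>2)) \<le> C * 4 ^ N / 2 * (
      4 * 4 powr \<bar>s\<bar> * ((\<Sum>\<sigma>\<in>F. w \<sigma> powr (2 * s) * (norm (f \<sigma>))\<^sup>2) + 
         (\<Sum>\<tau>\<in>T. w \<tau> powr (- 2 * s) * (norm (g \<tau>))\<^sup>2)))"
    by (rule mult_left_mono) (use pos in simp)
  with main show ?thesis by (simp add: mult_ac)
qed

section \<open>Test functions on the torus\<close>

text \<open>The partial derivatives are explicit witnesses, so sums, products and shears are handled
  by derivative rules; \<open>has_partials_dir_deriv\<close> recovers \<open>dir_deriv\<close>
  afterwards.\<close>

definition has_partials :: 
  "(real \<times> real \<Rightarrow> complex) \<Rightarrow> (real \<times> real \<Rightarrow> complex) \<Rightarrow> (real \<times> real \<Rightarrow> complex) \<Rightarrow> bool" where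
  "has_partials f ft fx \<longleftrightarrow> (\<forall>z. (f has_derivative (\<lambda>h. fst h *\<^sub>R ft z + snd h *\<^sub>R fx z)) (at z))"

lemma has_partialsD:
  "has_partials f ft fx \<Longrightarrow> (f has_derivative (\<lambda>h. fst h *\<^sub>R ft z + snd h *\<^sub>R fx z)) (at z)"
  unfolding has_partials_def by blast

lemma Basis_plane: "(Basis :: (real \<times> real) set) = {(1, 0), (0, 1)}"
  by (auto simp: Basis_prod_def)

lemma has_partials_dir_deriv:
  assumes "has_partials f ft fx"
  shows "dir_deriv (1, 0) f = ft" "dir_deriv (0, 1) f = fx"
proof -
  have "frechet_derivative f (at z) = (\<lambda>h. fst h *\<^sub>R ft z + snd h *\<^sub>R fx z)" for z
    using frechet_derivative_at[OF has_partialsD[OF assms, of z]] by simp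
  then show "dir_deriv (1, 0) f = ft" "dir_deriv (0, 1) f = fx"
    by (auto simp: dir_deriv_def)
qed

lemma differentiable_has_partials:
  assumes "\<And>z. f differentiable (at z)"
  shows "has_partials f (dir_deriv (1, 0) f) (dir_deriv (0, 1) f)"
  unfolding has_partials_def
proof
  fix z
  let ?L = "frechet_derivative f (at z)"
  have L: "(f has_derivative ?L) (at z)" using assms frechet_derivative_works by blast
  then have lin: "linear ?L" by (rule has_derivative_linear)
  have "?L h = fst h *\<^sub>R ?L (1, 0) + snd h *\<^sub>R ?L (0, 1)" for h
  proof -
    have "h = fst h *\<^sub>R (1, 0) + snd h *\<^sub>R (0, 1)" by (simp add: prod_eq_iff)
    then have "?L h = ?L (fst h *\<^sub>R (1, 0) + snd h *\<^sub>R (0, 1))" by (rule arg_cong)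
    then show ?thesis by (simp only: linear_add[OF lin] linear_scale[OF lin])
  qed
  then have "?L = (\<lambda>h. fst h *\<^sub>R dir_deriv (1, 0) f z + snd h *\<^sub>R dir_deriv (0, 1) f z)"
    unfolding dir_deriv_def by (rule ext)
  with L show "(f has_derivative (\<lambda>h. fst h *\<^sub>R dir_deriv (1, 0) f z + snd h *\<^sub>R dir_deriv (0, 1) f z)) (at z)"
    by simp
qed

lemma has_partials_continuous: "has_partials f ft fx \<Longrightarrow> continuous_on UNIV f"
  by (auto simp: has_partials_def intro!: continuous_at_imp_continuous_on intro: has_derivative_continuous)

lemma has_partials_vector_derivative:
  assumes "has_partials f ft fx"
  shows "((\<lambda>t. f (t, x)) has_vector_derivative ft (t, x)) (at t within S)"
    "((\<lambda>x. f (t, x)) has_vector_derivative fx (t, x)) (at x within S)"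
proof -
  have f: "(f has_derivative (\<lambda>h. fst h *\<^sub>R ft (t, x) + snd h *\<^sub>R fx (t, x))) (at (t, x))"
    using assms by (simp add: has_partials_def)
  have "((\<lambda>t. f (t, x)) has_derivative (\<lambda>h. fst (h, 0::real) *\<^sub>R ft (t, x) + snd (h, 0::real) *\<^sub>R fx (t, x))) (at t within S)"
    by (rule has_derivative_compose[of "\<lambda>t. (t, x)" "\<lambda>h. (h, 0)", OF _ f]) (auto intro!: derivative_eq_intros)
  then show "((\<lambda>t. f (t, x)) has_vector_derivative ft (t, x)) (at t within S)"
    by (simp add: has_vector_derivative_def)
  have "((\<lambda>x. f (t, x)) has_derivative (\<lambda>h. fst (0::real, h) *\<^sub>R ft (t, x) + snd (0::real, h) *\<^sub>R fx (t, x))) (at x within S)"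
    by (rule has_derivative_compose[of "\<lambda>x. (t, x)" "\<lambda>h. (0, h)", OF _ f]) (auto intro!: derivative_eq_intros)
  then show "((\<lambda>x. f (t, x)) has_vector_derivative fx (t, x)) (at x within S)"
    by (simp add: has_vector_derivative_def)
qed

text \<open>Write \<open>f (t, x) - f (t, c)\<close> as the integral of \<open>fx\<close> over
  \<open>{c..x}\<close>. Differentiating under the integral in \<open>t\<close> gives
  \<open>ft (t, x) - ft (t, c)\<close> as the integral of \<open>fxt\<close>, and the fundamental
  theorem in \<open>x\<close> finishes. It serves to bring iterated derivatives into the order used
  by \<open>test_seminorm\<close>.\<close>

lemma mixed_partials_commute:
  assumes f: "has_partials f ft fx" and ft: "has_partials ft ftt ftx" and fx: "has_partials fx fxt fxx"
    and cont: "continuous_on UNIV fxt"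
  shows "ftx = fxt"
proof
  fix z :: "real \<times> real"
  obtain t0 x0 where z: "z = (t0, x0)" by (cases z)
  define c where "c = x0 - 1"
  have cont_line: "continuous_on S (\<lambda>y. h (t, y))" if "continuous_on UNIV h" 
    for S t and h :: "real \<times> real \<Rightarrow> complex"
    by (rule continuous_on_compose2[OF that]) (auto intro!: continuous_intros)
  have eq: "ft (t0, x) - ft (t0, c) = integral {c..x} (\<lambda>y. fxt (t0, y))" if "c \<le> x" for x
  proof -
    have int: "integral {c..x} (\<lambda>y. fx (t, y)) = f (t, x) - f (t, c)" for t
      using has_partials_vector_derivative(2)[OF f] that
      by (intro integral_unique fundamental_theorem_of_calculus) auto
    have "((\<lambda>t. integral (cbox c x) (\<lambda>y. fx (t, y))) has_vector_derivative
        integral (cbox c x) (\<lambda>y. fxt (t0, y))) (at t0 within UNIV)"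
    proof (rule leibniz_rule_vector_derivative)
      show "(\<lambda>y. fx (t, y)) integrable_on cbox c x" for t
        by (intro integrable_continuous cont_line has_partials_continuous[OF fx])
      show "continuous_on (UNIV \<times> cbox c x) (\<lambda>(t, y). fxt (t, y))"
        using continuous_on_subset[OF cont] by (simp add: case_prod_beta)
    qed (use has_partials_vector_derivative(1)[OF fx] in auto)
    then have "((\<lambda>t. f (t, x) - f (t, c)) has_vector_derivative integral {c..x} (\<lambda>y. fxt (t0, y))) (at t0)"
      using int by simp
    moreover have "((\<lambda>t. f (t, x) - f (t, c)) has_vector_derivative ft (t0, x) - ft (t0, c)) (at t0)"
      by (intro has_vector_derivative_diff has_partials_vector_derivative[OF f])
    ultimately show ?thesis by (rule vector_derivative_unique_at[symmetric])
  qed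
  have "((\<lambda>x. integral {c..x} (\<lambda>y. fxt (t0, y))) has_vector_derivative fxt (t0, x0)) (at x0 within {c..x0 + 1})"
    by (rule integral_has_vector_derivative) (auto simp: c_def intro!: cont_line cont)
  then have "((\<lambda>x. ft (t0, x) - ft (t0, c)) has_vector_derivative fxt (t0, x0)) (at x0 within {c..x0 + 1})"
    by (rule has_vector_derivative_transform[rotated 2]) (use eq in \<open>auto simp: c_def\<close>)
  moreover have "((\<lambda>x. ft (t0, x) - ft (t0, c)) has_vector_derivative ftx (t0, x0) - 0) (at x0 within {c..x0 + 1})"
    by (intro has_vector_derivative_diff has_partials_vector_derivative[OF ft] has_vector_derivative_const)
  ultimately show "ftx z = fxt z"
    using vector_derivative_unique_within[of x0 "{c..x0 + 1}"]
    by (auto simp: z c_def trivial_limit_within islimpt_Icc)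
qed

lemma smooth_differentiable: "smooth \<phi> \<Longrightarrow> \<phi> differentiable (at z)"
  unfolding smooth_def by (drule spec[of _ "[]"]) (auto simp: differentiable_on_def)

lemma smooth_dir_deriv:
  assumes "smooth \<phi>" "v \<in> Basis"
  shows "smooth (dir_deriv v \<phi>)"
  unfolding smooth_def
proof (intro allI impI)
  fix vs :: "'a list" assume "set vs \<subseteq> Basis"
  then have "foldr dir_deriv (vs @ [v]) \<phi> differentiable_on UNIV"
    using assms by (intro assms(1)[unfolded smooth_def, rule_format]) auto
  then show "foldr dir_deriv vs (dir_deriv v \<phi>) differentiable_on UNIV" by simp
qed

lemma test_fun_has_partials:
  "\<phi> \<in> test_fun \<Longrightarrow> has_partials \<phi> (dir_deriv (1, 0) \<phi>) (dir_deriv (0, 1) \<phi>)"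
  by (intro differentiable_has_partials smooth_differentiable) (simp add: test_fun_def)

lemma dir_deriv_periodic:
  fixes \<phi> :: "real \<times> real \<Rightarrow> complex"
  assumes "has_partials \<phi> ft fx" "\<And>z. \<phi> (z + p) = \<phi> z"
  shows "ft (z + p) = ft z" "fx (z + p) = fx z"
proof -
  have "((\<lambda>z. \<phi> (z + p)) has_derivative (\<lambda>h. fst h *\<^sub>R ft (z + p) + snd h *\<^sub>R fx (z + p))) (at z)" for z
    by (rule has_derivative_compose[of "\<lambda>z. z + p" "\<lambda>h. h", where g = \<phi>, OF _ has_partialsD[OF assms(1)]])
       (auto intro!: derivative_eq_intros)
  then have "has_partials \<phi> (\<lambda>z. ft (z + p)) (\<lambda>z. fx (z + p))"
    by (simp add: has_partials_def assms(2))
  from has_partials_dir_deriv[OF this] has_partials_dir_deriv[OF assms(1)]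
  show "ft (z + p) = ft z" "fx (z + p) = fx z" by metis+
qed

lemma test_fun_dir_deriv:
  assumes "\<phi> \<in> test_fun" "v \<in> Basis"
  shows "dir_deriv v \<phi> \<in> test_fun"
proof -
  have "\<And>z. \<phi> (z + (2 * pi, 0)) = \<phi> z" "\<And>z. \<phi> (z + (0, 2 * pi)) = \<phi> z"
    using assms(1) by (auto simp: test_fun_def)
  from dir_deriv_periodic[OF test_fun_has_partials[OF assms(1)] this(1)]
    dir_deriv_periodic[OF test_fun_has_partials[OF assms(1)] this(2)] assms(2)
  have "dir_deriv v \<phi> (z + (2 * pi, 0)) = dir_deriv v \<phi> z" "dir_deriv v \<phi> (z + (0, 2 * pi)) = dir_deriv v \<phi> z" for z
    by (cases z; auto simp: Basis_plane)+
  from this[of "(t, x)" for t x] smooth_dir_deriv[of \<phi> v] assms show ?thesis by (simp add: test_fun_def)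
qed

lemma test_fun_commute:
  assumes "\<phi> \<in> test_fun"
  shows "dir_deriv (0, 1) (dir_deriv (1, 0) \<phi>) = dir_deriv (1, 0) (dir_deriv (0, 1) \<phi>)"
proof (rule mixed_partials_commute)
  have *: "dir_deriv (1, 0) \<phi> \<in> test_fun" "dir_deriv (0, 1) \<phi> \<in> test_fun"
    using assms test_fun_dir_deriv by (auto simp: Basis_plane)
  show "has_partials \<phi> (dir_deriv (1, 0) \<phi>) (dir_deriv (0, 1) \<phi>)"
    "has_partials (dir_deriv (1, 0) \<phi>) (dir_deriv (1, 0) (dir_deriv (1, 0) \<phi>)) (dir_deriv (0, 1) (dir_deriv (1, 0) \<phi>))"
    "has_partials (dir_deriv (0, 1) \<phi>) (dir_deriv (1, 0) (dir_deriv (0, 1) \<phi>)) (dir_deriv (0, 1) (dir_deriv (0, 1) \<phi>))"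
    using assms * test_fun_has_partials by auto
  show "continuous_on UNIV (dir_deriv (1, 0) (dir_deriv (0, 1) \<phi>))"
    using * test_fun_dir_deriv test_fun_has_partials has_partials_continuous by (metis Basis_plane insertI1)
qed

lemma test_fun_power:
  assumes "\<phi> \<in> test_fun"
  shows "(dir_deriv (1, 0) ^^ j) ((dir_deriv (0, 1) ^^ k) \<phi>) \<in> test_fun"
proof -
  have "(dir_deriv (0, 1) ^^ k) \<phi> \<in> test_fun"
    by (induction k) (use assms test_fun_dir_deriv in \<open>auto simp: Basis_plane\<close>)
  then show ?thesis
    by (induction j) (use test_fun_dir_deriv in \<open>auto simp: Basis_plane\<close>)
qed

lemma test_fun_commute_power:
  assumes "\<phi> \<in> test_fun"
  shows "dir_deriv (0, 1) ((dir_deriv (1, 0) ^^ j) ((dir_deriv (0, 1) ^^ k) \<phi>)) =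
    (dir_deriv (1, 0) ^^ j) ((dir_deriv (0, 1) ^^ Suc k) \<phi>)"
proof (induction j)
  case (Suc j)
  then show ?case using test_fun_commute[OF test_fun_power[OF assms, of j k]] by simp
qed simp

lemma test_fun_bounded:
  assumes "\<phi> \<in> test_fun"
  shows "bdd_above (range (\<lambda>z. norm (\<phi> z)))"
proof -
  let ?K = "{0..2 * pi} \<times> {0..2 * pi}"
  have "continuous_on ?K \<phi>"
    using has_partials_continuous[OF test_fun_has_partials[OF assms]] continuous_on_subset by blast
  then have "bounded (\<phi> ` ?K)"
    by (intro compact_imp_bounded compact_continuous_image compact_Times) auto
  then obtain M where M: "\<And>z. z \<in> ?K \<Longrightarrow> norm (\<phi> z) \<le> M" unfolding bounded_iff by blast
  have "norm (\<phi> (t, x)) \<le> M" for t x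
  proof -
    obtain k where k: "t + 2 * pi * of_int k \<in> {0..2 * pi}" by (rule reduce_period)
    obtain m where m: "x + 2 * pi * of_int m \<in> {0..2 * pi}" by (rule reduce_period)
    have "\<phi> (t, x) = \<phi> (t + 2 * pi * of_int k, x)"
      using periodic_int[of "\<lambda>t. \<phi> (t, x)" t k] assms by (simp add: test_fun_def)
    also have "\<dots> = \<phi> (t + 2 * pi * of_int k, x + 2 * pi * of_int m)"
      using periodic_int[of "\<lambda>x. \<phi> (t + 2 * pi * of_int k, x)" x m] assms by (simp add: test_fun_def)
    finally show ?thesis using M k m by simp
  qed
  then show ?thesis by (intro bdd_aboveI[of _ M]) auto
qed

section \<open>Derivative bounds in two variables and the seminorms of test functions\<close>

text \<open>One constant bounds all partial derivatives of order at most \<open>n\<close>, taken in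
  any order. This is the working form of \<open>test_seminorm\<close>:
  \<open>test_seminorm_le\<close> and \<open>test_fun_torus_bound\<close> compare the two in both
  directions, and the recursion matches inductions over products and shears.\<close>

fun torus_bound :: "nat \<Rightarrow> real \<Rightarrow> (real \<times> real \<Rightarrow> complex) \<Rightarrow> bool" where
  "torus_bound 0 M f \<longleftrightarrow> (\<forall>z. norm (f z) \<le> M)"
| "torus_bound (Suc n) M f \<longleftrightarrow> (\<forall>z. norm (f z) \<le> M) \<and>
     (\<exists>ft fx. has_partials f ft fx \<and> torus_bound n M ft \<and> torus_bound n M fx)"

lemma torus_bound_D: "torus_bound n M f \<Longrightarrow> norm (f z) \<le> M"
  by (cases n) (auto simp del: split_paired_All)

lemma torus_bound_nonneg: "torus_bound n M f \<Longrightarrow> 0 \<le> M"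
  using torus_bound_D norm_ge_zero order_trans by blast

lemma torus_bound_SucI:
  "(\<And>z. norm (f z) \<le> M) \<Longrightarrow> has_partials f ft fx \<Longrightarrow> torus_bound n M ft \<Longrightarrow> torus_bound n M fx \<Longrightarrow>
    torus_bound (Suc n) M f"
  by auto

lemma torus_bound_SucE:
  assumes "torus_bound (Suc n) M f"
  obtains ft fx where "has_partials f ft fx" "torus_bound n M ft" "torus_bound n M fx"
  using assms by auto

lemma torus_bound_lower:
  "torus_bound n M f \<Longrightarrow> m \<le> n \<Longrightarrow> torus_bound m M f"
proof (induction m arbitrary: n f)
  case 0
  then show ?case using torus_bound_D by simp
next
  case (Suc m)
  then obtain n' where "n = Suc n'" by (metis Suc_le_D)
  with Suc show ?case by (metis Suc_le_mono torus_bound.simps(2))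
qed

lemma torus_bound_mono:
  "torus_bound n M f \<Longrightarrow> M \<le> M' \<Longrightarrow> torus_bound n M' f"
proof (induction n arbitrary: f)
  case 0
  then show ?case by (auto intro: order_trans)
next
  case (Suc n)
  then show ?case by (meson order_trans torus_bound.simps(2))
qed

lemma has_partials_add:
  "has_partials f ft fx \<Longrightarrow> has_partials g gt gx \<Longrightarrow>
    has_partials (\<lambda>z. f z + g z) (\<lambda>z. ft z + gt z) (\<lambda>z. fx z + gx z)"
  unfolding has_partials_def
  by (auto intro!: derivative_eq_intros simp: algebra_simps)

lemma has_partials_mult:
  "has_partials f ft fx \<Longrightarrow> has_partials g gt gx \<Longrightarrow>
    has_partials (\<lambda>z. f z * g z) (\<lambda>z. f z * gt z + ft z * g z) (\<lambda>z. f z * gx z + fx z * g z)"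
  unfolding has_partials_def
  by (auto intro!: derivative_eq_intros simp: algebra_simps scaleR_conv_of_real)

lemma torus_bound_add:
  "torus_bound n M f \<Longrightarrow> torus_bound n M' g \<Longrightarrow> torus_bound n (M + M') (\<lambda>z. f z + g z)"
proof (induction n arbitrary: f g)
  case 0
  then show ?case by (auto intro: norm_triangle_mono)
next
  case (Suc n)
  obtain ft fx where f: "has_partials f ft fx" "torus_bound n M ft" "torus_bound n M fx"
    using Suc.prems(1) by (rule torus_bound_SucE)
  obtain gt gx where g: "has_partials g gt gx" "torus_bound n M' gt" "torus_bound n M' gx"
    using Suc.prems(2) by (rule torus_bound_SucE)
  show ?case
    by (rule torus_bound_SucI[OF _ has_partials_add[OF f(1) g(1)] Suc.IH[OF f(2) g(2)] Suc.IH[OF f(3) g(3)]])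
       (intro norm_triangle_mono torus_bound_D[OF Suc.prems(1)] torus_bound_D[OF Suc.prems(2)])
qed

lemma torus_bound_mult:
  "torus_bound n M f \<Longrightarrow> torus_bound n M' g \<Longrightarrow> torus_bound n (2 ^ n * (M * M')) (\<lambda>z. f z * g z)"
proof (induction n arbitrary: f g)
  case 0
  then show ?case
    by (auto simp: norm_mult intro!: mult_mono intro: order_trans[OF norm_ge_zero])
next
  case (Suc n)
  obtain ft fx where f: "has_partials f ft fx" "torus_bound n M ft" "torus_bound n M fx"
    using Suc.prems(1) by (rule torus_bound_SucE)
  obtain gt gx where g: "has_partials g gt gx" "torus_bound n M' gt" "torus_bound n M' gx"
    using Suc.prems(2) by (rule torus_bound_SucE)
  have fg: "torus_bound n M f" "torus_bound n M' g"
    by (rule torus_bound_lower[OF Suc.prems(1)], simp, rule torus_bound_lower[OF Suc.prems(2)], simp)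
  have two: "2 ^ n * (M * M') + 2 ^ n * (M * M') = 2 ^ Suc n * (M * M')" by simp
  show ?case
  proof (rule torus_bound_SucI[OF _ has_partials_mult[OF f(1) g(1)]])
    show "torus_bound n (2 ^ Suc n * (M * M')) (\<lambda>z. f z * gt z + ft z * g z)"
      "torus_bound n (2 ^ Suc n * (M * M')) (\<lambda>z. f z * gx z + fx z * g z)"
      unfolding two[symmetric] by (intro torus_bound_add Suc.IH fg f g)+
    fix z
    have "norm (f z * g z) \<le> M * M'"
      unfolding norm_mult using Suc.prems torus_bound_D torus_bound_nonneg
      by (meson mult_mono norm_ge_zero)
    also have "\<dots> \<le> 2 ^ Suc n * (M * M')"
      using Suc.prems torus_bound_nonneg
      by (metis (no_types, opaque_lifting) mult_nonneg_nonneg mult_right_mono mult_1 one_le_power one_le_numeral)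
    finally show "norm (f z * g z) \<le> 2 ^ Suc n * (M * M')" .
  qed
qed

lemma torus_bound_fst:
  "circle_bound 1 n M r \<Longrightarrow> torus_bound n M (\<lambda>z. r (fst z))"
proof (induction n arbitrary: r)
  case (Suc n)
  obtain r' where r': "\<And>t. (r has_vector_derivative r' t) (at t)" "circle_bound 1 n M r'"
    using Suc.prems by auto
  have "has_partials (\<lambda>z. r (fst z)) (\<lambda>z. r' (fst z)) (\<lambda>z. 0)"
    unfolding has_partials_def
  proof
    fix z :: "real \<times> real"
    have "((\<lambda>z. r (fst z)) has_derivative (\<lambda>h. fst h *\<^sub>R r' (fst z))) (at z)"
      using r'(1)[of "fst z"] unfolding has_vector_derivative_def
      by (rule has_derivative_compose[OF has_derivative_fst[OF has_derivative_ident]])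
    then show "((\<lambda>z. r (fst z)) has_derivative (\<lambda>h. fst h *\<^sub>R r' (fst z) + snd h *\<^sub>R 0)) (at z)" by simp
  qed
  moreover have "torus_bound n M (\<lambda>z. 0)"
    using Suc.IH[OF circle_bound_mono[OF circle_bound_const[of 1 n 0]]] circle_bound_nonneg[OF r'(2)] by simp
  ultimately show ?case
    using Suc.IH[OF r'(2)] circle_bound_D[OF Suc.prems] by (intro torus_bound_SucI)
qed auto

lemma torus_bound_swap:
  "torus_bound n M f \<Longrightarrow> torus_bound n M (\<lambda>z. f (snd z, fst z))"
proof (induction n arbitrary: f)
  case (Suc n)
  obtain ft fx where f: "has_partials f ft fx" "torus_bound n M ft" "torus_bound n M fx"
    using Suc.prems(1) by (rule torus_bound_SucE)
  have "has_partials (\<lambda>z. f (snd z, fst z)) (\<lambda>z. fx (snd z, fst z)) (\<lambda>z. ft (snd z, fst z))"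
    unfolding has_partials_def
  proof
    fix z :: "real \<times> real"
    have "((\<lambda>z. f (snd z, fst z)) has_derivative 
      (\<lambda>h. fst (snd h, fst h) *\<^sub>R ft (snd z, fst z) + snd (snd h, fst h) *\<^sub>R fx (snd z, fst z))) (at z)"
      by (rule has_derivative_compose[of "\<lambda>z. (snd z, fst z)" "\<lambda>h. (snd h, fst h)", OF _ has_partialsD[OF f(1)]])
         (auto intro!: derivative_eq_intros)
    then show "((\<lambda>z. f (snd z, fst z)) has_derivative 
      (\<lambda>h. fst h *\<^sub>R fx (snd z, fst z) + snd h *\<^sub>R ft (snd z, fst z))) (at z)" by (simp add: add.commute)
  qed
  then show ?case
    by (rule torus_bound_SucI[OF torus_bound_D[OF Suc.prems] _ Suc.IH[OF f(3)] Suc.IH[OF f(2)]])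
qed auto

text \<open>A bound at level \<open>n + 1\<close> yields one at level \<open>n\<close> for either
  partial derivative, so having bounds at all levels is inherited along any list of
  directions.\<close>

lemma torus_bound_smooth:
  assumes "\<And>n. \<exists>M. torus_bound n M f"
  shows "smooth f"
  unfolding smooth_def
proof (intro allI impI)
  fix vs :: "(real \<times> real) list" assume "set vs \<subseteq> Basis"
  then have "\<forall>n. \<exists>M. torus_bound n M (foldr dir_deriv vs f)"
  proof (induction vs)
    case (Cons v vs)
    show ?case
    proof
      fix n
      obtain M where "torus_bound (Suc n) M (foldr dir_deriv vs f)"
        using Cons by (auto simp del: torus_bound.simps)
      then obtain ft fx where "has_partials (foldr dir_deriv vs f) ft fx" "torus_bound n M ft" "torus_bound n M fx"
        by (rule torus_bound_SucE)
      then show "\<exists>M. torus_bound n M (foldr dir_deriv (v # vs) f)"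
        using Cons.prems has_partials_dir_deriv by (auto simp: Basis_plane)
    qed
  qed (use assms in auto)
  then obtain M where "torus_bound (Suc 0) M (foldr dir_deriv vs f)" by blast
  then obtain ft fx where "has_partials (foldr dir_deriv vs f) ft fx" by (rule torus_bound_SucE)
  then show "foldr dir_deriv vs f differentiable_on UNIV"
    unfolding differentiable_on_def differentiable_def using has_partialsD by blast
qed

lemma torus_bound_power:
  assumes "torus_bound n M f" "j + k \<le> n"
  shows "norm ((dir_deriv (1, 0) ^^ j) ((dir_deriv (0, 1) ^^ k) f) z) \<le> M"
proof -
  have step: "torus_bound m M (dir_deriv v g)" if "torus_bound (Suc m) M g" "v \<in> {(1, 0), (0, 1)}" for m v g
    using that has_partials_dir_deriv by (auto elim!: torus_bound_SucE)
  have "torus_bound (n - k) M ((dir_deriv (0, 1) ^^ k) f)" if "k \<le> n" for k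
    using that
  proof (induction k)
    case (Suc k)
    then show ?case using step[of "n - Suc k" "(dir_deriv (0, 1) ^^ k) f"] by (simp add: Suc_diff_Suc)
  qed (use assms in simp)
  then have k: "torus_bound (n - k) M ((dir_deriv (0, 1) ^^ k) f)" using assms by simp
  have "torus_bound (n - k - j) M ((dir_deriv (1, 0) ^^ j) ((dir_deriv (0, 1) ^^ k) f))" if "j + k \<le> n" for j
    using that
  proof (induction j)
    case (Suc j)
    then show ?case using step[of "n - k - Suc j" "(dir_deriv (1, 0) ^^ j) ((dir_deriv (0, 1) ^^ k) f)"]
      by (simp add: Suc_diff_Suc)
  qed (use k in simp)
  then show ?thesis using assms torus_bound_D by blast
qed

lemma test_seminorm_le:
  assumes "torus_bound N M f"
  shows "test_seminorm N f \<le> (\<Sum>m\<le>N. \<Sum>j\<le>m. M)"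
  unfolding test_seminorm_def
  by (intro sum_mono cSUP_least torus_bound_power[OF assms]) auto

text \<open>Commuting derivatives brings each of them to the form with the
  \<open>x\<close>-derivatives taken first. That form is dominated by a summand of the seminorm, and
  since the summands are nonnegative, by the whole sum.\<close>

lemma test_fun_torus_bound:
  assumes "\<phi> \<in> test_fun"
  shows "torus_bound N (test_seminorm N \<phi>) \<phi>"
proof -
  let ?D = "\<lambda>j k. (dir_deriv (1, 0) ^^ j) ((dir_deriv (0, 1) ^^ k) \<phi>)"
  have sup: "norm (?D j k z) \<le> (SUP z. norm (?D j k z))" for j k z
    by (intro cSUP_upper test_fun_bounded test_fun_power assms) simp
  have nonneg: "0 \<le> (SUP z. norm (?D j k z))" for j k
    using sup norm_ge_zero order_trans by blast
  have le: "norm (?D j k z) \<le> test_seminorm N \<phi>" if "j + k \<le> N" for j k z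
  proof -
    have "norm (?D j k z) \<le> (SUP z. norm (?D j (j + k - j) z))" using sup by simp
    also have "\<dots> \<le> (\<Sum>i\<le>j + k. (SUP z. norm (?D i (j + k - i) z)))"
      by (rule member_le_sum) (use nonneg in auto)
    also have "\<dots> \<le> test_seminorm N \<phi>" unfolding test_seminorm_def
      using that by (intro member_le_sum[where f = "\<lambda>m. \<Sum>i\<le>m. (SUP z. norm (?D i (m - i) z))"])
        (auto intro!: sum_nonneg nonneg)
    finally show ?thesis .
  qed
  have "torus_bound n (test_seminorm N \<phi>) (?D j k)" if "j + k + n \<le> N" for j k n
    using that
  proof (induction n arbitrary: j k)
    case 0
    then show ?case using le by simp
  next
    case (Suc n)
    have p: "has_partials (?D j k) (?D (Suc j) k) (?D j (Suc k))"
      using test_fun_has_partials[OF test_fun_power[OF assms, of j k]]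
      unfolding test_fun_commute_power[OF assms] by simp
    show ?case
      by (rule torus_bound_SucI[OF le p Suc.IH Suc.IH]) (use Suc.prems in auto)
  qed
  from this[of 0 0 N] show ?thesis by simp
qed

section \<open>Composition of test functions with a shear\<close>

lemma has_partials_shear:
  assumes "has_partials f ft fx" "\<And>t. (B has_real_derivative b t) (at t)"
  shows "has_partials (\<lambda>z. f (fst z, snd z + B (fst z)))
     (\<lambda>z. ft (fst z, snd z + B (fst z)) + of_real (b (fst z)) * fx (fst z, snd z + B (fst z)))
     (\<lambda>z. fx (fst z, snd z + B (fst z)))"
  unfolding has_partials_def
proof
  fix z :: "real \<times> real"
  let ?G = "\<lambda>z. (fst z, snd z + B (fst z))"
  have "((\<lambda>z. B (fst z)) has_derivative (\<lambda>h. fst h * b (fst z))) (at z)"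
    using has_derivative_compose[OF has_derivative_fst[OF has_derivative_ident], of B "\<lambda>h. h * b (fst z)" z UNIV]
      assms(2)[of "fst z"] by (simp add: has_field_derivative_def mult_commute_abs)
  then have "((\<lambda>z. f (?G z)) has_derivative 
      (\<lambda>h. fst (fst h, snd h + fst h * b (fst z)) *\<^sub>R ft (?G z) + 
           snd (fst h, snd h + fst h * b (fst z)) *\<^sub>R fx (?G z))) (at z)"
    by (intro has_derivative_compose[of ?G "\<lambda>h. (fst h, snd h + fst h * b (fst z))", OF _ has_partialsD[OF assms(1)]])
       (auto intro!: derivative_eq_intros)
  then show "((\<lambda>z. f (?G z)) has_derivative (\<lambda>h. fst h *\<^sub>R (ft (?G z) + of_real (b (fst z)) * fx (?G z)) +
      snd h *\<^sub>R fx (?G z))) (at z)"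
    by (simp add: scaleR_conv_of_real algebra_simps)
qed

text \<open>By the chain rule the partials of the sheared function are the sheared
  \<open>ft + b * fx\<close> and \<open>fx\<close>, so induction on \<open>n\<close> closes. A
  \<open>C\<close> common to all \<open>f\<close> is what makes the pullback of a distribution
  continuous again.\<close>

lemma torus_bound_shear:
  assumes B: "\<And>t. (B has_real_derivative b t) (at t)" and b: "\<And>n. \<exists>M. circle_bound 1 n M (\<lambda>t. of_real (b t))"
  shows "\<exists>C\<ge>0. \<forall>M f. torus_bound n M f \<longrightarrow> torus_bound n (C * M) (\<lambda>z. f (fst z, snd z + B (fst z)))"
proof (induction n)
  case 0
  show ?case by (intro exI[of _ 1]) simp
next
  case (Suc n)
  then obtain C where C: "C \<ge> 0"
    "\<And>M f. torus_bound n M f \<Longrightarrow> torus_bound n (C * M) (\<lambda>z. f (fst z, snd z + B (fst z)))" by blast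
  obtain \<beta> where "circle_bound 1 n \<beta> (\<lambda>t. of_real (b t))" using b by blast
  then have \<beta>: "torus_bound n \<beta> (\<lambda>z. of_real (b (fst z)))" by (rule torus_bound_fst)
  then have \<beta>0: "0 \<le> \<beta>" by (rule torus_bound_nonneg)
  \<comment> \<open>The summand 1 covers the function itself, \<open>C\<close> its
    \<open>x\<close>-derivative, and the last two together its \<open>t\<close>-derivative.\<close>
  define C' where "C' = 1 + C + 2 ^ n * (\<beta> * C)"
  have "torus_bound (Suc n) (C' * M) (\<lambda>z. f (fst z, snd z + B (fst z)))" if f: "torus_bound (Suc n) M f" for M f
  proof -
    have M: "0 \<le> M" using f torus_bound_nonneg by blast
    obtain ft fx where p: "has_partials f ft fx" "torus_bound n M ft" "torus_bound n M fx"
      using f by (rule torus_bound_SucE)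
    have le: "C * M \<le> C' * M" "C * M + 2 ^ n * (\<beta> * (C * M)) \<le> C' * M" "M \<le> C' * M"
      using M C(1) \<beta>0 by (auto simp: C'_def algebra_simps intro!: add_nonneg_nonneg mult_nonneg_nonneg)
    show ?thesis
    proof (rule torus_bound_SucI[OF _ has_partials_shear[OF p(1) B]])
      show "torus_bound n (C' * M) (\<lambda>z. ft (fst z, snd z + B (fst z)) +
             of_real (b (fst z)) * fx (fst z, snd z + B (fst z)))"
        by (rule torus_bound_mono[OF _ le(2)]) (intro torus_bound_add torus_bound_mult \<beta> C(2) p)
      show "torus_bound n (C' * M) (\<lambda>z. fx (fst z, snd z + B (fst z)))"
        by (rule torus_bound_mono[OF _ le(1)]) (intro C(2) p)
      show "norm (f (fst z, snd z + B (fst z))) \<le> C' * M" for z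
        using torus_bound_D[OF f] le(3) order_trans by blast
    qed
  qed
  moreover have "C' \<ge> 0" using C(1) \<beta>0 by (simp add: C'_def)
  ultimately show ?case by blast
qed

lemma test_fun_shear:
  assumes B: "\<And>t. (B has_real_derivative b t) (at t)" and b: "\<And>n. \<exists>M. circle_bound 1 n M (\<lambda>t. of_real (b t))"
    and per: "\<And>t. B (t + 2 * pi) = B t" and \<phi>: "\<phi> \<in> test_fun"
  shows "(\<lambda>z. \<phi> (fst z, snd z + B (fst z))) \<in> test_fun"
proof -
  have "\<exists>M. torus_bound n M (\<lambda>z. \<phi> (fst z, snd z + B (fst z)))" for n
    using torus_bound_shear[OF B b, of n] test_fun_torus_bound[OF \<phi>, of n] by blast
  then have "smooth (\<lambda>z. \<phi> (fst z, snd z + B (fst z)))" by (rule torus_bound_smooth)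
  moreover have "\<phi> (t, x + 2 * pi + B t) = \<phi> (t, x + B t)" for x t
  proof -
    have "x + 2 * pi + B t = (x + B t) + 2 * pi" by simp
    then show ?thesis using \<phi> by (simp only: test_fun_def mem_Collect_eq)
  qed
  ultimately show ?thesis using \<phi> per by (simp add: test_fun_def)
qed

lemma tensor_test_fun:
  assumes "\<And>n. \<exists>M. circle_bound 1 n M r"
  shows "(\<lambda>z. r (fst z) * cis (of_int k * snd z)) \<in> test_fun"
proof -
  have "\<exists>M. torus_bound n M (\<lambda>z. r (fst z) * cis (of_int k * snd z))" for n
  proof -
    obtain M where "circle_bound 1 n M r" using assms by blast
    moreover obtain M' where "circle_bound 1 n M' (\<lambda>t. cis (of_int k * t))"
      using circle_bound_cis_int by blast
    ultimately show ?thesis 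
      using torus_bound_mult[OF torus_bound_fst torus_bound_swap[OF torus_bound_fst]] by fastforce
  qed
  then have "smooth (\<lambda>z. r (fst z) * cis (of_int k * snd z))" by (rule torus_bound_smooth)
  then show ?thesis using circle_bound_D(1) assms cis_periodic
    by (auto simp: test_fun_def) metis
qed

section \<open>Multiplication by the phase of a shear\<close>

text \<open>This collects what the argument takes from the primitive and is stable under a change of
  sign, so both signs share one proof. The bounds concern the derivative \<open>b\<close>, because
  the phase has modulus one whatever the size of \<open>B\<close>.\<close>

definition circle_shear :: "(real \<Rightarrow> real) \<Rightarrow> (real \<Rightarrow> real) \<Rightarrow> bool" where
  "circle_shear B b \<longleftrightarrow> (\<forall>t. B (t + 2 * pi) = B t) \<and> (\<forall>t. (B has_real_derivative b t) (at t)) \<and>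
     (\<forall>n. \<exists>M. circle_bound 1 n M (\<lambda>t. of_real (b t)))"

definition phase :: "(real \<Rightarrow> real) \<Rightarrow> int \<Rightarrow> real \<Rightarrow> complex" where
  "phase B \<xi> t = cis (- (of_int \<xi> * B t))"

text \<open>Each derivative brings down \<open>- \<i> * \<xi> * b\<close>, and
  \<open>|\<xi>| \<le> l\<close> pays for it with one factor of the scale. The constant is therefore
  uniform in \<xi>, as the summation over all modes demands.\<close>

lemma phase_bound:
  assumes "circle_shear B b"
  shows "\<exists>C\<ge>1. \<forall>\<xi> l. 1 \<le> l \<longrightarrow> \<bar>of_int \<xi>\<bar> \<le> l \<longrightarrow> circle_bound l n C (phase B \<xi>)"
proof (induction n)
  case 0
  show ?case using assms by (intro exI[of _ 1]) (simp add: circle_shear_def phase_def)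
next
  case (Suc n)
  then obtain C where C: "C \<ge> 1"
    "\<And>\<xi> l. 1 \<le> l \<Longrightarrow> \<bar>of_int \<xi>\<bar> \<le> l \<Longrightarrow> circle_bound l n C (phase B \<xi>)" by blast
  obtain \<beta> where \<beta>: "circle_bound 1 n \<beta> (\<lambda>t. of_real (b t))"
    using assms unfolding circle_shear_def by blast
  define C' where "C' = max 1 (2 ^ n * (\<beta> * C))"
  have "circle_bound l (Suc n) C' (phase B \<xi>)" if l: "1 \<le> l" "\<bar>of_int \<xi>\<bar> \<le> l" for \<xi> l
  proof (rule circle_bound_SucI)
    show "phase B \<xi> (t + 2 * pi) = phase B \<xi> t" "norm (phase B \<xi> t) \<le> C'" for t
      using assms by (simp_all add: phase_def circle_shear_def C'_def)
    show "(phase B \<xi> has_vector_derivative - \<i> * of_int \<xi> * (of_real (b t) * phase B \<xi> t)) (at t)" for t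
    proof -
      have B: "(B has_vector_derivative b t) (at t)"
        using assms by (simp add: circle_shear_def has_real_derivative_iff_has_vector_derivative)
      have "((\<lambda>y. cis (- of_int \<xi> * y)) \<circ> B has_vector_derivative
         b t *\<^sub>R (\<i> * of_real (- of_int \<xi>) * cis (- of_int \<xi> * B t))) (at t)"
        by (rule vector_diff_chain_at[OF B]) (rule has_vector_derivative_cis)
      then show ?thesis by (simp add: phase_def[abs_def] o_def scaleR_conv_of_real mult_ac)
    qed
    have "circle_bound l n (2 ^ n * (\<beta> * C)) (\<lambda>t. of_real (b t) * phase B \<xi> t)"
      using l circle_bound_mono[OF \<beta>, of \<beta> l] C(2) by (intro circle_bound_mult) auto
    then have "circle_bound l n (norm (- \<i> * of_int \<xi>) * (2 ^ n * (\<beta> * C))) 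
        (\<lambda>t. - \<i> * of_int \<xi> * (of_real (b t) * phase B \<xi> t))"
      using l by (intro circle_bound_cmult) auto
    then show "circle_bound l n (l * C') (\<lambda>t. - \<i> * of_int \<xi> * (of_real (b t) * phase B \<xi> t))"
    proof (rule circle_bound_mono)
      have "0 \<le> \<beta> * C" using circle_bound_nonneg[OF \<beta>] C(1) by simp
      then show "norm (- \<i> * of_int \<xi>) * (2 ^ n * (\<beta> * C)) \<le> l * C'"
        using l by (intro mult_mono) (auto simp: norm_mult C'_def)
    qed (use l in auto)
  qed
  moreover have "C' \<ge> 1" by (simp add: C'_def)
  ultimately show ?case by blast
qed

text \<open>Repeated integration by parts, \<open>h'\<close> being the m-th derivative. The level
  exceeds \<open>m\<close> by one because the L2 bound for multipliers asks \<open>h'\<close> to be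
  continuous.\<close>

lemma circle_coeff_higher_deriv:
  assumes "circle_bound l (Suc m) C h"
  shows "\<exists>h'. continuous_on UNIV h' \<and> (\<forall>t. norm (h' t) \<le> C * l ^ m) \<and>
    (\<forall>k. of_int k ^ m * circle_coeff h k = \<i> ^ m * circle_coeff h' k)"
  using assms
proof (induction m arbitrary: h C)
  case 0
  then show ?case using circle_bound_continuous[OF 0] by (intro exI[of _ h]) auto
next
  case (Suc m)
  obtain h1 where h1: "\<And>t. (h has_vector_derivative h1 t) (at t)" "circle_bound l (Suc m) (l * C) h1"
    using Suc.prems by auto
  obtain h' where h': "continuous_on UNIV h'" "\<And>t. norm (h' t) \<le> l * C * l ^ m"
    "\<And>k. of_int k ^ m * circle_coeff h1 k = \<i> ^ m * circle_coeff h' k"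
    using Suc.IH[OF h1(2)] by blast
  have "of_int k ^ Suc m * circle_coeff h k = \<i> ^ Suc m * circle_coeff h' k" for k
  proof -
    have "circle_coeff h1 k = - \<i> * of_int k * circle_coeff h k"
      by (intro circle_coeff_deriv h1 circle_bound_continuous[OF h1(2)] circle_bound_D(1)[OF Suc.prems])
    then have "of_int k * circle_coeff h k = \<i> * circle_coeff h1 k" by (simp flip: mult.assoc)
    then have "of_int k ^ Suc m * circle_coeff h k = \<i> * (of_int k ^ m * circle_coeff h1 k)"
      by (simp add: mult_ac)
    then show ?thesis unfolding h'(3) by simp
  qed
  then show ?case using h'(1,2) by (intro exI[of _ h']) (auto simp: mult_ac)
qed

lemma circle_coeff_multiplier_bounds:
  assumes "circle_bound l (Suc N) C h"
  shows "multiplier_bounds C l N (circle_coeff h)"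
  unfolding multiplier_bounds_def
proof (intro allI impI)
  fix m and F T :: "int set" and f g :: "int \<Rightarrow> complex"
  assume m: "m \<le> N" and fin: "finite F" "finite T"
  have "circle_bound l (Suc m) C h" using assms m by (intro circle_bound_lower[OF assms]) simp
  from circle_coeff_higher_deriv[OF this] obtain h' where
    h': "continuous_on UNIV h'" "\<And>t. norm (h' t) \<le> C * l ^ m"
      "\<And>k. of_int k ^ m * circle_coeff h k = \<i> ^ m * circle_coeff h' k" by blast
  have "(\<Sum>\<tau>\<in>T. \<Sum>\<sigma>\<in>F. g \<tau> * f \<sigma> * (of_int (\<sigma> - \<tau>) ^ m * circle_coeff h (\<sigma> - \<tau>))) =
     \<i> ^ m * (\<Sum>\<tau>\<in>T. \<Sum>\<sigma>\<in>F. g \<tau> * f \<sigma> * circle_coeff h' (\<sigma> - \<tau>))"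
    unfolding h'(3) sum_distrib_left by (intro sum.cong refl) (simp only: mult_ac)
  then show "norm (\<Sum>\<tau>\<in>T. \<Sum>\<sigma>\<in>F. g \<tau> * f \<sigma> * (of_int (\<sigma> - \<tau>) ^ m * circle_coeff h (\<sigma> - \<tau>)))
       \<le> C * l ^ m * (L2_set (\<lambda>\<sigma>. norm (f \<sigma>)) F * L2_set (\<lambda>\<tau>. norm (g \<tau>)) T)"
    using multiplier_bound_L2[OF fin h'(1,2), of g f] by (simp add: norm_mult norm_power)
qed

lemma japanese_ge: "1 \<le> japanese x" "\<bar>x\<bar> \<le> japanese x"
  unfolding japanese_def by (simp, rule real_le_rsqrt) simp

lemma japanese_pos: "0 < japanese x"
  using japanese_ge(1)[of x] by simp

text \<open>Both parts rest on \<open>w \<le> \<langle>x\<rangle> \<le> sqrt 2 * l * w\<close>: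
  powers \<open>p \<ge> 0\<close> compare for free, while \<open>p \<le> 0\<close> uses the second
  inequality and pays its constant. The loss of derivatives in the theorem originates here.\<close>

lemma japanese_weight:
  fixes x :: real
  assumes "1 \<le> l"
  defines "w \<equiv> max 1 (\<bar>x\<bar> / l)"
  shows "0 \<le> p \<Longrightarrow> w powr (2 * p) \<le> japanese x powr (2 * p)"
    "p \<le> 0 \<Longrightarrow> w powr (2 * p) \<le> (2 * l\<^sup>2) powr \<bar>p\<bar> * japanese x powr (2 * p)"
proof -
  have w: "w \<ge> 1" "\<bar>x\<bar> \<le> w * l" using assms(1) by (auto simp: w_def pos_divide_le_eq[symmetric])
  have "\<bar>x\<bar> / l \<le> \<bar>x\<bar>" using assms(1) by (simp add: pos_divide_le_eq mult_le_cancel_left1)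
  also have "\<dots> \<le> japanese x" by (rule japanese_ge)
  finally have le: "w \<le> japanese x" using japanese_ge(1) by (simp add: w_def)
  show "w powr (2 * p) \<le> japanese x powr (2 * p)" if "0 \<le> p"
    using le w that by (intro powr_mono2) auto
  have "(japanese x)\<^sup>2 = 1 + \<bar>x\<bar>\<^sup>2" by (simp add: japanese_def)
  also have "\<dots> \<le> (w * l)\<^sup>2 + (w * l)\<^sup>2"
    using w assms(1) mult_mono[of 1 w 1 l] by (intro add_mono power_mono one_le_power) auto
  finally have le2: "(japanese x)\<^sup>2 / (2 * l\<^sup>2) \<le> w\<^sup>2"
    using assms(1) by (simp add: pos_divide_le_eq power_mult_distrib mult_ac)
  show "w powr (2 * p) \<le> (2 * l\<^sup>2) powr \<bar>p\<bar> * japanese x powr (2 * p)" if "p \<le> 0"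
  proof -
    have sq: "y powr (2 * p) = (y\<^sup>2) powr p" if "y > 0" for y :: real
      using that by (simp add: powr_powr flip: powr_numeral)
    have "(w\<^sup>2) powr p \<le> ((japanese x)\<^sup>2 / (2 * l\<^sup>2)) powr p"
      using assms(1) that le2 japanese_pos[of x] by (intro powr_mono2') auto
    also have "\<dots> = (2 * l\<^sup>2) powr \<bar>p\<bar> * ((japanese x)\<^sup>2) powr p"
      using assms(1) that by (simp add: powr_divide powr_minus_divide abs_of_nonpos)
    finally show ?thesis using w japanese_pos[of x] by (simp add: sq)
  qed
qed

text \<open>The bilinear bound is tested against \<open>\<langle>\<tau>\<rangle>\<^sup>2\<^sup>s cnj (v \<tau>)\<close>, scaled by an optimal factor \<open>\<theta>\<close>.\<close>

lemma multiplier_sobolev_bound: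
  assumes bnd: "multiplier_bounds C l N \<kappa>" and pos: "1 \<le> l" "1 \<le> C" and N: "\<bar>s\<bar> + 1 \<le> real N"
    and a: "\<And>F. finite F \<Longrightarrow> (\<Sum>\<sigma>\<in>F. japanese (of_int \<sigma>) powr (2 * s) * (norm (a \<sigma>))\<^sup>2) \<le> R"
    and v: "\<And>\<tau>. (\<lambda>n. \<Sum>\<sigma>\<in>{- int n..int n}. \<kappa> (\<sigma> - \<tau>) * a \<sigma>) \<longlonglongrightarrow> v \<tau>"
    and T: "finite T"
  shows "(\<Sum>\<tau>\<in>T. japanese (of_int \<tau>) powr (2 * s) * (norm (v \<tau>))\<^sup>2)
     \<le> 4 * (C * 4 ^ N * 2 * 4 powr \<bar>s\<bar>)\<^sup>2 * (2 * l\<^sup>2) powr \<bar>s\<bar> * R"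
proof -
  define K where "K = C * 4 ^ N * 2 * 4 powr \<bar>s\<bar>"
  have K: "K > 0" using pos by (simp add: K_def)
  define w where "w k = max 1 (\<bar>real_of_int k\<bar> / l)" for k
  define J where "J k = japanese (of_int k)" for k
  have J: "J k > 0" for k by (simp add: J_def japanese_pos)
  \<comment> \<open>The exponents \<open>2 * s\<close> and \<open>- 2 * s\<close> both have to be
    compared. According to the sign of \<open>s\<close>, one comparison is free and the other takes
    the whole loss, so the product is the same in both cases.\<close>
  obtain E1 E2 where E: "E1 > 0" "E2 > 0" "E1 * E2 = (2 * l\<^sup>2) powr \<bar>s\<bar>"
    "\<And>k. w k powr (2 * s) \<le> E1 * J k powr (2 * s)" "\<And>k. w k powr (- 2 * s) \<le> E2 * J k powr (- 2 * s)"
  proof (cases "0 \<le> s")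
    case True
    show ?thesis
      by (rule that[of 1 "(2 * l\<^sup>2) powr \<bar>s\<bar>"])
         (use japanese_weight(1)[OF pos(1) True] japanese_weight(2)[OF pos(1), of "- s"] True pos(1)
          in \<open>auto simp: w_def J_def\<close>)
  next
    case False
    show ?thesis
      by (rule that[of "(2 * l\<^sup>2) powr \<bar>s\<bar>" 1])
         (use japanese_weight(1)[OF pos(1), of "- s"] japanese_weight(2)[OF pos(1), of s] False pos(1)
          in \<open>auto simp: w_def J_def\<close>)
  qed
  define X where "X = (\<Sum>\<tau>\<in>T. J \<tau> powr (2 * s) * (norm (v \<tau>))\<^sup>2)"
  \<comment> \<open>With this value \<open>K * E2 * \<theta>\<^sup>2 * X\<close> equals
    \<open>\<theta> * X / 2\<close>, which is absorbed on the left-hand side.\<close>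
  define \<theta> where "\<theta> = 1 / (2 * K * E2)"
  have \<theta>: "\<theta> > 0" using K E(2) by (simp add: \<theta>_def)
  define g where "g \<tau> = of_real (\<theta> * J \<tau> powr (2 * s)) * cnj (v \<tau>)" for \<tau>
  \<comment> \<open>\<open>v\<close> is given only as a limit of symmetric partial sums. Since
    \<open>T\<close> is finite, the bilinear bound passes to the limit, its right-hand side being
    independent of \<open>n\<close>.\<close>
  have lim: "(\<lambda>n. \<Sum>\<tau>\<in>T. \<Sum>\<sigma>\<in>{- int n..int n}. g \<tau> * a \<sigma> * \<kappa> (\<sigma> - \<tau>)) \<longlonglongrightarrow> (\<Sum>\<tau>\<in>T. g \<tau> * v \<tau>)"
  proof -
    have "(\<lambda>n. \<Sum>\<tau>\<in>T. g \<tau> * (\<Sum>\<sigma>\<in>{- int n..int n}. \<kappa> (\<sigma> - \<tau>) * a \<sigma>)) \<longlonglongrightarrow> (\<Sum>\<tau>\<in>T. g \<tau> * v \<tau>)"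
      by (intro tendsto_sum tendsto_mult_left v)
    then show ?thesis by (simp add: sum_distrib_left mult_ac)
  qed
  have "norm (\<Sum>\<tau>\<in>T. \<Sum>\<sigma>\<in>{- int n..int n}. g \<tau> * a \<sigma> * \<kappa> (\<sigma> - \<tau>)) \<le> K * (E1 * R + E2 * \<theta>\<^sup>2 * X)" for n
  proof -
    let ?F = "{- int n..int n}"
    have "norm (\<Sum>\<tau>\<in>T. \<Sum>\<sigma>\<in>?F. g \<tau> * a \<sigma> * \<kappa> (\<sigma> - \<tau>)) \<le> K * ((\<Sum>\<sigma>\<in>?F. w \<sigma> powr (2 * s) * (norm (a \<sigma>))\<^sup>2) + 
         (\<Sum>\<tau>\<in>T. w \<tau> powr (- 2 * s) * (norm (g \<tau>))\<^sup>2))"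
      unfolding K_def w_def by (rule weighted_multiplier_bound[OF bnd _ T]) (use pos N in auto)
    also have "\<dots> \<le> K * (E1 * R + E2 * \<theta>\<^sup>2 * X)"
    proof (intro mult_left_mono add_mono)
      have "(\<Sum>\<sigma>\<in>?F. w \<sigma> powr (2 * s) * (norm (a \<sigma>))\<^sup>2) \<le> (\<Sum>\<sigma>\<in>?F. E1 * J \<sigma> powr (2 * s) * (norm (a \<sigma>))\<^sup>2)"
        by (intro sum_mono mult_right_mono E) simp
      also have "\<dots> = E1 * (\<Sum>\<sigma>\<in>?F. J \<sigma> powr (2 * s) * (norm (a \<sigma>))\<^sup>2)"
        by (simp add: sum_distrib_left mult_ac)
      also have "\<dots> \<le> E1 * R" unfolding J_def using E(1) by (intro mult_left_mono a) auto
      finally show "(\<Sum>\<sigma>\<in>?F. w \<sigma> powr (2 * s) * (norm (a \<sigma>))\<^sup>2) \<le> E1 * R" .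
      have "(\<Sum>\<tau>\<in>T. w \<tau> powr (- 2 * s) * (norm (g \<tau>))\<^sup>2) \<le> (\<Sum>\<tau>\<in>T. E2 * J \<tau> powr (- 2 * s) * (norm (g \<tau>))\<^sup>2)"
        by (intro sum_mono mult_right_mono E) simp
      also have "\<dots> = (\<Sum>\<tau>\<in>T. E2 * \<theta>\<^sup>2 * (J \<tau> powr (2 * s) * (norm (v \<tau>))\<^sup>2))"
      proof (intro sum.cong refl)
        fix \<tau>
        have "J \<tau> powr (- 2 * s) * (J \<tau> powr (2 * s))\<^sup>2 = J \<tau> powr (2 * s)"
          using J[of \<tau>] by (simp add: power2_eq_square powr_minus)
        then have "E2 * \<theta>\<^sup>2 * (norm (v \<tau>))\<^sup>2 * (J \<tau> powr (- 2 * s) * (J \<tau> powr (2 * s))\<^sup>2) =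
           E2 * \<theta>\<^sup>2 * (norm (v \<tau>))\<^sup>2 * J \<tau> powr (2 * s)" by simp
        then show "E2 * J \<tau> powr (- 2 * s) * (norm (g \<tau>))\<^sup>2 = E2 * \<theta>\<^sup>2 * (J \<tau> powr (2 * s) * (norm (v \<tau>))\<^sup>2)"
          by (simp add: g_def norm_mult power_mult_distrib mult_ac)
      qed
      finally show "(\<Sum>\<tau>\<in>T. w \<tau> powr (- 2 * s) * (norm (g \<tau>))\<^sup>2) \<le> E2 * \<theta>\<^sup>2 * X"
        by (simp add: X_def sum_distrib_left)
    qed (use K in auto)
    finally show ?thesis .
  qed
  then have "norm (\<Sum>\<tau>\<in>T. g \<tau> * v \<tau>) \<le> K * (E1 * R + E2 * \<theta>\<^sup>2 * X)"
    by (intro LIMSEQ_le_const2[OF tendsto_norm[OF lim]]) auto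
  moreover have "(\<Sum>\<tau>\<in>T. g \<tau> * v \<tau>) = of_real (\<theta> * X)"
  proof -
    have "g \<tau> * v \<tau> = of_real (\<theta> * (J \<tau> powr (2 * s) * (norm (v \<tau>))\<^sup>2))" for \<tau>
      by (simp add: g_def complex_norm_square mult_ac flip: of_real_power)
    then show ?thesis by (simp add: X_def sum_distrib_left)
  qed
  moreover have "0 \<le> X" unfolding X_def by (intro sum_nonneg) simp
  ultimately have "\<theta> * X \<le> K * (E1 * R + E2 * \<theta>\<^sup>2 * X)" using \<theta> by (simp add: norm_mult abs_mult)
  also have "K * (E1 * R + E2 * \<theta>\<^sup>2 * X) = K * E1 * R + \<theta> * X / 2"
    using K E(2) by (simp add: \<theta>_def field_simps power2_eq_square)
  finally have "\<theta> * X / 2 \<le> K * E1 * R" by simp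
  then have "4 * K * E2 * (\<theta> * X / 2) \<le> 4 * K * E2 * (K * E1 * R)"
    using K E(2) by (intro mult_left_mono) auto
  also have "4 * K * E2 * (\<theta> * X / 2) = X" using K E(2) by (simp add: \<theta>_def)
  also have "4 * K * E2 * (K * E1 * R) = 4 * K\<^sup>2 * (E1 * E2) * R" by (simp add: power2_eq_square)
  finally show ?thesis unfolding E(3) X_def J_def K_def .
qed

section \<open>Fourier coefficients of the pullback\<close>

lemma distributionsD:
  assumes "u \<in> distributions"
  shows "\<phi> \<in> test_fun \<Longrightarrow> \<psi> \<in> test_fun \<Longrightarrow> u (\<lambda>z. \<phi> z + \<psi> z) = u \<phi> + u \<psi>"
    "\<phi> \<in> test_fun \<Longrightarrow> u (\<lambda>z. c * \<phi> z) = c * u \<phi>"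
    "\<exists>N C. \<forall>\<phi>\<in>test_fun. norm (u \<phi>) \<le> C * test_seminorm N \<phi>"
    "\<phi> \<notin> test_fun \<Longrightarrow> u \<phi> = 0"
  using assms unfolding distributions_def by blast+

definition circle_smooth :: "(real \<Rightarrow> complex) \<Rightarrow> bool" where
  "circle_smooth r \<longleftrightarrow> (\<forall>n. \<exists>M. circle_bound 1 n M r)"

text \<open>The sign of \<xi> is that of the exponential in \<open>fourier_coeff\<close>, so
  \<open>u (tensor r \<xi>)\<close> sees only the \<xi>-th mode of \<open>u\<close> in
  \<open>x\<close>.\<close>

definition tensor :: "(real \<Rightarrow> complex) \<Rightarrow> int \<Rightarrow> real \<times> real \<Rightarrow> complex" where
  "tensor r \<xi> = (\<lambda>z. r (fst z) * cis (of_int (- \<xi>) * snd z))"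

lemma circle_smooth_cis: "circle_smooth (\<lambda>t. cis (- (of_int k * t)))"
  using circle_bound_cis_int[of _ "- k"] by (simp add: circle_smooth_def)

lemma circle_smooth_add: "circle_smooth f \<Longrightarrow> circle_smooth g \<Longrightarrow> circle_smooth (\<lambda>t. f t + g t)"
  unfolding circle_smooth_def using circle_bound_add by blast

lemma circle_smooth_mult: "circle_smooth f \<Longrightarrow> circle_smooth g \<Longrightarrow> circle_smooth (\<lambda>t. f t * g t)"
  unfolding circle_smooth_def using circle_bound_mult[OF _ _ zero_le_one] by blast

lemma circle_smooth_cmult: "circle_smooth f \<Longrightarrow> circle_smooth (\<lambda>t. c * f t)"
  unfolding circle_smooth_def using circle_bound_cmult[OF _ zero_le_one] by blast

lemma circle_smooth_sum:
  assumes "finite I" "\<And>i. i \<in> I \<Longrightarrow> circle_smooth (f i)"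
  shows "circle_smooth (\<lambda>t. \<Sum>i\<in>I. f i t)"
  using assms
proof (induction I rule: finite_induct)
  case empty
  have "circle_bound 1 n (norm (0::complex)) (\<lambda>t. 0)" for n by (rule circle_bound_const) simp
  then show ?case unfolding circle_smooth_def by auto
next
  case (insert i I)
  then show ?case by (simp add: circle_smooth_add)
qed

lemma circle_smooth_phase: "circle_shear B b \<Longrightarrow> circle_smooth (phase B \<xi>)"
  unfolding circle_smooth_def
proof
  fix n assume B: "circle_shear B b"
  obtain C where "circle_bound (max 1 \<bar>of_int \<xi>\<bar>) n C (phase B \<xi>)"
    using phase_bound[OF B, of n] max.cobounded1 max.cobounded2 by metis
  then show "\<exists>M. circle_bound 1 n M (phase B \<xi>)"
    using circle_bound_rescale max.cobounded1 by blast
qed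

lemma tensor_in_test_fun: "circle_smooth r \<Longrightarrow> tensor r \<xi> \<in> test_fun"
  unfolding tensor_def circle_smooth_def by (intro tensor_test_fun) simp

lemma distribution_tensor_sum:
  assumes u: "u \<in> distributions" and "finite I" "\<And>i. i \<in> I \<Longrightarrow> circle_smooth (f i)"
  shows "u (tensor (\<lambda>t. \<Sum>i\<in>I. c i * f i t) \<xi>) = (\<Sum>i\<in>I. c i * u (tensor (f i) \<xi>))"
  using assms(2,3)
proof (induction I rule: finite_induct)
  case empty
  have "tensor (\<lambda>t. cis (- (of_int 0 * t))) \<xi> \<in> test_fun" 
    by (intro tensor_in_test_fun circle_smooth_cis)
  from distributionsD(2)[OF u this, of 0] show ?case by (simp add: tensor_def)
next
  case (insert i I)
  have "u (\<lambda>z. c i * tensor (f i) \<xi> z + tensor (\<lambda>t. \<Sum>i\<in>I. c i * f i t) \<xi> z) = 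
     u (\<lambda>z. c i * tensor (f i) \<xi> z) + u (tensor (\<lambda>t. \<Sum>i\<in>I. c i * f i t) \<xi>)"
  proof (rule distributionsD(1)[OF u])
    have "tensor (\<lambda>t. c i * f i t) \<xi> \<in> test_fun"
      using insert by (intro tensor_in_test_fun circle_smooth_cmult) auto
    then show "(\<lambda>z. c i * tensor (f i) \<xi> z) \<in> test_fun" by (simp add: tensor_def mult.assoc)
    show "tensor (\<lambda>t. \<Sum>i\<in>I. c i * f i t) \<xi> \<in> test_fun"
      using insert by (intro tensor_in_test_fun circle_smooth_sum circle_smooth_cmult) auto
  qed
  moreover have "u (\<lambda>z. c i * tensor (f i) \<xi> z) = c i * u (tensor (f i) \<xi>)"
    using insert by (intro distributionsD(2)[OF u] tensor_in_test_fun) auto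
  moreover have "tensor (\<lambda>t. \<Sum>i\<in>insert i I. c i * f i t) \<xi> = 
      (\<lambda>z. c i * tensor (f i) \<xi> z + tensor (\<lambda>t. \<Sum>i\<in>I. c i * f i t) \<xi> z)"
    using insert by (simp add: tensor_def algebra_simps fun_eq_iff)
  ultimately show ?case using insert by simp
qed

lemma fourier_coeff_tensor:
  "u (tensor (\<lambda>t. cis (- (of_int k * t))) \<xi>) = (2 * of_real pi)\<^sup>2 * fourier_coeff u k \<xi>"
proof -
  have "tensor (\<lambda>t. cis (- (of_int k * t))) \<xi> =
     (\<lambda>(t, x). exp (- \<i> * of_real (t * of_int k + x * of_int \<xi>)))"
    by (auto simp: tensor_def fun_eq_iff cis_conv_exp algebra_simps simp flip: exp_add)
  then show ?thesis by (simp add: fourier_coeff_def)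
qed

text \<open>On finite Fourier sums of \<open>r\<close> the value of \<open>u\<close> is known by
  linearity. The remainders tend to 0 together with their first \<open>N\<close> derivatives,
  \<open>N\<close> being the order of a seminorm that bounds \<open>u\<close>, so their values under
  \<open>u\<close> tend to 0.\<close>

lemma distribution_tensor_limit:
  assumes u: "u \<in> distributions" and r: "circle_smooth r"
  shows "(\<lambda>n. \<Sum>k\<in>{- int n..int n}. circle_coeff r k * ((2 * of_real pi)\<^sup>2 * fourier_coeff u k \<xi>))
    \<longlonglongrightarrow> u (tensor r \<xi>)"
proof -
  obtain N C where NC: "\<And>\<phi>. \<phi> \<in> test_fun \<Longrightarrow> norm (u \<phi>) \<le> C * test_seminorm N \<phi>"
    using distributionsD(3)[OF u] by blast
  obtain M where M: "circle_bound 1 N M (\<lambda>t. cis (of_int (- \<xi>) * t))" using circle_bound_cis_int by blast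
  then have M': "torus_bound N M (\<lambda>z. cis (of_int (- \<xi>) * snd z))"
    using torus_bound_swap[OF torus_bound_fst] by fastforce
  have smooth_sum: "circle_smooth (fourier_sum n r)" for n
    unfolding fourier_sum_def[abs_def] by (intro circle_smooth_sum circle_smooth_cmult circle_smooth_cis) simp
  define d where "d n t = r t + (- 1) * fourier_sum n r t" for n t
  have d_smooth: "circle_smooth (d n)" for n
    unfolding d_def[abs_def] by (intro circle_smooth_add circle_smooth_cmult r smooth_sum)
  have split: "u (tensor r \<xi>) - (\<Sum>k\<in>{- int n..int n}. circle_coeff r k * ((2 * of_real pi)\<^sup>2 * fourier_coeff u k \<xi>))
      = u (tensor (d n) \<xi>)" for n
  proof -
    have "u (tensor (fourier_sum n r) \<xi>) = (\<Sum>k\<in>{- int n..int n}. circle_coeff r k * ((2 * of_real pi)\<^sup>2 * fourier_coeff u k \<xi>))"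
      unfolding fourier_sum_def[abs_def] fourier_coeff_tensor[symmetric]
      by (intro distribution_tensor_sum[OF u] circle_smooth_cis) simp
    moreover have "u (tensor (fourier_sum n r) \<xi>) + u (tensor (d n) \<xi>) = u (tensor r \<xi>)"
    proof -
      have "tensor r \<xi> = (\<lambda>z. tensor (fourier_sum n r) \<xi> z + tensor (d n) \<xi> z)"
        by (simp add: tensor_def d_def fun_eq_iff algebra_simps)
      then show ?thesis using distributionsD(1)[OF u] smooth_sum d_smooth tensor_in_test_fun by presburger
    qed
    ultimately show ?thesis by (simp add: algebra_simps)
  qed
  \<comment> \<open>\<open>L\<close> gathers all factors independent of \<open>n\<close>, which
    makes the remainder at most \<open>L * \<epsilon>\<close>. Dividing \<open>e\<close> by
    \<open>L + 1\<close> covers \<open>L = 0\<close> and keeps the final inequality strict.\<close>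
  define L where "L = \<bar>C\<bar> * (\<Sum>m\<le>N. \<Sum>j\<le>m. 2 ^ N * \<bar>M\<bar>)"
  have L: "L \<ge> 0" unfolding L_def by (intro mult_nonneg_nonneg sum_nonneg) auto
  have "(\<lambda>n. u (tensor (d n) \<xi>)) \<longlonglongrightarrow> 0"
  proof (rule tendstoI)
    fix e :: real assume e: "e > 0"
    define \<epsilon> where "\<epsilon> = e / (L + 1)"
    have \<epsilon>: "\<epsilon> > 0" using e L by (simp add: \<epsilon>_def)
    have "\<forall>\<^sub>F n in sequentially. circle_bound 1 N \<epsilon> (\<lambda>t. r t - fourier_sum n r t)"
      by (rule fourier_sum_converges) (use r \<epsilon> in \<open>auto simp: circle_smooth_def\<close>)
    then show "\<forall>\<^sub>F n in sequentially. dist (u (tensor (d n) \<xi>)) 0 < e"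
    proof eventually_elim
      case (elim n)
      then have "circle_bound 1 N \<epsilon> (d n)" by (simp add: d_def[abs_def])
      then have "torus_bound N (2 ^ N * (\<epsilon> * M)) (tensor (d n) \<xi>)"
        unfolding tensor_def by (intro torus_bound_mult torus_bound_fst M')
      then have "torus_bound N (2 ^ N * (\<epsilon> * \<bar>M\<bar>)) (tensor (d n) \<xi>)"
        by (rule torus_bound_mono) (use \<epsilon> in auto)
      then have "test_seminorm N (tensor (d n) \<xi>) \<le> (\<Sum>m\<le>N. \<Sum>j\<le>m. 2 ^ N * (\<epsilon> * \<bar>M\<bar>))"
        by (rule test_seminorm_le)
      moreover have "0 \<le> test_seminorm N (tensor (d n) \<xi>)"
        by (rule torus_bound_nonneg[OF test_fun_torus_bound[OF tensor_in_test_fun[OF d_smooth]]])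
      moreover have "norm (u (tensor (d n) \<xi>)) \<le> C * test_seminorm N (tensor (d n) \<xi>)"
        by (intro NC tensor_in_test_fun d_smooth)
      ultimately have "norm (u (tensor (d n) \<xi>)) \<le> \<bar>C\<bar> * (\<Sum>m\<le>N. \<Sum>j\<le>m. 2 ^ N * (\<epsilon> * \<bar>M\<bar>))"
        by (meson abs_ge_self abs_ge_zero mult_mono order_trans)
      also have "\<dots> = L * \<epsilon>" by (simp add: L_def sum_distrib_left sum_distrib_right mult_ac)
      also have "\<dots> < e" using e L by (simp add: \<epsilon>_def divide_less_eq)
      finally show ?case by simp
    qed
  qed
  from tendsto_diff[OF tendsto_const[of "u (tensor r \<xi>)"] this] show ?thesis
    unfolding split[symmetric] by simp
qed

lemma inv_shear: "inv (\<lambda>(t, x). (t, x - B t)) = (\<lambda>z. (fst z, snd z + B (fst z)))"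
  for B :: "real \<Rightarrow> real"
  by (rule inv_unique_comp) (auto simp: fun_eq_iff)

lemma jacobian_shear:
  assumes "\<And>t. (B has_real_derivative b t) (at t)"
  shows "jacobian (\<lambda>z. (fst z, snd z + B (fst z))) z = 1"
proof -
  have "((\<lambda>z. B (fst z)) has_derivative (\<lambda>h. fst h * b (fst z))) (at z)"
    using has_derivative_compose[OF has_derivative_fst[OF has_derivative_ident], of B "\<lambda>h. h * b (fst z)" z UNIV]
      assms[of "fst z"] by (simp add: has_field_derivative_def mult_commute_abs)
  then have "((\<lambda>z. (fst z, snd z + B (fst z))) has_derivative (\<lambda>h. (fst h, snd h + fst h * b (fst z)))) (at z)"
    by (auto intro!: derivative_eq_intros)
  then have "frechet_derivative (\<lambda>z. (fst z, snd z + B (fst z))) (at z) = (\<lambda>h. (fst h, snd h + fst h * b (fst z)))"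
    by (rule frechet_derivative_at[symmetric])
  then show ?thesis by (simp add: jacobian_def)
qed

text \<open>The inverse shear has Jacobian 1, so the density factor of \<open>pullback\<close>
  disappears and only composition with \<open>x + B t\<close> is left.\<close>

lemma Psi_apply:
  assumes "circle_shear B b"
  shows "Psi B u \<phi> = (if \<phi> \<in> test_fun then u (\<lambda>z. \<phi> (fst z, snd z + B (fst z))) else 0)"
  using jacobian_shear[of B b] assms unfolding Psi_def pullback_def inv_shear
  by (simp add: circle_shear_def)

lemma circle_shear_test_fun:
  assumes "circle_shear B b" "\<phi> \<in> test_fun"
  shows "(\<lambda>z. \<phi> (fst z, snd z + B (fst z))) \<in> test_fun"
  using assms test_fun_shear[of B b \<phi>] unfolding circle_shear_def by blast

lemma Psi_distributions:
  assumes B: "circle_shear B b" and u: "u \<in> distributions"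
  shows "Psi B u \<in> distributions"
proof -
  note G = circle_shear_test_fun[OF B]
  \<comment> \<open>\<open>Psi B u\<close> asks whether its argument is a test function, so
    linearity presupposes closure of \<open>test_fun\<close> under sums and multiples.\<close>
  have add: "(\<lambda>z. \<phi> z + \<psi> z) \<in> test_fun" if "\<phi> \<in> test_fun" "\<psi> \<in> test_fun" for \<phi> \<psi>
  proof -
    have "smooth (\<lambda>z. \<phi> z + \<psi> z)"
      using torus_bound_add test_fun_torus_bound that by (intro torus_bound_smooth) blast
    then show ?thesis using that by (simp add: test_fun_def)
  qed
  have scale: "(\<lambda>z. c * \<phi> z) \<in> test_fun" if "\<phi> \<in> test_fun" for c \<phi>
  proof -
    have "\<exists>M. torus_bound n M (\<lambda>z. c * \<phi> z)" for n
      using torus_bound_mult[OF torus_bound_fst[OF circle_bound_const] test_fun_torus_bound[OF that]]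
      by fastforce
    then have "smooth (\<lambda>z. c * \<phi> z)" by (rule torus_bound_smooth)
    then show ?thesis using that by (simp add: test_fun_def)
  qed
  obtain N C where NC: "\<And>\<phi>. \<phi> \<in> test_fun \<Longrightarrow> norm (u \<phi>) \<le> C * test_seminorm N \<phi>"
    using distributionsD(3)[OF u] by blast
  obtain D where D: "D \<ge> 0" 
    "\<And>M f. torus_bound N M f \<Longrightarrow> torus_bound N (D * M) (\<lambda>z. f (fst z, snd z + B (fst z)))"
    using torus_bound_shear[of B b N] B unfolding circle_shear_def by blast
  have bound: "norm (Psi B u \<phi>) \<le> \<bar>C\<bar> * (\<Sum>m\<le>N. \<Sum>j\<le>m. D) * test_seminorm N \<phi>" if \<phi>: "\<phi> \<in> test_fun" for \<phi>
  proof -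
    let ?\<psi> = "\<lambda>z. \<phi> (fst z, snd z + B (fst z))"
    have "test_seminorm N ?\<psi> \<le> (\<Sum>m\<le>N. \<Sum>j\<le>m. D * test_seminorm N \<phi>)"
      by (intro test_seminorm_le D test_fun_torus_bound \<phi>)
    moreover have "0 \<le> test_seminorm N ?\<psi>"
      by (rule torus_bound_nonneg[OF test_fun_torus_bound[OF G[OF \<phi>]]])
    ultimately have "norm (u ?\<psi>) \<le> \<bar>C\<bar> * (\<Sum>m\<le>N. \<Sum>j\<le>m. D * test_seminorm N \<phi>)"
      using NC[OF G[OF \<phi>]] by (meson abs_ge_self abs_ge_zero mult_mono order_trans)
    then show ?thesis using \<phi> by (simp add: Psi_apply[OF B] sum_distrib_right sum_distrib_left mult_ac)
  qed
  show ?thesis unfolding distributions_def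
  proof (intro CollectI conjI ballI allI impI)
    show "\<exists>N C. \<forall>\<phi>\<in>test_fun. norm (Psi B u \<phi>) \<le> C * test_seminorm N \<phi>"
      using bound by blast
  qed (use G add scale distributionsD[OF u] in \<open>auto simp: Psi_apply[OF B]\<close>)
qed

text \<open>Shearing the exponential of frequency \<open>(\<tau>, \<xi>)\<close> keeps its
  \<xi>-mode and multiplies the factor in \<open>t\<close> by the phase. Expanding that factor in a
  Fourier series, where the exponential in \<open>t\<close> shifts the coefficients by \<tau>, gives
  the matrix of multiplication by the phase.\<close>

lemma fourier_coeff_Psi:
  assumes B: "circle_shear B b" and u: "u \<in> distributions"
  shows "(\<lambda>n. \<Sum>\<sigma>\<in>{- int n..int n}. circle_coeff (phase B \<xi>) (\<sigma> - \<tau>) * fourier_coeff u \<sigma> \<xi>)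
     \<longlonglongrightarrow> fourier_coeff (Psi B u) \<tau> \<xi>"
proof -
  define r where "r t = cis (- (of_int \<tau> * t)) * phase B \<xi> t" for t
  have r: "circle_smooth r" unfolding r_def[abs_def]
    by (intro circle_smooth_mult circle_smooth_cis circle_smooth_phase[OF B])
  have coeff: "circle_coeff r k = circle_coeff (phase B \<xi>) (k - \<tau>)" for k
  proof -
    have "r t * cis (of_int k * t) = phase B \<xi> t * cis (of_int (k - \<tau>) * t)" for t
    proof -
      have "cis (of_int (k - \<tau>) * t) = cis (- (of_int \<tau> * t)) * cis (of_int k * t)"
        by (simp add: cis_mult algebra_simps)
      then show ?thesis by (simp only: r_def mult_ac)
    qed
    then show ?thesis by (simp add: circle_coeff_def)
  qed
  have "Psi B u (tensor (\<lambda>t. cis (- (of_int \<tau> * t))) \<xi>) = u (tensor r \<xi>)"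
  proof -
    have "(\<lambda>z. tensor (\<lambda>t. cis (- (of_int \<tau> * t))) \<xi> (fst z, snd z + B (fst z))) = tensor r \<xi>"
      by (auto simp: tensor_def r_def phase_def fun_eq_iff cis_mult algebra_simps)
    then show ?thesis using tensor_in_test_fun[OF circle_smooth_cis] by (simp add: Psi_apply[OF B])
  qed
  then have eq: "fourier_coeff (Psi B u) \<tau> \<xi> = 1 / (2 * of_real pi)\<^sup>2 * u (tensor r \<xi>)"
    unfolding fourier_coeff_tensor by (simp add: field_simps)
  have "(\<lambda>n. 1 / (2 * of_real pi)\<^sup>2 * (\<Sum>k\<in>{- int n..int n}. circle_coeff r k * ((2 * of_real pi)\<^sup>2 * fourier_coeff u k \<xi>)))
    \<longlonglongrightarrow> fourier_coeff (Psi B u) \<tau> \<xi>"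
    unfolding eq by (intro tendsto_mult_left distribution_tensor_limit u r)
  then show ?thesis by (simp add: sum_distrib_left coeff)
qed

section \<open>Mixed Sobolev spaces\<close>

lemma Hmix_term_nonneg: "0 \<le> Hmix_term s1 s2 u p"
  by (cases p) (simp add: Hmix_term_def)

lemma Hmix_norm_nonneg: "0 \<le> Hmix_norm s1 s2 u"
  unfolding Hmix_norm_def by (intro real_sqrt_ge_zero infsum_nonneg Hmix_term_nonneg)

lemma sum_infsum_slices:
  fixes h :: "'a \<times> 'b \<Rightarrow> real"
  assumes h: "h summable_on UNIV" and X: "finite X"
  shows "(\<Sum>\<xi>\<in>X. infsum h (UNIV \<times> {\<xi>})) = infsum h (UNIV \<times> X)"
  using X
proof (induction X rule: finite_induct)
  case (insert \<xi> X)
  have "(UNIV :: 'a set) \<times> insert \<xi> X = UNIV \<times> {\<xi>} \<union> UNIV \<times> X" by auto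
  moreover have "infsum h (UNIV \<times> {\<xi>} \<union> UNIV \<times> X) = infsum h (UNIV \<times> {\<xi>}) + infsum h (UNIV \<times> X)"
    using insert by (intro infsum_Un_disjoint summable_on_subset_banach[OF h]) auto
  ultimately show ?case using insert by (simp del: insert_Times_insert)
qed simp

text \<open>On a fixed mode the \<xi>-weight is a constant power of
  \<open>l = \<langle>\<xi>\<rangle>\<close>, so the one-variable estimate with this
  \<open>l\<close> applies to the coefficients in \<tau>. All powers of \<open>l\<close> cancel in
  the end, and \<open>D\<close> depends on neither \<xi> nor \<open>s2\<close>.\<close>

lemma Psi_slice_bound:
  assumes B: "circle_shear B b"
  shows "\<exists>D>0. \<forall>s2. \<forall>u\<in>Hmix s1 s2. \<forall>\<xi> T. finite T \<longrightarrow>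
    (\<Sum>\<tau>\<in>T. Hmix_term s1 (s2 - \<bar>s1\<bar>) (Psi B u) (\<tau>, \<xi>)) \<le> D * infsum (Hmix_term s1 s2 u) (UNIV \<times> {\<xi>})"
proof -
  define N where "N = nat \<lceil>\<bar>s1\<bar> + 1\<rceil>"
  have N: "\<bar>s1\<bar> + 1 \<le> real N" unfolding N_def by linarith
  obtain C where C: "C \<ge> 1"
    "\<And>\<xi> l. 1 \<le> l \<Longrightarrow> \<bar>of_int \<xi>\<bar> \<le> l \<Longrightarrow> circle_bound l (Suc N) C (phase B \<xi>)"
    using phase_bound[OF B, of "Suc N"] by blast
  define K where "K = C * 4 ^ N * 2 * 4 powr \<bar>s1\<bar>"
  have K: "K > 0" using C(1) by (simp add: K_def)
  define D where "D = 4 * K\<^sup>2 * 2 powr \<bar>s1\<bar>"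
  have "(\<Sum>\<tau>\<in>T. Hmix_term s1 (s2 - \<bar>s1\<bar>) (Psi B u) (\<tau>, \<xi>)) \<le> D * infsum (Hmix_term s1 s2 u) (UNIV \<times> {\<xi>})"
    if u: "u \<in> Hmix s1 s2" and T: "finite T" for s2 u \<xi> T
  proof -
    define l where "l = japanese (of_int \<xi>)"
    have l: "1 \<le> l" "\<bar>of_int \<xi>\<bar> \<le> l" "0 < l" by (simp_all add: l_def japanese_ge japanese_pos)
    define S where "S = infsum (Hmix_term s1 s2 u) (UNIV \<times> {\<xi>})"
    have ud: "u \<in> distributions" and us: "Hmix_term s1 s2 u summable_on UNIV"
      using u by (auto simp: Hmix_def)
    have "(\<Sum>\<tau>\<in>T. japanese (of_int \<tau>) powr (2 * s1) * (norm (fourier_coeff (Psi B u) \<tau> \<xi>))\<^sup>2)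
       \<le> 4 * (C * 4 ^ N * 2 * 4 powr \<bar>s1\<bar>)\<^sup>2 * (2 * l\<^sup>2) powr \<bar>s1\<bar> * (l powr (- 2 * s2) * S)"
    proof (rule multiplier_sobolev_bound[OF circle_coeff_multiplier_bounds[OF C(2)[OF l(1,2)]] l(1) C(1) N _ _ T])
      show "(\<lambda>n. \<Sum>\<sigma>\<in>{- int n..int n}. circle_coeff (phase B \<xi>) (\<sigma> - \<tau>) * fourier_coeff u \<sigma> \<xi>)
        \<longlonglongrightarrow> fourier_coeff (Psi B u) \<tau> \<xi>" for \<tau>
        by (rule fourier_coeff_Psi[OF B ud])
      fix F :: "int set" assume F: "finite F"
      have "(\<Sum>\<sigma>\<in>F. japanese (of_int \<sigma>) powr (2 * s1) * (norm (fourier_coeff u \<sigma> \<xi>))\<^sup>2) =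
         l powr (- 2 * s2) * (\<Sum>\<sigma>\<in>F. Hmix_term s1 s2 u (\<sigma>, \<xi>))"
        unfolding sum_distrib_left
      proof (intro sum.cong refl)
        fix \<sigma>
        have "l powr (- 2 * s2) * l powr (2 * s2) = 1" using l(3) by (simp add: powr_minus)
        then have "l powr (- 2 * s2) * l powr (2 * s2) * (japanese (of_int \<sigma>) powr (2 * s1) * (norm (fourier_coeff u \<sigma> \<xi>))\<^sup>2)
          = japanese (of_int \<sigma>) powr (2 * s1) * (norm (fourier_coeff u \<sigma> \<xi>))\<^sup>2" by simp
        then show "japanese (of_int \<sigma>) powr (2 * s1) * (norm (fourier_coeff u \<sigma> \<xi>))\<^sup>2 =
          l powr (- 2 * s2) * Hmix_term s1 s2 u (\<sigma>, \<xi>)"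
          by (simp add: Hmix_term_def l_def[symmetric] mult_ac)
      qed
      also have "(\<Sum>\<sigma>\<in>F. Hmix_term s1 s2 u (\<sigma>, \<xi>)) = sum (Hmix_term s1 s2 u) (F \<times> {\<xi>})"
        by (simp add: sum.cartesian_product')
      also have "\<dots> \<le> S" unfolding S_def
        by (intro finite_sum_le_infsum summable_on_subset_banach[OF us]) (use F in \<open>auto intro: Hmix_term_nonneg\<close>)
      finally show "(\<Sum>\<sigma>\<in>F. japanese (of_int \<sigma>) powr (2 * s1) * (norm (fourier_coeff u \<sigma> \<xi>))\<^sup>2) \<le> l powr (- 2 * s2) * S"
        by (simp add: mult_left_mono)
    qed
    then have "l powr (2 * (s2 - \<bar>s1\<bar>)) * (\<Sum>\<tau>\<in>T. japanese (of_int \<tau>) powr (2 * s1) * (norm (fourier_coeff (Psi B u) \<tau> \<xi>))\<^sup>2)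
       \<le> l powr (2 * (s2 - \<bar>s1\<bar>)) * (4 * K\<^sup>2 * (2 * l\<^sup>2) powr \<bar>s1\<bar> * (l powr (- 2 * s2) * S))"
      unfolding K_def by (intro mult_left_mono) auto
    also have "\<dots> = D * (l powr (2 * (s2 - \<bar>s1\<bar>)) * l powr (2 * \<bar>s1\<bar>) * l powr (- 2 * s2)) * S"
    proof -
      have "(2 * l\<^sup>2) powr \<bar>s1\<bar> = 2 powr \<bar>s1\<bar> * l powr (2 * \<bar>s1\<bar>)"
        using l(3) by (simp add: powr_mult powr_powr flip: powr_numeral)
      then show ?thesis by (simp add: D_def)
    qed
    \<comment> \<open>Lowering the order in \<open>x\<close> by \<open>|s1|\<close> compensates
      exactly the factor \<open>l powr (2 * |s1|)\<close> lost in comparing weights.\<close>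
    also have "l powr (2 * (s2 - \<bar>s1\<bar>)) * l powr (2 * \<bar>s1\<bar>) * l powr (- 2 * s2) = 1"
      using l(3) by (simp add: algebra_simps flip: powr_add)
    finally show ?thesis
      by (simp add: S_def Hmix_term_def l_def[symmetric] sum_distrib_left mult_ac)
  qed
  moreover have "D > 0" using K by (simp add: D_def)
  ultimately show ?thesis by blast
qed

text \<open>Different modes do not interact, so the slice bounds add up. A finite set of frequency
  pairs is enlarged to the product of its projections in order to be cut into slices; the uniform
  bound on finite sums gives summability and the norm estimate at once.\<close>

lemma Psi_bounded:
  assumes B: "circle_shear B b"
  shows "\<exists>C>0. \<forall>s2. \<forall>u\<in>Hmix s1 s2. Psi B u \<in> Hmix s1 (s2 - \<bar>s1\<bar>) \<and>
    Hmix_norm s1 (s2 - \<bar>s1\<bar>) (Psi B u) \<le> C * Hmix_norm s1 s2 u"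
proof -
  obtain D where D: "D > 0" "\<And>s2 u \<xi> T. u \<in> Hmix s1 s2 \<Longrightarrow> finite T \<Longrightarrow>
    (\<Sum>\<tau>\<in>T. Hmix_term s1 (s2 - \<bar>s1\<bar>) (Psi B u) (\<tau>, \<xi>)) \<le> D * infsum (Hmix_term s1 s2 u) (UNIV \<times> {\<xi>})"
    using Psi_slice_bound[OF B, of s1] by blast
  have "Psi B u \<in> Hmix s1 (s2 - \<bar>s1\<bar>) \<and> Hmix_norm s1 (s2 - \<bar>s1\<bar>) (Psi B u) \<le> sqrt D * Hmix_norm s1 s2 u"
    if u: "u \<in> Hmix s1 s2" for s2 u
  proof -
    let ?h = "Hmix_term s1 s2 u" and ?k = "Hmix_term s1 (s2 - \<bar>s1\<bar>) (Psi B u)"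
    have ud: "u \<in> distributions" and us: "?h summable_on UNIV" using u by (auto simp: Hmix_def)
    have fin: "sum ?k P \<le> D * infsum ?h UNIV" if P: "finite P" for P
    proof -
      have "sum ?k P \<le> sum ?k (fst ` P \<times> snd ` P)"
        using P by (intro sum_mono2) (auto intro: Hmix_term_nonneg image_eqI[rotated])
      also have "\<dots> = (\<Sum>\<xi>\<in>snd ` P. \<Sum>\<tau>\<in>fst ` P. ?k (\<tau>, \<xi>))"
        unfolding sum.cartesian_product' by (rule sum.swap)
      also have "\<dots> \<le> (\<Sum>\<xi>\<in>snd ` P. D * infsum ?h (UNIV \<times> {\<xi>}))"
        using P by (intro sum_mono D(2) u) auto
      also have "\<dots> = D * infsum ?h (UNIV \<times> snd ` P)"
        using P by (simp add: sum_infsum_slices[OF us] flip: sum_distrib_left)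
      also have "\<dots> \<le> D * infsum ?h UNIV"
        using D(1) by (intro mult_left_mono infsum_mono2 summable_on_subset_banach[OF us])
          (auto intro: Hmix_term_nonneg)
      finally show ?thesis .
    qed
    have ks: "?k summable_on UNIV"
      by (rule nonneg_bdd_above_summable_on) (use fin Hmix_term_nonneg in \<open>auto intro!: bdd_aboveI2\<close>)
    moreover have "infsum ?k UNIV \<le> D * infsum ?h UNIV"
      using ks fin by (rule infsum_le_finite_sums)
    then have "Hmix_norm s1 (s2 - \<bar>s1\<bar>) (Psi B u) \<le> sqrt D * Hmix_norm s1 s2 u"
      unfolding Hmix_norm_def real_sqrt_mult[symmetric] by (rule real_sqrt_le_mono)
    ultimately show ?thesis using Psi_distributions[OF B ud] by (simp add: Hmix_def)
  qed
  then show ?thesis using D(1) by (intro exI[of _ "sqrt D"]) auto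
qed

text \<open>Continuity is phrased through norms of differences, while the bound on
  \<open>Psi\<close> speaks of members of the space, so differences must belong to it.\<close>

lemma Hmix_diff:
  assumes u: "u \<in> Hmix s1 s2" and v: "v \<in> Hmix s1 s2"
  shows "(\<lambda>\<phi>. v \<phi> - u \<phi>) \<in> Hmix s1 s2"
proof -
  have ud: "u \<in> distributions" and us: "Hmix_term s1 s2 u summable_on UNIV"
    and vd: "v \<in> distributions" and vs: "Hmix_term s1 s2 v summable_on UNIV"
    using u v by (auto simp: Hmix_def)
  note D = distributionsD[OF ud] distributionsD[OF vd]
  have "(\<lambda>\<phi>. v \<phi> - u \<phi>) \<in> distributions" unfolding distributions_def
  proof (intro CollectI conjI ballI allI impI)
    obtain N C where NC: "\<And>\<phi>. \<phi> \<in> test_fun \<Longrightarrow> norm (u \<phi>) \<le> C * test_seminorm N \<phi>"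
      using distributionsD(3)[OF ud] by blast
    obtain M E where ME: "\<And>\<phi>. \<phi> \<in> test_fun \<Longrightarrow> norm (v \<phi>) \<le> E * test_seminorm M \<phi>"
      using distributionsD(3)[OF vd] by blast
    \<comment> \<open>The two functionals may be bounded by seminorms of different orders
      \<open>N\<close> and \<open>M\<close>; the seminorms increase with the order, so
      \<open>N + M\<close> dominates both.\<close>
    have mono: "0 \<le> test_seminorm n \<phi>" "test_seminorm n \<phi> \<le> test_seminorm (N + M) \<phi>"
      if "n \<le> N + M" "\<phi> \<in> test_fun" for n \<phi>
    proof -
      show "0 \<le> test_seminorm n \<phi>" using torus_bound_nonneg[OF test_fun_torus_bound[OF that(2)]] .
      have "0 \<le> (SUP z. norm ((dir_deriv (1, 0) ^^ j) ((dir_deriv (0, 1) ^^ k) \<phi>) z))" for j k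
        by (rule order_trans[OF norm_ge_zero cSUP_upper[OF UNIV_I test_fun_bounded[OF test_fun_power[OF that(2)]]]])
      then show "test_seminorm n \<phi> \<le> test_seminorm (N + M) \<phi>"
        unfolding test_seminorm_def using that(1) by (intro sum_mono2 sum_nonneg) auto
    qed
    have "norm (v \<phi> - u \<phi>) \<le> (\<bar>C\<bar> + \<bar>E\<bar>) * test_seminorm (N + M) \<phi>" if "\<phi> \<in> test_fun" for \<phi>
    proof -
      have "norm (u \<phi>) \<le> \<bar>C\<bar> * test_seminorm (N + M) \<phi>"
        using NC[OF that] mono[OF _ that, of N] by (meson abs_ge_self abs_ge_zero le_add1 mult_mono order_trans)
      moreover have "norm (v \<phi>) \<le> \<bar>E\<bar> * test_seminorm (N + M) \<phi>"
        using ME[OF that] mono[OF _ that, of M] by (meson abs_ge_self abs_ge_zero le_add2 mult_mono order_trans)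
      ultimately show ?thesis
        using norm_triangle_ineq4[of "v \<phi>" "u \<phi>"] by (simp add: distrib_right)
    qed
    then show "\<exists>N C. \<forall>\<phi>\<in>test_fun. norm (v \<phi> - u \<phi>) \<le> C * test_seminorm N \<phi>" by blast
  qed (simp_all add: D algebra_simps)
  moreover have "Hmix_term s1 s2 (\<lambda>\<phi>. v \<phi> - u \<phi>) summable_on UNIV"
  proof (rule summable_on_comparison_test)
    show "(\<lambda>p. 2 * (Hmix_term s1 s2 v p + Hmix_term s1 s2 u p)) summable_on UNIV"
      by (intro summable_on_cmult_right summable_on_add us vs)
    fix p :: "int \<times> int"
    obtain \<tau> \<xi> where p: "p = (\<tau>, \<xi>)" by (cases p)
    let ?a = "fourier_coeff v \<tau> \<xi>" and ?b = "fourier_coeff u \<tau> \<xi>"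
    have "(norm (?a - ?b))\<^sup>2 \<le> (norm ?a + norm ?b)\<^sup>2"
      by (intro power_mono norm_triangle_ineq4) simp
    also have "\<dots> \<le> 2 * ((norm ?a)\<^sup>2 + (norm ?b)\<^sup>2)"
      using sum_squares_bound[of "norm ?a" "norm ?b"] by (simp add: power2_sum)
    finally have le: "(norm (?a - ?b))\<^sup>2 \<le> 2 * ((norm ?a)\<^sup>2 + (norm ?b)\<^sup>2)" .
    have "fourier_coeff (\<lambda>\<phi>. v \<phi> - u \<phi>) \<tau> \<xi> = ?a - ?b"
      by (simp add: fourier_coeff_def diff_divide_distrib)
    then have "Hmix_term s1 s2 (\<lambda>\<phi>. v \<phi> - u \<phi>) p \<le>
      japanese (of_int \<tau>) powr (2 * s1) * japanese (of_int \<xi>) powr (2 * s2) * (2 * ((norm ?a)\<^sup>2 + (norm ?b)\<^sup>2))"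
      using le by (simp add: p Hmix_term_def mult_left_mono)
    also have "\<dots> = 2 * (Hmix_term s1 s2 v p + Hmix_term s1 s2 u p)"
      by (simp add: p Hmix_term_def algebra_simps)
    finally show "Hmix_term s1 s2 (\<lambda>\<phi>. v \<phi> - u \<phi>) p \<le> 2 * (Hmix_term s1 s2 v p + Hmix_term s1 s2 u p)" .
  qed (rule Hmix_term_nonneg)
  ultimately show ?thesis by (simp add: Hmix_def)
qed

text \<open>The difference of two pullbacks is the pullback of the difference, so boundedness gives
  continuity with \<open>\<delta> = \<epsilon> / C\<close>.\<close>

lemma Psi_continuous:
  assumes B: "circle_shear B b" and C: "C > 0"
    and bnd: "\<And>u. u \<in> Hmix s1 s2 \<Longrightarrow> Psi B u \<in> Hmix r1 r2 \<and> Hmix_norm r1 r2 (Psi B u) \<le> C * Hmix_norm s1 s2 u"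
  shows "Hmix_continuous s1 s2 r1 r2 (Psi B)"
  unfolding Hmix_continuous_def
proof (intro conjI ballI allI impI)
  fix u and \<epsilon> :: real assume u: "u \<in> Hmix s1 s2" and \<epsilon>: "\<epsilon> > 0"
  have "Hmix_norm r1 r2 (\<lambda>\<phi>. Psi B v \<phi> - Psi B u \<phi>) < \<epsilon>"
    if v: "v \<in> Hmix s1 s2" and less: "Hmix_norm s1 s2 (\<lambda>\<phi>. v \<phi> - u \<phi>) < \<epsilon> / C" for v
  proof -
    have "(\<lambda>\<phi>. Psi B v \<phi> - Psi B u \<phi>) = Psi B (\<lambda>\<phi>. v \<phi> - u \<phi>)"
      by (simp add: fun_eq_iff Psi_apply[OF B])
    then have "Hmix_norm r1 r2 (\<lambda>\<phi>. Psi B v \<phi> - Psi B u \<phi>) \<le> C * Hmix_norm s1 s2 (\<lambda>\<phi>. v \<phi> - u \<phi>)"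
      using bnd[OF Hmix_diff[OF u v]] by simp
    also have "\<dots> < \<epsilon>" using less C by (simp add: pos_less_divide_eq mult.commute)
    finally show ?thesis .
  qed
  then show "\<exists>\<delta>>0. \<forall>v\<in>Hmix s1 s2. Hmix_norm s1 s2 (\<lambda>\<phi>. v \<phi> - u \<phi>) < \<delta> \<longrightarrow>
      Hmix_norm r1 r2 (\<lambda>\<phi>. Psi B v \<phi> - Psi B u \<phi>) < \<epsilon>"
    using \<epsilon> C by (intro exI[of _ "\<epsilon> / C"]) auto
qed (use bnd in blast)

section \<open>The mean-free primitive\<close>

lemma smooth_circle_deriv:
  assumes "a \<in> smooth_circle"
  shows "(a has_real_derivative dir_deriv 1 a t) (at t)" "dir_deriv 1 a \<in> smooth_circle"
proof -
  have D: "(a has_real_derivative dir_deriv 1 a t) (at t)" for t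
  proof -
    have d: "(a has_derivative frechet_derivative a (at t)) (at t)"
      using assms smooth_differentiable by (auto simp: smooth_circle_def frechet_derivative_works[symmetric])
    have "frechet_derivative a (at t) h = dir_deriv 1 a t * h" for h
      using linear_scale[OF has_derivative_linear[OF d], of h 1] by (simp add: dir_deriv_def)
    then have "frechet_derivative a (at t) = (*) (dir_deriv 1 a t)" by (rule ext)
    then show ?thesis using d by (simp add: has_field_derivative_def)
  qed
  show "(a has_real_derivative dir_deriv 1 a t) (at t)" by (rule D)
  have "dir_deriv 1 a (t + 2 * pi) = dir_deriv 1 a t" for t
  proof -
    have "((\<lambda>t. a (t + 2 * pi)) has_real_derivative dir_deriv 1 a (t + 2 * pi) * 1) (at t)"
      by (rule DERIV_chain2[OF D]) (auto intro!: derivative_eq_intros)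
    then have "(a has_real_derivative dir_deriv 1 a (t + 2 * pi)) (at t)"
      using assms by (simp add: smooth_circle_def)
    then show ?thesis using D DERIV_unique by blast
  qed
  then show "dir_deriv 1 a \<in> smooth_circle"
    using assms smooth_dir_deriv[of a 1] by (simp add: smooth_circle_def)
qed

lemma smooth_circle_bound:
  assumes "a \<in> smooth_circle"
  shows "\<exists>M. circle_bound 1 n M (\<lambda>t. of_real (a t))"
  using assms
proof (induction n arbitrary: a)
  case 0
  have "continuous_on UNIV a"
    using smooth_circle_deriv(1)[OF 0] by (auto intro!: continuous_at_imp_continuous_on DERIV_isCont)
  then obtain M where "\<And>t. norm (a t) \<le> M"
    using periodic_continuous_bounded[of a] 0 by (auto simp: smooth_circle_def)
  then show ?case using 0 by (auto simp: smooth_circle_def)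
next
  case (Suc n)
  have "continuous_on UNIV a"
    using smooth_circle_deriv(1)[OF Suc.prems] by (auto intro!: continuous_at_imp_continuous_on DERIV_isCont)
  then obtain M where M: "\<And>t. norm (a t) \<le> M"
    using periodic_continuous_bounded[of a] Suc.prems by (auto simp: smooth_circle_def)
  obtain M' where M': "circle_bound 1 n M' (\<lambda>t. of_real (dir_deriv 1 a t))"
    using Suc.IH[OF smooth_circle_deriv(2)[OF Suc.prems]] by blast
  have "circle_bound 1 (Suc n) (max M M') (\<lambda>t. of_real (a t))"
  proof (rule circle_bound_SucI)
    show "complex_of_real (a (t + 2 * pi)) = of_real (a t)" "norm (complex_of_real (a t)) \<le> max M M'" for t
      using Suc.prems M[of t] by (auto simp: smooth_circle_def)
    show "((\<lambda>t. complex_of_real (a t)) has_vector_derivative of_real (dir_deriv 1 a t)) (at t)" for t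
      using smooth_circle_deriv(1)[OF Suc.prems] by (intro has_vector_derivative_of_real) 
        (simp add: has_real_derivative_iff_has_vector_derivative)
    show "circle_bound 1 n (1 * max M M') (\<lambda>t. of_real (dir_deriv 1 a t))"
      by (rule circle_bound_mono[OF M']) auto
  qed
  then show ?case by blast
qed

text \<open>Periodicity of \<open>a\<close> makes \<open>A (t + 2 * pi) - A t\<close> constant in
  \<open>t\<close>, and at \<open>t = 0\<close> the constant is the integral of
  \<open>a - mean a\<close> over one period, which is 0.\<close>

lemma mean_free_primitive_shear:
  assumes a: "a \<in> smooth_circle"
  shows "circle_shear (mean_free_primitive a) (\<lambda>t. a t - mean a)"
  unfolding circle_shear_def
proof (intro conjI allI)
  let ?A = "mean_free_primitive a" and ?b = "\<lambda>t. a t - mean a"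
  have ca: "continuous_on S a" for S
    using smooth_circle_deriv(1)[OF a] continuous_on_subset[of UNIV a S]
    by (auto intro!: continuous_at_imp_continuous_on DERIV_isCont)
  have per: "a (t + 2 * pi) = a t" for t using a by (simp add: smooth_circle_def)
  have D: "(?A has_real_derivative ?b t) (at t)" for t
  proof -
    \<comment> \<open>The fundamental theorem is applied on a bounded interval with 0 and
      \<open>t\<close> in its interior, so that the derivative within the interval is the full one
      and negative \<open>t\<close> are included.\<close>
    let ?m = "\<bar>t\<bar> + 1"
    have "((\<lambda>u. LBINT y=(0::real)..u. a y - mean a) has_vector_derivative ?b t) (at t within {- ?m..?m})"
      by (rule interval_integral_FTC2) (auto intro!: continuous_intros ca)
    moreover have "t \<in> {- ?m<..<?m}" by auto
    ultimately have "((\<lambda>u. LBINT y=(0::real)..u. a y - mean a) has_vector_derivative ?b t) (at t)"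
      by (subst (asm) at_within_Icc_at) auto
    then show ?thesis
      by (simp add: mean_free_primitive_def[abs_def] has_real_derivative_iff_has_vector_derivative zero_ereal_def)
  qed
  show "(?A has_real_derivative ?b t) (at t)" for t by (rule D)
  show "?A (t + 2 * pi) = ?A t" for t
  proof -
    have "((\<lambda>t. ?A (t + 2 * pi) - ?A t) has_real_derivative 0) (at t)" for t
    proof -
      have "((\<lambda>t. ?A (t + 2 * pi)) has_real_derivative ?b (t + 2 * pi) * 1) (at t)"
        by (rule DERIV_chain2[OF D]) (auto intro!: derivative_eq_intros)
      from DERIV_diff[OF this D] show ?thesis by (simp add: per)
    qed
    then have "?A (t + 2 * pi) - ?A t = ?A (0 + 2 * pi) - ?A 0"
      by (intro DERIV_isconst_all) blast
    also have "?A 0 = 0" by (simp add: mean_free_primitive_def zero_ereal_def)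
    also have "?A (0 + 2 * pi) = 0"
    proof -
      have "?A (2 * pi) = (LBINT t=0..2*pi. a t) - (LBINT t=0..2*pi. mean a)"
        unfolding mean_free_primitive_def
        unfolding zero_ereal_def
        by (intro interval_lebesgue_integral_diff interval_integrable_continuous_on ca continuous_on_const) simp_all
      also have "(LBINT t=0..2*pi. mean a) = 2 * pi * mean a"
        by (simp add: zero_ereal_def)
      also have "\<dots> = (LBINT t=0..2*pi. a t)" by (simp add: mean_def)
      finally show ?thesis by simp
    qed
    finally show ?thesis by simp
  qed
  show "\<exists>M. circle_bound 1 n M (\<lambda>t. of_real (?b t))" for n
  proof -
    obtain M where "circle_bound 1 n M (\<lambda>t. of_real (a t))" using smooth_circle_bound[OF a] by blast
    then have "circle_bound 1 n (M + norm (complex_of_real (- mean a))) (\<lambda>t. of_real (a t) + of_real (- mean a))"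
      by (intro circle_bound_add circle_bound_const) auto
    then show ?thesis by auto
  qed
qed

lemma circle_shear_minus:
  assumes "circle_shear B b"
  shows "circle_shear (\<lambda>t. - B t) (\<lambda>t. - b t)"
proof -
  have "\<exists>M. circle_bound 1 n M (\<lambda>t. of_real (- b t))" for n
  proof -
    obtain M where "circle_bound 1 n M (\<lambda>t. of_real (b t))" using assms unfolding circle_shear_def by blast
    from circle_bound_cmult[OF this, of "- 1"] show ?thesis by auto
  qed
  then show ?thesis using assms by (auto simp: circle_shear_def intro: DERIV_minus)
qed

text \<open>\<open>C\<close> is chosen before \<open>a\<close> and \<open>s2\<close>, hence depends
  on \<open>A\<close> and \<open>s1\<close> alone. The two signs are two shears with their own
  constants, joined by a maximum.\<close>

theorem proposition6p3:
  fixes A :: "real \<Rightarrow> real" and s1 :: real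
  shows "\<exists>C>0. \<forall>a\<in>smooth_circle. A = mean_free_primitive a \<longrightarrow>
    (\<forall>s2. \<forall>B\<in>{A, \<lambda>t. - A t}.
       Hmix_continuous s1 s2 s1 (s2 - \<bar>s1\<bar>) (Psi B) \<and>
       (\<forall>u\<in>Hmix s1 s2. Hmix_norm s1 (s2 - \<bar>s1\<bar>) (Psi B u) \<le> C * Hmix_norm s1 s2 u))"
proof (cases "\<exists>a\<in>smooth_circle. A = mean_free_primitive a")
  case True
  then obtain b where A: "circle_shear A b" using mean_free_primitive_shear by blast
  have mA: "circle_shear (\<lambda>t. - A t) (\<lambda>t. - b t)" using A by (rule circle_shear_minus)
  obtain C1 where C1: "C1 > 0" "\<And>s2 u. u \<in> Hmix s1 s2 \<Longrightarrow> Psi A u \<in> Hmix s1 (s2 - \<bar>s1\<bar>) \<and>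
    Hmix_norm s1 (s2 - \<bar>s1\<bar>) (Psi A u) \<le> C1 * Hmix_norm s1 s2 u"
    using Psi_bounded[OF A] by blast
  obtain C2 where C2: "C2 > 0" "\<And>s2 u. u \<in> Hmix s1 s2 \<Longrightarrow> Psi (\<lambda>t. - A t) u \<in> Hmix s1 (s2 - \<bar>s1\<bar>) \<and>
    Hmix_norm s1 (s2 - \<bar>s1\<bar>) (Psi (\<lambda>t. - A t) u) \<le> C2 * Hmix_norm s1 s2 u"
    using Psi_bounded[OF mA] by blast
  have "Hmix_norm s1 (s2 - \<bar>s1\<bar>) (Psi B u) \<le> max C1 C2 * Hmix_norm s1 s2 u"
    if "B \<in> {A, \<lambda>t. - A t}" "u \<in> Hmix s1 s2" for B s2 u
  proof -
    have "C1 * Hmix_norm s1 s2 u \<le> max C1 C2 * Hmix_norm s1 s2 u"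
      "C2 * Hmix_norm s1 s2 u \<le> max C1 C2 * Hmix_norm s1 s2 u"
      by (intro mult_right_mono Hmix_norm_nonneg; simp)+
    then show ?thesis using that C1(2)[OF that(2)] C2(2)[OF that(2)] by (elim insertE) (auto intro: order_trans)
  qed
  moreover have "Hmix_continuous s1 s2 s1 (s2 - \<bar>s1\<bar>) (Psi B)" if "B \<in> {A, \<lambda>t. - A t}" for B s2
    using that Psi_continuous[OF A C1] Psi_continuous[OF mA C2] by blast
  moreover have "max C1 C2 > 0" using C1(1) by simp
  ultimately show ?thesis by (intro exI[of _ "max C1 C2"]) simp
next
  case False
  \<comment> \<open>If \<open>A\<close> is no mean-free primitive of a smooth periodic function, the
    claim is vacuous and any positive constant will do.\<close>
  then show ?thesis by (intro exI[of _ 1]) auto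
qed

end
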